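(* Let $M$ be a pointwise $k$-slant submanifold of a Kähler manifold $(\bar M,\varphi,g)$, with associated orthogonal decomposition $TM=\mathcal D_0\oplus\mathcal D_1\oplus\dots\oplus\mathcal D_k$ and slant functions $\theta_0=0,\theta_1,\dots,\theta_k$. If $\nabla T=0$, then: (i) $\mathcal D_0$ and $\oplus_{i=1}^k\mathcal D_i$ are completely integrable distributions; (ii) for $i\in\{0,\dots,k\}$ with $\theta_j(p)\neq\frac{\pi}{2}$ for all $p\in M$ and all $j\neq i$, $j\in\{0,\dots,k\}$, $\mathcal D_i$ is an integrable distribution if and only if, for all $X,Y\in\Gamma(\mathcal D_i)$, $$\nabla_XTY-\nabla_YTX\in\Gamma(\mathcal D_i);$$ (iii) either $M$ is a $(\mathcal D_0,\mathcal D_0)$-totally geodesic submanifold of $\bar M$ (i.e., $h(X,Y)=0$ for all $X,Y\in\Gamma(\mathcal D_0)$), or $-1$ is an eigenvalue of $n^2$, and, for $X,Y\in\Gamma(\mathcal D_0)$, any nonzero $h(X,Y)$ is an eigenvector for it.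
   Context: An almost Hermitian manifold $(\bar M,\varphi,g)$ is a Riemannian manifold $(\bar M,g)$ with a $(1,1)$-tensor field $\varphi$ such that $\varphi^2=-I$ and $g(\varphi\cdot,\varphi\cdot)=g$. Here it is called Kähler if $\bar\nabla\varphi=0$, where $\bar\nabla$ is the Levi-Civita connection of $g$. Let $M$ be a submanifold of $\bar M$ defined by an injective immersion, with induced metric also denoted $g$ and Levi-Civita connection $\nabla$. The second fundamental form $h$ is given by $\bar\nabla_XY=\nabla_XY+h(X,Y)$ for $X,Y\in\Gamma(TM)$. For $X\in\Gamma(TM)$ and $V\in\Gamma(T^\bot M)$ write $\varphi X=TX+NX$ and $\varphi V=tV+nV$, with $TX,tV$ tangent and $NX,nV$ normal to $M$. Put $(\nabla_XT)Y:=\nabla_XTY-T(\nabla_XY)$; $\nabla T=0$ means $(\nabla_XT)Y=0$ for all $X,Y\in\Gamma(TM)$. A distribution $\mathcal D\subseteq TM$ is pointwise slant if, at each $p\in M$, the angle $\theta(p)$ between $\varphi X_p$ and $\mathcal D_p$ is nonzero and independent of the choice of $X_p\in\mathcal D_p\setminus\{0\}$; $\theta$ is its slant function. $M$ is a pointwise $k$-slant submanifold of $\bar M$ ($k\in\mathbb N$, $k\ge1$) if there exist mutually orthogonal smooth regular (constant rank) distributions $\mathcal D_0,\dots,\mathcal D_k$ on $M$ such that: $TM=\mathcal D_0\oplus\mathcal D_1\oplus\dots\oplus\mathcal D_k$; $T(\mathcal D_i)\subseteq\mathcal D_i$ for $i\in\{1,\dots,k\}$; $\mathcal D_0$ is invariant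 ($\varphi(\mathcal D_0)\subseteq\mathcal D_0$), possibly trivial; and $\mathcal D_1,\dots,\mathcal D_k$ are nontrivial pointwise slant distributions with slant functions $\theta_i(p)\in(0,\frac{\pi}{2}]$ that are pointwise distinct ($\theta_i(p)\ne\theta_j(p)$ for all $p\in M$ and $i\ne j$). By convention $\theta_0=0$. A distribution $\mathcal D$ is integrable if $[X,Y]\in\Gamma(\mathcal D)$ for all $X,Y\in\Gamma(\mathcal D)$, and completely integrable if $\nabla_XY\in\Gamma(\mathcal D)$ for all $X,Y\in\Gamma(\mathcal D)$. Eigenvalues and eigenvectors of $n^2$ are understood on sections: $\lambda$ is an eigenvalue of $n^2$ with eigenvector $V$ if $V\in\Gamma(T^\bot M)$ is a nonzero section with $n^2V=\lambda V$. *)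

theory Defs
  imports "HOL-Analysis.Analysis"
begin

section \<open>Smooth manifolds modelled on a Euclidean space\<close>

text \<open>
  The point set of a manifold is a (Hausdorff, second countable) type \<open>'m\<close>, the model space is a
  Euclidean space \<open>'e\<close>, and the smooth structure is given by an atlas.
\<close>

text \<open>Only used for open \<open>S\<close> and finite-dimensional \<open>'a\<close>.\<close>

primrec Ck_on :: "nat \<Rightarrow> ('a::real_normed_vector \<Rightarrow> 'b::real_normed_vector) \<Rightarrow> 'a set \<Rightarrow> bool" where
  "Ck_on 0 f S = continuous_on S f"
| "Ck_on (Suc k) f S =
     ((\<forall>x\<in>S. f differentiable (at x)) \<and> (\<forall>v. Ck_on k (\<lambda>x. frechet_derivative f (at x) v) S))"

definition smooth_on :: "'a::real_normed_vector set \<Rightarrow> ('a \<Rightarrow> 'b::real_normed_vector) \<Rightarrow> bool" where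
  "smooth_on S f \<longleftrightarrow> (\<forall>k. Ck_on k f S)"

type_synonym ('m, 'e) chart = "'m set \<times> ('m \<Rightarrow> 'e)"

definition chart_inv :: "('m, 'e) chart \<Rightarrow> 'e \<Rightarrow> 'm" where
  "chart_inv C = inv_into (fst C) (snd C)"

definition is_chart :: "('m::topological_space, 'e::euclidean_space) chart \<Rightarrow> bool" where
  "is_chart C \<longleftrightarrow> open (fst C) \<and> open (snd C ` fst C) \<and>
     homeomorphism (fst C) (snd C ` fst C) (snd C) (chart_inv C)"

definition smooth_atlas ::
  "('m::{t2_space,second_countable_topology}, 'e::euclidean_space) chart set \<Rightarrow> bool" where
  "smooth_atlas A \<longleftrightarrow>
     (\<forall>C\<in>A. is_chart C) \<and>
     (\<forall>p. \<exists>C\<in>A. p \<in> fst C) \<and>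
     (\<forall>C\<in>A. \<forall>C'\<in>A. smooth_on (snd C ` (fst C \<inter> fst C')) (snd C' \<circ> chart_inv C))"

definition smooth_fun ::
  "('m::topological_space, 'e::euclidean_space) chart set \<Rightarrow> 'm set
    \<Rightarrow> ('m \<Rightarrow> 'b::real_normed_vector) \<Rightarrow> bool" where
  "smooth_fun A S u \<longleftrightarrow> (\<forall>C\<in>A. smooth_on (snd C ` (fst C \<inter> S)) (u \<circ> chart_inv C))"

definition smooth_map ::
  "('m::topological_space, 'e::euclidean_space) chart set
    \<Rightarrow> ('n::topological_space, 'f::euclidean_space) chart set \<Rightarrow> ('m \<Rightarrow> 'n) \<Rightarrow> bool" where
  "smooth_map A B f \<longleftrightarrow> continuous_on UNIV f \<and>
     (\<forall>C\<in>A. \<forall>C'\<in>B. smooth_on (snd C ` (fst C \<inter> f -` fst C')) (snd C' \<circ> f \<circ> chart_inv C))"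


section \<open>Tangent vectors and vector fields\<close>

text \<open>
  Every point \<open>p\<close> has a preferred chart \<open>chart_at A p\<close>, and the tangent space at \<open>p\<close> is realised
  as the model space \<open>'e\<close>: the element \<open>v\<close> of \<open>'e\<close> stands for the tangent vector at \<open>p\<close> whose
  components in the preferred chart at \<open>p\<close> are \<open>v\<close>.  Since the preferred chart varies with the
  point in an arbitrary way, smoothness of a vector field \<open>X :: 'm \<Rightarrow> 'e\<close> is not smoothness of
  \<open>X\<close> as a map; it is expressed by the components in a fixed chart.
\<close>

definition chart_at :: "('m, 'e) chart set \<Rightarrow> 'm \<Rightarrow> ('m, 'e) chart" where
  "chart_at A p = (SOME C. C \<in> A \<and> p \<in> fst C)"

text \<open>\<open>tcomp A C p v\<close>: the components in the chart \<open>C\<close> of the tangent vector \<open>v\<close> at \<open>p\<close>.\<close>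

definition tcomp ::
  "('m, 'e::euclidean_space) chart set \<Rightarrow> ('m, 'e) chart \<Rightarrow> 'm \<Rightarrow> 'e \<Rightarrow> 'e" where
  "tcomp A C p v =
     frechet_derivative (snd C \<circ> chart_inv (chart_at A p)) (at (snd (chart_at A p) p)) v"

text \<open>
  The vector field on the domain of \<open>C\<close> with constant components \<open>b\<close> in \<open>C\<close>; for \<open>b\<close> in \<open>Basis\<close>
  these are the coordinate vector fields of \<open>C\<close>.
\<close>

definition coord_field ::
  "('m, 'e::euclidean_space) chart set \<Rightarrow> ('m, 'e) chart \<Rightarrow> 'e \<Rightarrow> 'm \<Rightarrow> 'e" where
  "coord_field A C b p =
     frechet_derivative (snd (chart_at A p) \<circ> chart_inv C) (at (snd C p)) b"

text \<open>The derivative of \<open>u\<close> at \<open>p\<close> in the direction of the tangent vector \<open>v\<close> at \<open>p\<close>.\<close>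

definition dir_deriv ::
  "('m, 'e::euclidean_space) chart set \<Rightarrow> 'm \<Rightarrow> 'e \<Rightarrow> ('m \<Rightarrow> 'b::real_normed_vector) \<Rightarrow> 'b" where
  "dir_deriv A p v u =
     frechet_derivative (u \<circ> chart_inv (chart_at A p)) (at (snd (chart_at A p) p)) v"

text \<open>The differential of \<open>f\<close> at \<open>p\<close>.\<close>

definition tmap ::
  "('m, 'e::euclidean_space) chart set \<Rightarrow> ('n, 'f::euclidean_space) chart set \<Rightarrow> ('m \<Rightarrow> 'n)
    \<Rightarrow> 'm \<Rightarrow> 'e \<Rightarrow> 'f" where
  "tmap A B f p v = dir_deriv A p v (snd (chart_at B (f p)) \<circ> f)"

text \<open>Smooth vector fields on an open set \<open>S\<close>; values outside \<open>S\<close> are irrelevant.\<close>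

definition smooth_vf ::
  "('m::topological_space, 'e::euclidean_space) chart set \<Rightarrow> 'm set \<Rightarrow> ('m \<Rightarrow> 'e) \<Rightarrow> bool" where
  "smooth_vf A S X \<longleftrightarrow>
     (\<forall>C\<in>A. smooth_on (snd C ` (fst C \<inter> S)) ((\<lambda>p. tcomp A C p (X p)) \<circ> chart_inv C))"

text \<open>
  Smooth vector fields along \<open>f\<close>, i.e. smooth sections of the pullback bundle: \<open>V p\<close> is a tangent
  vector of the target at \<open>f p\<close>.
\<close>

definition smooth_vf_along ::
  "('m::topological_space, 'e::euclidean_space) chart set
    \<Rightarrow> ('n::topological_space, 'f::euclidean_space) chart set \<Rightarrow> ('m \<Rightarrow> 'n) \<Rightarrow> ('m \<Rightarrow> 'f) \<Rightarrow> bool" where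
  "smooth_vf_along A B f V \<longleftrightarrow>
     (\<forall>C\<in>A. \<forall>C'\<in>B. smooth_on (snd C ` (fst C \<inter> f -` fst C'))
        ((\<lambda>p. tcomp B C' (f p) (V p)) \<circ> chart_inv C))"

text \<open>\<open>[X,Y] = DY(X) - DX(Y)\<close>, computed at \<open>p\<close> in the preferred chart at \<open>p\<close>.\<close>

definition lie_bracket ::
  "('m, 'e::euclidean_space) chart set \<Rightarrow> ('m \<Rightarrow> 'e) \<Rightarrow> ('m \<Rightarrow> 'e) \<Rightarrow> 'm \<Rightarrow> 'e" where
  "lie_bracket A X Y p =
     dir_deriv A p (X p) (\<lambda>q. tcomp A (chart_at A p) q (Y q)) -
     dir_deriv A p (Y p) (\<lambda>q. tcomp A (chart_at A p) q (X q))"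


section \<open>Riemannian metrics, connections, Kaehler manifolds\<close>

definition riemannian_metric ::
  "('m::topological_space, 'e::euclidean_space) chart set \<Rightarrow> ('m \<Rightarrow> 'e \<Rightarrow> 'e \<Rightarrow> real) \<Rightarrow> bool" where
  "riemannian_metric A g \<longleftrightarrow>
     (\<forall>p. bilinear (g p) \<and> (\<forall>u v. g p u v = g p v u) \<and> (\<forall>v. v \<noteq> 0 \<longrightarrow> g p v v > 0)) \<and>
     (\<forall>S X Y. open S \<longrightarrow> smooth_vf A S X \<longrightarrow> smooth_vf A S Y \<longrightarrow>
        smooth_fun A S (\<lambda>p. g p (X p) (Y p)))"

definition tensor11 ::
  "('m::topological_space, 'e::euclidean_space) chart set \<Rightarrow> ('m \<Rightarrow> 'e \<Rightarrow> 'e) \<Rightarrow> bool" where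
  "tensor11 A \<phi> \<longleftrightarrow>
     (\<forall>p. linear (\<phi> p)) \<and>
     (\<forall>S X. open S \<longrightarrow> smooth_vf A S X \<longrightarrow> smooth_vf A S (\<lambda>p. \<phi> p (X p)))"

text \<open>
  An affine connection, acting on local vector fields: \<open>nab p v Y\<close> is the covariant derivative at
  \<open>p\<close> of a vector field \<open>Y\<close>, smooth on some open neighbourhood of \<open>p\<close>, in the direction of the
  tangent vector \<open>v\<close>.  The last clause says that it depends only on \<open>Y\<close> near \<open>p\<close>.
\<close>

type_synonym ('m, 'e) connection = "'m \<Rightarrow> 'e \<Rightarrow> ('m \<Rightarrow> 'e) \<Rightarrow> 'e"

definition affine_connection ::
  "('m::topological_space, 'e::euclidean_space) chart set \<Rightarrow> ('m, 'e) connection \<Rightarrow> bool" where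
  "affine_connection A nab \<longleftrightarrow> (\<forall>S. open S \<longrightarrow>
     (\<forall>X Y. smooth_vf A S X \<longrightarrow> smooth_vf A S Y \<longrightarrow> smooth_vf A S (\<lambda>p. nab p (X p) Y)) \<and>
     (\<forall>Y. smooth_vf A S Y \<longrightarrow> (\<forall>p\<in>S. linear (\<lambda>v. nab p v Y))) \<and>
     (\<forall>Y Z. smooth_vf A S Y \<longrightarrow> smooth_vf A S Z \<longrightarrow>
        (\<forall>p\<in>S. \<forall>v. nab p v (\<lambda>q. Y q + Z q) = nab p v Y + nab p v Z)) \<and>
     (\<forall>u Y. smooth_fun A S u \<longrightarrow> smooth_vf A S Y \<longrightarrow>
        (\<forall>p\<in>S. \<forall>v. nab p v (\<lambda>q. u q *\<^sub>R Y q) = dir_deriv A p v u *\<^sub>R Y p + u p *\<^sub>R nab p v Y)) \<and>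
     (\<forall>Y Z. smooth_vf A S Y \<longrightarrow> smooth_vf A S Z \<longrightarrow> (\<forall>q\<in>S. Y q = Z q) \<longrightarrow>
        (\<forall>p\<in>S. \<forall>v. nab p v Y = nab p v Z)))"

definition torsion_free ::
  "('m::topological_space, 'e::euclidean_space) chart set \<Rightarrow> ('m, 'e) connection \<Rightarrow> bool" where
  "torsion_free A nab \<longleftrightarrow> (\<forall>S X Y. open S \<longrightarrow> smooth_vf A S X \<longrightarrow> smooth_vf A S Y \<longrightarrow>
     (\<forall>p\<in>S. nab p (X p) Y - nab p (Y p) X = lie_bracket A X Y p))"

definition metric_connection ::
  "('m::topological_space, 'e::euclidean_space) chart set \<Rightarrow> ('m \<Rightarrow> 'e \<Rightarrow> 'e \<Rightarrow> real)
    \<Rightarrow> ('m, 'e) connection \<Rightarrow> bool" where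
  "metric_connection A g nab \<longleftrightarrow> (\<forall>S Y Z. open S \<longrightarrow> smooth_vf A S Y \<longrightarrow> smooth_vf A S Z \<longrightarrow>
     (\<forall>p\<in>S. \<forall>v. dir_deriv A p v (\<lambda>q. g q (Y q) (Z q)) =
        g p (nab p v Y) (Z p) + g p (Y p) (nab p v Z)))"

definition levi_civita ::
  "('m::topological_space, 'e::euclidean_space) chart set \<Rightarrow> ('m \<Rightarrow> 'e \<Rightarrow> 'e \<Rightarrow> real)
    \<Rightarrow> ('m, 'e) connection \<Rightarrow> bool" where
  "levi_civita A g nab \<longleftrightarrow>
     affine_connection A nab \<and> torsion_free A nab \<and> metric_connection A g nab"

definition almost_hermitian ::
  "('m::topological_space, 'e::euclidean_space) chart set \<Rightarrow> ('m \<Rightarrow> 'e \<Rightarrow> 'e)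
    \<Rightarrow> ('m \<Rightarrow> 'e \<Rightarrow> 'e \<Rightarrow> real) \<Rightarrow> bool" where
  "almost_hermitian A \<phi> g \<longleftrightarrow> riemannian_metric A g \<and> tensor11 A \<phi> \<and>
     (\<forall>p v. \<phi> p (\<phi> p v) = - v) \<and> (\<forall>p u v. g p (\<phi> p u) (\<phi> p v) = g p u v)"

definition parallel_tensor11 ::
  "('m::topological_space, 'e::euclidean_space) chart set \<Rightarrow> ('m, 'e) connection
    \<Rightarrow> ('m \<Rightarrow> 'e \<Rightarrow> 'e) \<Rightarrow> bool" where
  "parallel_tensor11 A nab \<phi> \<longleftrightarrow> (\<forall>S Y. open S \<longrightarrow> smooth_vf A S Y \<longrightarrow>
     (\<forall>p\<in>S. \<forall>v. nab p v (\<lambda>q. \<phi> q (Y q)) - \<phi> p (nab p v Y) = 0))"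

text \<open>A Kaehler manifold together with its Levi-Civita connection.\<close>

definition kaehler ::
  "('m::{t2_space,second_countable_topology}, 'e::euclidean_space) chart set
    \<Rightarrow> ('m \<Rightarrow> 'e \<Rightarrow> 'e) \<Rightarrow> ('m \<Rightarrow> 'e \<Rightarrow> 'e \<Rightarrow> real) \<Rightarrow> ('m, 'e) connection \<Rightarrow> bool" where
  "kaehler A \<phi> g nab \<longleftrightarrow>
     smooth_atlas A \<and> almost_hermitian A \<phi> g \<and> levi_civita A g nab \<and> parallel_tensor11 A nab \<phi>"


section \<open>Submanifolds\<close>

text \<open>
  Below \<open>A\<close> is the atlas of the submanifold, \<open>B\<close>, \<open>g\<close>, \<open>\<phi>\<close>, \<open>nabb\<close> are the atlas, metric, almost
  complex structure and connection of the ambient manifold, and \<open>f\<close> is the injective immersion.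
\<close>

definition injective_immersion ::
  "('m::topological_space, 'e::euclidean_space) chart set
    \<Rightarrow> ('n::topological_space, 'f::euclidean_space) chart set \<Rightarrow> ('m \<Rightarrow> 'n) \<Rightarrow> bool" where
  "injective_immersion A B f \<longleftrightarrow> smooth_map A B f \<and> inj f \<and> (\<forall>p. inj (tmap A B f p))"

definition induced_metric ::
  "('m, 'e::euclidean_space) chart set \<Rightarrow> ('n, 'f::euclidean_space) chart set \<Rightarrow> ('m \<Rightarrow> 'n)
    \<Rightarrow> ('n \<Rightarrow> 'f \<Rightarrow> 'f \<Rightarrow> real) \<Rightarrow> 'm \<Rightarrow> 'e \<Rightarrow> 'e \<Rightarrow> real" where
  "induced_metric A B f g p u v = g (f p) (tmap A B f p u) (tmap A B f p v)"

definition normal_at ::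
  "('m, 'e::euclidean_space) chart set \<Rightarrow> ('n, 'f::euclidean_space) chart set \<Rightarrow> ('m \<Rightarrow> 'n)
    \<Rightarrow> ('n \<Rightarrow> 'f \<Rightarrow> 'f \<Rightarrow> real) \<Rightarrow> 'm \<Rightarrow> 'f set" where
  "normal_at A B f g p = {w. \<forall>v. g (f p) w (tmap A B f p v) = 0}"

definition normal_sections ::
  "('m::topological_space, 'e::euclidean_space) chart set
    \<Rightarrow> ('n::topological_space, 'f::euclidean_space) chart set \<Rightarrow> ('m \<Rightarrow> 'n)
    \<Rightarrow> ('n \<Rightarrow> 'f \<Rightarrow> 'f \<Rightarrow> real) \<Rightarrow> ('m \<Rightarrow> 'f) set" where
  "normal_sections A B f g = {V. smooth_vf_along A B f V \<and> (\<forall>p. V p \<in> normal_at A B f g p)}"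

text \<open>
  Tangential and normal component of an ambient tangent vector \<open>w\<close> at \<open>f p\<close>.  The tangential
  component is returned as a tangent vector of the submanifold at \<open>p\<close>.
\<close>

definition tan_part ::
  "('m, 'e::euclidean_space) chart set \<Rightarrow> ('n, 'f::euclidean_space) chart set \<Rightarrow> ('m \<Rightarrow> 'n)
    \<Rightarrow> ('n \<Rightarrow> 'f \<Rightarrow> 'f \<Rightarrow> real) \<Rightarrow> 'm \<Rightarrow> 'f \<Rightarrow> 'e" where
  "tan_part A B f g p w = (THE u. w - tmap A B f p u \<in> normal_at A B f g p)"

definition nor_part ::
  "('m, 'e::euclidean_space) chart set \<Rightarrow> ('n, 'f::euclidean_space) chart set \<Rightarrow> ('m \<Rightarrow> 'n)
    \<Rightarrow> ('n \<Rightarrow> 'f \<Rightarrow> 'f \<Rightarrow> real) \<Rightarrow> 'm \<Rightarrow> 'f \<Rightarrow> 'f" where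
  "nor_part A B f g p w = w - tmap A B f p (tan_part A B f g p w)"

text \<open>The operators \<open>T\<close> and \<open>n\<close> of the decompositions \<open>\<phi>X = TX + NX\<close> and \<open>\<phi>V = tV + nV\<close>.\<close>

definition T_op ::
  "('m, 'e::euclidean_space) chart set \<Rightarrow> ('n, 'f::euclidean_space) chart set \<Rightarrow> ('m \<Rightarrow> 'n)
    \<Rightarrow> ('n \<Rightarrow> 'f \<Rightarrow> 'f) \<Rightarrow> ('n \<Rightarrow> 'f \<Rightarrow> 'f \<Rightarrow> real) \<Rightarrow> 'm \<Rightarrow> 'e \<Rightarrow> 'e" where
  "T_op A B f \<phi> g p v = tan_part A B f g p (\<phi> (f p) (tmap A B f p v))"

definition n_op ::
  "('m, 'e::euclidean_space) chart set \<Rightarrow> ('n, 'f::euclidean_space) chart set \<Rightarrow> ('m \<Rightarrow> 'n)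
    \<Rightarrow> ('n \<Rightarrow> 'f \<Rightarrow> 'f) \<Rightarrow> ('n \<Rightarrow> 'f \<Rightarrow> 'f \<Rightarrow> real) \<Rightarrow> 'm \<Rightarrow> 'f \<Rightarrow> 'f" where
  "n_op A B f \<phi> g p w = nor_part A B f g p (\<phi> (f p) w)"

text \<open>
  The ambient covariant derivative of a vector field \<open>V\<close> along \<open>f\<close> in the direction of a tangent
  vector \<open>v\<close> of the submanifold at \<open>p\<close>.  Near \<open>p\<close> write \<open>V = (\<Sum>b. V\<^sup>b (E\<^sub>b \<circ> f))\<close>, where \<open>E\<^sub>b\<close> are the
  coordinate fields of a chart around \<open>f p\<close>; then the derivative is
  \<open>\<Sum>b. v(V\<^sup>b) E\<^sub>b + V\<^sup>b nabb\<^bsub>df v\<^esub> E\<^sub>b\<close>.  By the Leibniz rule this equals \<open>nabb\<^bsub>df v\<^esub> W\<close> for every local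
  extension \<open>W\<close> of \<open>V\<close>, and it does not depend on the chart.
\<close>

definition cov_along ::
  "('m, 'e::euclidean_space) chart set \<Rightarrow> ('n, 'f::euclidean_space) chart set \<Rightarrow> ('m \<Rightarrow> 'n)
    \<Rightarrow> ('n, 'f) connection \<Rightarrow> 'm \<Rightarrow> 'e \<Rightarrow> ('m \<Rightarrow> 'f) \<Rightarrow> 'f" where
  "cov_along A B f nabb p v V =
     (let C = chart_at B (f p); comp = (\<lambda>b q. tcomp B C (f q) (V q) \<bullet> b) in
       (\<Sum>b\<in>Basis. dir_deriv A p v (comp b) *\<^sub>R coord_field B C b (f p) +
          comp b p *\<^sub>R nabb (f p) (tmap A B f p v) (coord_field B C b)))"

text \<open>
  The second fundamental form by the Gauss formula, for vector fields \<open>X\<close>, \<open>Y\<close> on the submanifold;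
  \<open>nab\<close> is the connection of the submanifold.
\<close>

definition second_fund ::
  "('m, 'e::euclidean_space) chart set \<Rightarrow> ('n, 'f::euclidean_space) chart set \<Rightarrow> ('m \<Rightarrow> 'n)
    \<Rightarrow> ('n, 'f) connection \<Rightarrow> ('m, 'e) connection \<Rightarrow> ('m \<Rightarrow> 'e) \<Rightarrow> ('m \<Rightarrow> 'e) \<Rightarrow> 'm \<Rightarrow> 'f" where
  "second_fund A B f nabb nab X Y p =
     cov_along A B f nabb p (X p) (\<lambda>q. tmap A B f q (Y q)) - tmap A B f p (nab p (X p) Y)"

definition n_squared_eigenvector ::
  "('m::topological_space, 'e::euclidean_space) chart set
    \<Rightarrow> ('n::topological_space, 'f::euclidean_space) chart set \<Rightarrow> ('m \<Rightarrow> 'n)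
    \<Rightarrow> ('n \<Rightarrow> 'f \<Rightarrow> 'f) \<Rightarrow> ('n \<Rightarrow> 'f \<Rightarrow> 'f \<Rightarrow> real) \<Rightarrow> real \<Rightarrow> ('m \<Rightarrow> 'f) \<Rightarrow> bool" where
  "n_squared_eigenvector A B f \<phi> g c V \<longleftrightarrow>
     V \<in> normal_sections A B f g \<and> V \<noteq> (\<lambda>p. 0) \<and>
     (\<forall>p. n_op A B f \<phi> g p (n_op A B f \<phi> g p (V p)) = c *\<^sub>R V p)"

definition n_squared_eigenvalue ::
  "('m::topological_space, 'e::euclidean_space) chart set
    \<Rightarrow> ('n::topological_space, 'f::euclidean_space) chart set \<Rightarrow> ('m \<Rightarrow> 'n)
    \<Rightarrow> ('n \<Rightarrow> 'f \<Rightarrow> 'f) \<Rightarrow> ('n \<Rightarrow> 'f \<Rightarrow> 'f \<Rightarrow> real) \<Rightarrow> real \<Rightarrow> bool" where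
  "n_squared_eigenvalue A B f \<phi> g c \<longleftrightarrow> (\<exists>V. n_squared_eigenvector A B f \<phi> g c V)"


section \<open>Distributions and pointwise k-slant submanifolds\<close>

text \<open>A smooth distribution of constant rank.\<close>

definition distribution ::
  "('m::topological_space, 'e::euclidean_space) chart set \<Rightarrow> ('m \<Rightarrow> 'e set) \<Rightarrow> bool" where
  "distribution A D \<longleftrightarrow>
     (\<forall>p. subspace (D p)) \<and> (\<exists>r. \<forall>p. dim (D p) = r) \<and>
     (\<forall>p. \<exists>S F. open S \<and> p \<in> S \<and> finite F \<and> (\<forall>E\<in>F. smooth_vf A S E) \<and>
        (\<forall>q\<in>S. D q = span ((\<lambda>E. E q) ` F)))"

definition sections ::
  "('m::topological_space, 'e::euclidean_space) chart set \<Rightarrow> ('m \<Rightarrow> 'e set) \<Rightarrow> ('m \<Rightarrow> 'e) set" where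
  "sections A D = {X. smooth_vf A UNIV X \<and> (\<forall>p. X p \<in> D p)}"

definition integrable_distribution ::
  "('m::topological_space, 'e::euclidean_space) chart set \<Rightarrow> ('m \<Rightarrow> 'e set) \<Rightarrow> bool" where
  "integrable_distribution A D \<longleftrightarrow> distribution A D \<and>
     (\<forall>X\<in>sections A D. \<forall>Y\<in>sections A D. lie_bracket A X Y \<in> sections A D)"

definition completely_integrable_distribution ::
  "('m::topological_space, 'e::euclidean_space) chart set \<Rightarrow> ('m, 'e) connection
    \<Rightarrow> ('m \<Rightarrow> 'e set) \<Rightarrow> bool" where
  "completely_integrable_distribution A nab D \<longleftrightarrow> distribution A D \<and>
     (\<forall>X\<in>sections A D. \<forall>Y\<in>sections A D. (\<lambda>p. nab p (X p) Y) \<in> sections A D)"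

definition sum_distribution :: "nat set \<Rightarrow> (nat \<Rightarrow> 'm \<Rightarrow> 'e::euclidean_space set) \<Rightarrow> 'm \<Rightarrow> 'e set" where
  "sum_distribution I D p = {\<Sum>i\<in>I. w i |w. \<forall>i\<in>I. w i \<in> D i p}"

definition vec_angle :: "('f::real_vector \<Rightarrow> 'f \<Rightarrow> real) \<Rightarrow> 'f \<Rightarrow> 'f \<Rightarrow> real" where
  "vec_angle g u w = arccos (g u w / (sqrt (g u u) * sqrt (g w w)))"

text \<open>
  The angle in \<open>[0, \<pi>/2]\<close> between a nonzero vector \<open>u\<close> and a nontrivial subspace \<open>W\<close> is the least
  angle between \<open>u\<close> and a nonzero element of \<open>W\<close>.
\<close>

definition subspace_angle :: "('f::real_vector \<Rightarrow> 'f \<Rightarrow> real) \<Rightarrow> 'f \<Rightarrow> 'f set \<Rightarrow> real" where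
  "subspace_angle g u W = (INF w\<in>W - {0}. vec_angle g u w)"

definition pointwise_slant ::
  "('m, 'e::euclidean_space) chart set \<Rightarrow> ('n, 'f::euclidean_space) chart set \<Rightarrow> ('m \<Rightarrow> 'n)
    \<Rightarrow> ('n \<Rightarrow> 'f \<Rightarrow> 'f) \<Rightarrow> ('n \<Rightarrow> 'f \<Rightarrow> 'f \<Rightarrow> real) \<Rightarrow> ('m \<Rightarrow> 'e set) \<Rightarrow> ('m \<Rightarrow> real) \<Rightarrow> bool" where
  "pointwise_slant A B f \<phi> g D \<theta> \<longleftrightarrow>
     (\<forall>p. \<theta> p \<noteq> 0 \<and> (\<forall>v\<in>D p - {0}.
        subspace_angle (g (f p)) (\<phi> (f p) (tmap A B f p v)) (tmap A B f p ` D p) = \<theta> p))"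

definition pointwise_k_slant ::
  "('m::topological_space, 'e::euclidean_space) chart set
    \<Rightarrow> ('n::topological_space, 'f::euclidean_space) chart set \<Rightarrow> ('m \<Rightarrow> 'n)
    \<Rightarrow> ('n \<Rightarrow> 'f \<Rightarrow> 'f) \<Rightarrow> ('n \<Rightarrow> 'f \<Rightarrow> 'f \<Rightarrow> real) \<Rightarrow> nat
    \<Rightarrow> (nat \<Rightarrow> 'm \<Rightarrow> 'e set) \<Rightarrow> (nat \<Rightarrow> 'm \<Rightarrow> real) \<Rightarrow> bool" where
  "pointwise_k_slant A B f \<phi> g k D \<theta> \<longleftrightarrow>
     k \<ge> 1 \<and>
     (\<forall>i\<le>k. distribution A (D i)) \<and>
     (\<forall>i\<le>k. \<forall>j\<le>k. i \<noteq> j \<longrightarrow>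
        (\<forall>p. \<forall>u\<in>D i p. \<forall>v\<in>D j p. induced_metric A B f g p u v = 0)) \<and>
     (\<forall>p v. \<exists>!w. w \<in> (\<Pi>\<^sub>E i\<in>{..k}. D i p) \<and> v = (\<Sum>i\<le>k. w i)) \<and>
     (\<forall>i\<in>{1..k}. \<forall>p. T_op A B f \<phi> g p ` D i p \<subseteq> D i p) \<and>
     (\<forall>p. \<phi> (f p) ` tmap A B f p ` D 0 p \<subseteq> tmap A B f p ` D 0 p) \<and>
     (\<forall>i\<in>{1..k}. (\<forall>p. D i p \<noteq> {0}) \<and> pointwise_slant A B f \<phi> g (D i) (\<theta> i) \<and>
        (\<forall>p. 0 < \<theta> i p \<and> \<theta> i p \<le> pi / 2)) \<and>
     (\<forall>i\<in>{1..k}. \<forall>j\<in>{1..k}. i \<noteq> j \<longrightarrow> (\<forall>p. \<theta> i p \<noteq> \<theta> j p)) \<and>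
     (\<forall>p. \<theta> 0 p = 0)"

text \<open>\<open>\<nabla>T = 0\<close>, on global vector fields.\<close>

definition T_parallel ::
  "('m::topological_space, 'e::euclidean_space) chart set \<Rightarrow> ('m, 'e) connection
    \<Rightarrow> ('m \<Rightarrow> 'e \<Rightarrow> 'e) \<Rightarrow> bool" where
  "T_parallel A nab T \<longleftrightarrow> (\<forall>X Y. smooth_vf A UNIV X \<longrightarrow> smooth_vf A UNIV Y \<longrightarrow>
     (\<forall>p. nab p (X p) (\<lambda>q. T q (Y q)) - T p (nab p (X p) Y) = 0))"

end

theory Submission
  imports Defs
begin

text \<open>
  \<open>T\<close> is skew-adjoint and parallel, so \<open>T\<^sup>2\<close> is symmetric and parallel.  A vector \<open>v\<close> with \<open>T\<^sup>2v = -v\<close>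
  satisfies \<open>|Tv| = |\<phi>v|\<close>, hence \<open>\<phi>v = Tv\<close> is tangent, which is impossible in a slant distribution with
  nonzero angle; thus \<open>\<D>\<^sub>0\<close> is the kernel and its orthogonal complement the image of the parallel
  endomorphism \<open>T\<^sup>2 + 1\<close>, and (i) follows.  For (ii), \<open>\<nabla>\<^sub>XTY - \<nabla>\<^sub>YTX = T[X,Y]\<close> and \<open>T\<close> is injective on
  every \<open>\<D>\<^sub>j\<close> with \<open>\<theta>\<^sub>j \<noteq> \<pi>/2\<close>.  For (iii), applying \<open>\<phi>\<close> to the Gauss formula gives
  \<open>\<phi> h(X,Y) = h(X,TY)\<close> for \<open>Y\<close> in \<open>\<D>\<^sub>0\<close>; since \<open>h\<close> is normal, \<open>n\<^sup>2h = \<phi>\<^sup>2h = -h\<close>.  That the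
  vector fields \<open>TY\<close> and the sections of \<open>im (T\<^sup>2 + 1)\<close> are smooth rests on the smoothness of solutions of
  invertible linear systems, and the normality of \<open>h\<close> on the uniqueness of the Levi-Civita connection.
\<close>

section \<open>Smooth functions between normed spaces\<close>

text \<open>Parallelism of \<open>T\<close> is assumed for global vector fields only, while frames
  of a distribution exist only locally. So complete integrability of the complement of
  \<open>D 0\<close> is not tested against a frame of \<open>D 0\<close>. Instead a section
  \<open>Y\<close> of the complement is written globally as \<open>T (T W) + W\<close>: the preimage
  \<open>W\<close> is chosen pointwise inside the complement, hence independently of any frame, and
  only its smoothness is a local matter. Two objects are not defined by the properties used of them.
  \<open>nab\<close> is any Levi-Civita connection of the induced metric rather than the tangential
  part of \<open>nabb\<close>, so normality of \<open>second_fund\<close> needs a proof.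
  \<open>cov_along\<close> is a coordinate formula, so its Leibniz rule, chart independence,
  torsion, metric compatibility and commutation with \<open>\<phi>\<close> have to be derived.
  Tangent vectors are components in a preferred chart that may jump from point to point; smoothness
  proofs therefore freeze one chart near the point and expand everything in its coordinate fields.
  Part (iii) rests on part (i): \<open>\<phi>\<close> maps the derivative of a section of
  \<open>D 0\<close> to a tangent vector because that derivative stays in
  \<open>D 0\<close>.\<close>

lemma frechet_derivative_eq:
  "(f has_derivative f') (at x) \<Longrightarrow> frechet_derivative f (at x) = f'"
  using frechet_derivative_at by metis

lemma frechet_has_derivative:
  "f differentiable (at x) \<Longrightarrow> (f has_derivative frechet_derivative f (at x)) (at x)"
  by (simp add: frechet_derivative_works)

text \<open>Both functions have the same derivatives at \<open>x\<close>, so the choice operator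
  behind \<open>frechet_derivative\<close> picks the same value for both, even where no derivative
  exists.\<close>

lemma frechet_derivative_cong_open:
  assumes "open S" "x \<in> S" "\<And>y. y \<in> S \<Longrightarrow> f y = g y"
  shows "frechet_derivative f (at x) = frechet_derivative g (at x)"
proof -
  have "(f has_derivative D) (at x) \<longleftrightarrow> (g has_derivative D) (at x)" for D
    using has_derivative_transform_within_open[OF _ assms(1,2), of f D UNIV g]
      has_derivative_transform_within_open[OF _ assms(1,2), of g D UNIV f] assms(3) by auto
  then show ?thesis
    unfolding frechet_derivative_def by simp
qed

lemma differentiable_cong_open:
  assumes "open S" "x \<in> S" "\<And>y. y \<in> S \<Longrightarrow> f y = g y" "f differentiable (at x)"
  shows "g differentiable (at x)"
  using assms has_derivative_transform_within_open[of f _ x UNIV S g] unfolding differentiable_def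
  by blast

lemma Ck_on_cong:
  assumes "open S" "\<And>y. y \<in> S \<Longrightarrow> f y = g y" "Ck_on k f S"
  shows "Ck_on k g S"
  using assms(2,3)
proof (induction k arbitrary: f g)
  case 0
  then show ?case
    using continuous_on_cong by auto
next
  case (Suc k)
  have d: "g differentiable (at x)" if "x \<in> S" for x
    using Suc.prems that differentiable_cong_open[OF assms(1) that, of f g] by simp
  have "Ck_on k (\<lambda>x. frechet_derivative g (at x) v) S" for v
  proof (rule Suc.IH)
    show "Ck_on k (\<lambda>x. frechet_derivative f (at x) v) S"
      using Suc.prems by simp
    show "frechet_derivative f (at y) v = frechet_derivative g (at y) v" if "y \<in> S" for y
      using frechet_derivative_cong_open[OF assms(1) that, of f g] Suc.prems by simp
  qed
  then show ?case
    using d by simp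
qed

lemma Ck_on_Suc_imp: "Ck_on (Suc k) f S \<Longrightarrow> Ck_on k f S"
proof (induction k arbitrary: f)
  case 0
  then show ?case
    by (auto intro!: continuous_at_imp_continuous_on differentiable_imp_continuous_within)
next
  case (Suc k)
  then show ?case
    by (meson Ck_on.simps(2))
qed

lemma Ck_on_subset:
  "Ck_on k f S \<Longrightarrow> T \<subseteq> S \<Longrightarrow> Ck_on k f T"
  by (induction k arbitrary: f) (auto intro: continuous_on_subset)

lemma Ck_on_local:
  assumes "\<And>x. x \<in> S \<Longrightarrow> \<exists>U. open U \<and> x \<in> U \<and> Ck_on k f U"
  shows "Ck_on k f S"
  using assms
proof (induction k arbitrary: f)
  case 0
  have "isCont f x" if "x \<in> S" for x
    using 0[OF that] continuous_on_interior interior_open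
    by (metis Ck_on.simps(1) continuous_on_eq_continuous_at)
  then show ?case
    by (simp add: continuous_at_imp_continuous_on)
next
  case (Suc k)
  have "f differentiable (at x)" if "x \<in> S" for x
    using Suc.prems[OF that] by auto
  moreover have "Ck_on k (\<lambda>x. frechet_derivative f (at x) v) S" for v
  proof (rule Suc.IH)
    fix x
    assume "x \<in> S"
    from Suc.prems[OF this] show "\<exists>U. open U \<and> x \<in> U \<and> Ck_on k (\<lambda>x. frechet_derivative f (at x) v) U"
      by auto
  qed
  ultimately show ?case
    by simp
qed

section \<open>Closure of \<open>Ck_on\<close> under algebraic operations and composition\<close>

lemma Ck_on_const: "Ck_on k (\<lambda>x. c) S"
  by (induction k arbitrary: c) auto

lemma Ck_on_linear:
  assumes "bounded_linear L" "open S" "Ck_on k f S"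
  shows "Ck_on k (\<lambda>x. L (f x)) S"
  using assms(3)
proof (induction k arbitrary: f)
  case 0
  then show ?case
    using assms(1) by (simp add: linear_continuous_on_compose bounded_linear.continuous_on)
next
  case (Suc k)
  have d: "((\<lambda>x. L (f x)) has_derivative (\<lambda>v. L (frechet_derivative f (at x) v))) (at x)"
    if "x \<in> S" for x
    using Suc.prems that by (intro bounded_linear.has_derivative[OF assms(1)] frechet_has_derivative) simp
  have "Ck_on k (\<lambda>x. frechet_derivative (\<lambda>x. L (f x)) (at x) v) S" for v
  proof (rule Ck_on_cong[OF assms(2)])
    show "Ck_on k (\<lambda>x. L (frechet_derivative f (at x) v)) S"
      using Suc by simp
  qed (simp add: frechet_derivative_eq[OF d])
  then show ?case
    using d by (auto simp: differentiable_def)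
qed

lemma Ck_on_add:
  assumes "open S" "Ck_on k f S" "Ck_on k g S"
  shows "Ck_on k (\<lambda>x. f x + g x) S"
  using assms(2,3)
proof (induction k arbitrary: f g)
  case 0
  then show ?case
    by (simp add: continuous_on_add)
next
  case (Suc k)
  have d: "((\<lambda>x. f x + g x) has_derivative
      (\<lambda>v. frechet_derivative f (at x) v + frechet_derivative g (at x) v)) (at x)"
    if "x \<in> S" for x
    using Suc.prems that by (intro has_derivative_add frechet_has_derivative) simp_all
  have "Ck_on k (\<lambda>x. frechet_derivative (\<lambda>x. f x + g x) (at x) v) S" for v
  proof (rule Ck_on_cong[OF assms(1)])
    show "Ck_on k (\<lambda>x. frechet_derivative f (at x) v + frechet_derivative g (at x) v) S"
      using Suc by simp
  qed (simp add: frechet_derivative_eq[OF d])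
  then show ?case
    using d by (auto simp: differentiable_def)
qed

lemma Ck_on_sum:
  assumes "open S" "\<And>i. i \<in> I \<Longrightarrow> Ck_on k (f i) S"
  shows "Ck_on k (\<lambda>x. \<Sum>i\<in>I. f i x) S"
  using assms(2)
  by (induction I rule: infinite_finite_induct) (auto simp: Ck_on_const intro: Ck_on_add assms(1))

lemma Ck_on_bilinear:
  assumes "bounded_bilinear pr" "open S" "Ck_on k f S" "Ck_on k g S"
  shows "Ck_on k (\<lambda>x. pr (f x) (g x)) S"
  using assms(3,4)
proof (induction k arbitrary: f g)
  case 0
  then show ?case
    using bounded_bilinear.continuous_on[OF assms(1)] by simp
next
  case (Suc k)
  have d: "((\<lambda>x. pr (f x) (g x)) has_derivative
      (\<lambda>v. pr (f x) (frechet_derivative g (at x) v) + pr (frechet_derivative f (at x) v) (g x))) (at x)"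
    if "x \<in> S" for x
    using Suc.prems that
    by (intro bounded_bilinear.FDERIV[OF assms(1)] frechet_has_derivative) simp_all
  have "Ck_on k (\<lambda>x. frechet_derivative (\<lambda>x. pr (f x) (g x)) (at x) v) S" for v
  proof (rule Ck_on_cong[OF assms(2)])
    have "Ck_on k f S" "Ck_on k g S"
      using Suc.prems Ck_on_Suc_imp by blast+
    moreover have "Ck_on k (\<lambda>x. frechet_derivative g (at x) v) S"
      "Ck_on k (\<lambda>x. frechet_derivative f (at x) v) S"
      using Suc.prems by simp_all
    ultimately show "Ck_on k (\<lambda>x. pr (f x) (frechet_derivative g (at x) v) +
        pr (frechet_derivative f (at x) v) (g x)) S"
      by (intro Ck_on_add assms(2) Suc.IH)
  qed (simp add: frechet_derivative_eq[OF d])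
  then show ?case
    using d by (auto simp: differentiable_def)
qed

text \<open>\<open>Ck_on\<close> speaks of derivatives in fixed directions. This expansion turns a
  linear map applied to a moving vector into a finite sum of products, to which the closure rules
  apply.\<close>

lemma linear_eq_sum_Basis:
  fixes L :: "'a::euclidean_space \<Rightarrow> 'b::real_vector"
  assumes "linear L"
  shows "L v = (\<Sum>b\<in>Basis. (v \<bullet> b) *\<^sub>R L b)"
proof -
  have "L v = L (\<Sum>b\<in>Basis. (v \<bullet> b) *\<^sub>R b)"
    by (simp add: euclidean_representation)
  also have "\<dots> = (\<Sum>b\<in>Basis. (v \<bullet> b) *\<^sub>R L b)"
    by (simp add: linear_sum[OF assms] linear_scale[OF assms])
  finally show ?thesis .
qed

text \<open>The chain rule produces the derivative of \<open>f\<close> in a direction that moves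
  with \<open>x\<close>. Expanding this direction in \<open>Basis\<close> leaves derivatives of
  \<open>f\<close> in fixed directions composed with \<open>g\<close>, which the induction
  hypothesis covers; hence \<open>f\<close> is generalised and \<open>g\<close> is fixed.\<close>

lemma Ck_on_compose:
  fixes f :: "'a::euclidean_space \<Rightarrow> 'b::real_normed_vector"
    and g :: "'c::real_normed_vector \<Rightarrow> 'a"
  assumes "open S" "\<And>x. x \<in> S \<Longrightarrow> g x \<in> T" "Ck_on k f T" "Ck_on k g S"
  shows "Ck_on k (\<lambda>x. f (g x)) S"
  using assms(3,4)
proof (induction k arbitrary: f)
  case 0
  then show ?case
    using assms(2) continuous_on_compose2[of T f S g] by auto
next
  case (Suc k)
  let ?D = "\<lambda>x v. \<Sum>b\<in>Basis. (frechet_derivative g (at x) v \<bullet> b) *\<^sub>R frechet_derivative f (at (g x)) b"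
  have d: "((\<lambda>x. f (g x)) has_derivative ?D x) (at x)"
    if "x \<in> S" for x
  proof -
    have f: "f differentiable (at (g x))" and g: "g differentiable (at x)"
      using Suc.prems that assms(2) by auto
    have "((f \<circ> g) has_derivative (frechet_derivative f (at (g x)) \<circ> frechet_derivative g (at x))) (at x)"
      by (rule diff_chain_at[OF frechet_has_derivative[OF g] frechet_has_derivative[OF f]])
    moreover have "frechet_derivative f (at (g x)) \<circ> frechet_derivative g (at x) = ?D x"
      by (rule ext, simp only: o_def) (rule linear_eq_sum_Basis[OF linear_frechet_derivative[OF f]])
    ultimately show ?thesis
      by (simp add: o_def)
  qed
  have "Ck_on k (\<lambda>x. frechet_derivative (\<lambda>x. f (g x)) (at x) v) S" for v
  proof (rule Ck_on_cong[OF assms(1)])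
    have "Ck_on k g S" and Dg: "Ck_on k (\<lambda>x. frechet_derivative g (at x) v) S"
      using Suc.prems Ck_on_Suc_imp by auto
    then have "Ck_on k (\<lambda>x. frechet_derivative f (at (g x)) b) S" for b
      using Suc.IH[of "\<lambda>y. frechet_derivative f (at y) b"] Suc.prems by simp
    then show "Ck_on k (\<lambda>x. ?D x v) S"
      by (intro Ck_on_sum assms(1) Ck_on_bilinear[OF bounded_bilinear_scaleR]
        Ck_on_linear[OF bounded_linear_inner_left] Dg)
  qed (simp add: frechet_derivative_eq[OF d])
  then show ?case
    using d by (auto simp: differentiable_def)
qed

text \<open>Product rule at a zero of \<open>F\<close>: the derivative of \<open>c\<close> would be
  multiplied by \<open>F a = 0\<close>, so continuity of \<open>c\<close> is enough. This is what
  allows differentiating a solution of a linear system that is so far only known to be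
  continuous.\<close>

lemma has_derivative_scaleR_zero:
  fixes F :: "'a::real_normed_vector \<Rightarrow> 'b::real_normed_vector"
  assumes c: "isCont c a" and F: "(F has_derivative F') (at a)" and [simp]: "F a = 0"
  shows "((\<lambda>x. c x *\<^sub>R F x) has_derivative (\<lambda>v. c a *\<^sub>R F' v)) (at a)"
proof -
  interpret F': bounded_linear F'
    using F by (rule has_derivative_bounded_linear)
  \<comment> \<open>The difference quotient splits into \<open>c x\<close> times the remainder
    quotient of \<open>F\<close>, and the null factor \<open>c x - c a\<close> times
    \<open>F'\<close> at a vector of norm at most 1, which stays bounded.\<close>
  have "((\<lambda>x. c x *\<^sub>R ((F x - F' (x - a)) /\<^sub>R norm (x - a)) + (c x - c a) *\<^sub>R F' ((x - a) /\<^sub>R norm (x - a))) \<longlongrightarrow> c a *\<^sub>R 0 + 0) (at a)"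
  proof (intro tendsto_add tendsto_scaleR)
    show "(c \<longlongrightarrow> c a) (at a)"
      using c by (simp add: isCont_def)
    then have "((\<lambda>x. c x - c a) \<longlongrightarrow> 0) (at a)"
      by (simp add: LIM_zero)
    moreover obtain K where K: "\<And>v. norm (F' v) \<le> norm v * K"
      using F'.bounded by blast
    have "norm (F' ((x - a) /\<^sub>R norm (x - a))) \<le> \<bar>K\<bar>" for x
    proof -
      have n: "norm ((x - a) /\<^sub>R norm (x - a)) \<le> 1"
        by (cases "x = a") auto
      have "norm (F' ((x - a) /\<^sub>R norm (x - a))) \<le> norm ((x - a) /\<^sub>R norm (x - a)) * \<bar>K\<bar>"
        using K[of "(x - a) /\<^sub>R norm (x - a)"] by (smt (verit) mult_left_mono norm_ge_zero)
      also have "\<dots> \<le> 1 * \<bar>K\<bar>"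
        by (intro mult_right_mono n) simp
      finally show ?thesis
        by simp
    qed
    then have "Bfun (\<lambda>x. F' ((x - a) /\<^sub>R norm (x - a))) (at a)"
      by (intro BfunI[of _ "\<bar>K\<bar>"]) auto
    ultimately show "((\<lambda>x. (c x - c a) *\<^sub>R F' ((x - a) /\<^sub>R norm (x - a))) \<longlongrightarrow> 0) (at a)"
      using bounded_bilinear.Zfun_prod_Bfun[OF bounded_bilinear_scaleR] by (simp add: tendsto_Zfun_iff)
    show "((\<lambda>x. (F x - F' (x - a)) /\<^sub>R norm (x - a)) \<longlongrightarrow> 0) (at a)"
      using F unfolding has_derivative_at_within by simp
  qed
  moreover have "c x *\<^sub>R ((F x - F' (x - a)) /\<^sub>R norm (x - a)) + (c x - c a) *\<^sub>R F' ((x - a) /\<^sub>R norm (x - a))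
      = (c x *\<^sub>R F x - c a *\<^sub>R F a - c a *\<^sub>R F' (x - a)) /\<^sub>R norm (x - a)" for x
    by (simp only: F'.scaleR) (simp add: algebra_simps)
  ultimately show ?thesis
    unfolding has_derivative_at_within
    using bounded_linear_compose[OF bounded_linear_scaleR_right F'.bounded_linear_axioms]
    by (simp add: o_def)
qed

lemma linear_system_isCont:
  fixes G :: "'a::real_normed_vector \<Rightarrow> 'e::euclidean_space \<Rightarrow> 'e"
  assumes S: "open S" "a \<in> S"
    and lin: "\<And>x. x \<in> S \<Longrightarrow> linear (G x)" and inj: "inj (G a)"
    and eq: "\<And>x. x \<in> S \<Longrightarrow> G x (u x) = w x"
    and G: "\<And>b. isCont (\<lambda>x. G x b) a" and w: "isCont w a"
  shows "isCont u a"
proof -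
  have lina: "linear (G a)"
    using lin S by blast
  obtain c where c: "c > 0" "\<And>v. c * norm v \<le> norm (G a v)"
    using linear_inj_bounded_below_pos[OF lina inj] by metis
  \<comment> \<open>Coefficients frozen at \<open>a\<close>: the variation of \<open>G\<close> moves
    to the right-hand side, where its factors \<open>G x b - G a b\<close> vanish at
    \<open>a\<close>.\<close>
  have key: "G a (u x) = w x - (\<Sum>b\<in>Basis. (u x \<bullet> b) *\<^sub>R (G x b - G a b))" if "x \<in> S" for x
    using linear_eq_sum_Basis[OF lin[OF that], of "u x"] linear_eq_sum_Basis[OF lina, of "u x"]
      eq[OF that] by (simp add: scaleR_diff_right sum_subtractf)
  define \<epsilon> where "\<epsilon> x = (\<Sum>b\<in>Basis. norm (G x b - G a b))" for x
  have eps: "(\<epsilon> \<longlongrightarrow> 0) (at a)"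
  proof -
    have "((\<lambda>x. norm (G x b - G a b)) \<longlongrightarrow> 0) (at a)" for b
      using G[of b] by (simp add: isCont_def LIM_zero tendsto_norm_zero)
    then show ?thesis
      unfolding \<epsilon>_def by (intro tendsto_null_sum)
  qed
  have wcont: "((\<lambda>x. norm (w x - w a)) \<longlongrightarrow> 0) (at a)"
    using w by (simp add: isCont_def LIM_zero tendsto_norm_zero)
  \<comment> \<open>The threshold \<open>c / 2\<close> lets the term
    \<open>norm (u x - u a) * \<epsilon> x\<close> be absorbed by half of
    \<open>c * norm (u x - u a)\<close>; the remaining half gives the factor
    \<open>2 / c\<close>.\<close>
  have bnd: "norm (u x - u a) \<le> 2 / c * (norm (w x - w a) + \<epsilon> x * norm (u a))"
    if x: "x \<in> S" and e: "\<epsilon> x < c / 2" for x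
  proof -
    have "G a (u x - u a) = w x - w a - (\<Sum>b\<in>Basis. (u x \<bullet> b) *\<^sub>R (G x b - G a b))"
      using key[OF x] eq[OF S(2)] by (simp add: linear_diff[OF lina])
    then have "c * norm (u x - u a) \<le> norm (w x - w a - (\<Sum>b\<in>Basis. (u x \<bullet> b) *\<^sub>R (G x b - G a b)))"
      using c(2)[of "u x - u a"] by simp
    also have "\<dots> \<le> norm (w x - w a) + norm (\<Sum>b\<in>Basis. (u x \<bullet> b) *\<^sub>R (G x b - G a b))"
      by (rule norm_triangle_ineq4)
    also have "norm (\<Sum>b\<in>Basis. (u x \<bullet> b) *\<^sub>R (G x b - G a b)) \<le> (\<Sum>b\<in>Basis. norm (u x) * norm (G x b - G a b))"
      by (rule order_trans[OF norm_sum]) (auto intro!: sum_mono mult_right_mono simp: Basis_le_norm)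
    also have "\<dots> = norm (u x) * \<epsilon> x"
      by (simp add: \<epsilon>_def sum_distrib_left)
    also have "\<dots> \<le> (norm (u x - u a) + norm (u a)) * \<epsilon> x"
      using norm_triangle_ineq[of "u x - u a" "u a"]
      by (intro mult_right_mono) (auto simp: \<epsilon>_def sum_nonneg)
    finally have "c * norm (u x - u a) \<le> norm (w x - w a) + \<epsilon> x * norm (u a) + norm (u x - u a) * \<epsilon> x"
      by (simp add: algebra_simps)
    also have "norm (u x - u a) * \<epsilon> x \<le> norm (u x - u a) * (c / 2)"
      using e by (intro mult_left_mono) auto
    finally show ?thesis
      using c(1) by (simp add: field_simps)
  qed
  have "((\<lambda>x. u x - u a) \<longlongrightarrow> 0) (at a)"
  proof (rule Lim_null_comparison)
    have "eventually (\<lambda>x. \<epsilon> x < c / 2) (at a)"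
      using eps c(1) by (intro order_tendstoD(2)[of _ 0]) auto
    moreover have "eventually (\<lambda>x. x \<in> S) (at a)"
      using S by (simp add: eventually_at_in_open')
    ultimately show "eventually (\<lambda>x. norm (u x - u a) \<le> 2 / c * (norm (w x - w a) + \<epsilon> x * norm (u a))) (at a)"
      by eventually_elim (rule bnd)
    have "((\<lambda>x. 2 / c * (norm (w x - w a) + \<epsilon> x * norm (u a))) \<longlongrightarrow> 2 / c * (0 + 0 * norm (u a))) (at a)"
      by (intro tendsto_intros eps wcont)
    then show "((\<lambda>x. 2 / c * (norm (w x - w a) + \<epsilon> x * norm (u a))) \<longlongrightarrow> 0) (at a)"
      by simp
  qed
  then show ?thesis
    by (simp add: isCont_def LIM_zero_cancel)
qed

lemma linear_system_has_derivative:
  fixes G :: "'a::real_normed_vector \<Rightarrow> 'e::euclidean_space \<Rightarrow> 'e"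
  assumes S: "open S" "a \<in> S"
    and lin: "\<And>x. x \<in> S \<Longrightarrow> linear (G x)" and inj: "inj (G a)"
    and eq: "\<And>x. x \<in> S \<Longrightarrow> G x (u x) = w x"
    and G: "\<And>b. (\<lambda>x. G x b) differentiable (at a)" and w: "w differentiable (at a)"
  obtains u' where "(u has_derivative u') (at a)"
    "\<And>v. G a (u' v) = frechet_derivative w (at a) v
        - (\<Sum>b\<in>Basis. (u a \<bullet> b) *\<^sub>R frechet_derivative (\<lambda>x. G x b) (at a) v)"
proof -
  have lina: "linear (G a)"
    using lin S by blast
  have key: "G a (u x) = w x - (\<Sum>b\<in>Basis. (u x \<bullet> b) *\<^sub>R (G x b - G a b))" if "x \<in> S" for x
    using linear_eq_sum_Basis[OF lin[OF that], of "u x"] linear_eq_sum_Basis[OF lina, of "u x"]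
      eq[OF that] by (simp add: scaleR_diff_right sum_subtractf)
  have ucont: "isCont u a"
    using G w by (intro linear_system_isCont[where G = G, OF S lin inj eq] differentiable_imp_continuous_within) auto
  obtain H where H: "linear H" "\<And>v. H (G a v) = v" "\<And>v. G a (H v) = v"
    using linear_injective_isomorphism[OF lina inj] by metis
  let ?D = "\<lambda>v. frechet_derivative w (at a) v
        - (\<Sum>b\<in>Basis. (u a \<bullet> b) *\<^sub>R frechet_derivative (\<lambda>x. G x b) (at a) v)"
  have "((\<lambda>x. w x - (\<Sum>b\<in>Basis. (u x \<bullet> b) *\<^sub>R (G x b - G a b))) has_derivative ?D) (at a)"
  proof (intro has_derivative_diff has_derivative_sum has_derivative_scaleR_zero)
    show "(w has_derivative frechet_derivative w (at a)) (at a)"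
      using w by (rule frechet_has_derivative)
    show "isCont (\<lambda>x. u x \<bullet> b) a" for b
      using ucont by (intro continuous_intros)
    show "((\<lambda>x. G x b - G a b) has_derivative frechet_derivative (\<lambda>x. G x b) (at a)) (at a)" for b
      using has_derivative_diff[OF frechet_has_derivative[OF G[of b]] has_derivative_const[of "G a b"]]
      by simp
  qed auto
  then have "((\<lambda>x. H (w x - (\<Sum>b\<in>Basis. (u x \<bullet> b) *\<^sub>R (G x b - G a b)))) has_derivative (\<lambda>v. H (?D v))) (at a)"
    using bounded_linear.has_derivative linear_conv_bounded_linear H(1) by blast
  then have "(u has_derivative (\<lambda>v. H (?D v))) (at a)"
    by (rule has_derivative_transform_within_open[OF _ S]) (metis key H(2))
  then show ?thesis
    using H(3) that by blast
qed

lemma Ck_on_linear_system: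
  fixes G :: "'a::real_normed_vector \<Rightarrow> 'e::euclidean_space \<Rightarrow> 'e"
  assumes S: "open S"
    and lin: "\<And>x. x \<in> S \<Longrightarrow> linear (G x)" and inj: "\<And>x. x \<in> S \<Longrightarrow> inj (G x)"
    and G: "\<And>b m. Ck_on m (\<lambda>x. G x b) S"
    and w: "Ck_on k w S"
    and eq: "\<And>x. x \<in> S \<Longrightarrow> G x (u x) = w x"
  shows "Ck_on k u S"
  using w eq
proof (induction k arbitrary: u w)
  case 0
  have "isCont u x" if x: "x \<in> S" for x
  proof (rule linear_system_isCont[where G = G and w = w, OF S x lin inj[OF x] 0(2)])
    show "isCont (\<lambda>x. G x b) x" for b
      using G[of 0 b] S x by (simp add: continuous_on_eq_continuous_at)
    show "isCont w x"
      using 0(1) S x by (simp add: continuous_on_eq_continuous_at)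
  qed
  then show ?case
    by (simp add: continuous_at_imp_continuous_on)
next
  case (Suc k)
  have Gd: "(\<lambda>x. G x b) differentiable (at x)" if "x \<in> S" for x b
    using G[of "Suc 0" b] that by simp
  have wd: "w differentiable (at x)" if "x \<in> S" for x
    using Suc.prems that by simp
  \<comment> \<open>The derivative of a solution solves a system with the same \<open>G\<close>.\<close>
  let ?W = "\<lambda>v x. frechet_derivative w (at x) v
      + - (\<Sum>b\<in>Basis. (u x \<bullet> b) *\<^sub>R frechet_derivative (\<lambda>x. G x b) (at x) v)"
  have d: "u differentiable (at x) \<and> (\<forall>v. G x (frechet_derivative u (at x) v) = ?W v x)"
    if x: "x \<in> S" for x
  proof -
    obtain u' where u': "(u has_derivative u') (at x)"
      and eq': "\<And>v. G x (u' v) = frechet_derivative w (at x) v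
        - (\<Sum>b\<in>Basis. (u x \<bullet> b) *\<^sub>R frechet_derivative (\<lambda>x. G x b) (at x) v)"
      using linear_system_has_derivative[OF S x lin inj[OF x] Suc.prems(2) Gd[OF x] wd[OF x]] by blast
    from u' have "u differentiable (at x)"
      unfolding differentiable_def by blast
    with eq' show ?thesis
      by (simp add: frechet_derivative_eq[OF u'])
  qed
  \<comment> \<open>The right-hand side \<open>?W v\<close> contains \<open>u\<close> itself. So the
    induction hypothesis serves twice: here for \<open>u\<close>, and below for the derivative of
    \<open>u\<close> as a solution with right-hand side \<open>?W v\<close>.\<close>
  have "Ck_on k u S"
    using Suc.IH[OF Ck_on_Suc_imp[OF Suc.prems(1)] Suc.prems(2)] .
  then have "Ck_on k (?W v) S" for v
    using Suc.prems(1) G[of "Suc k"]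
    by (intro Ck_on_add S Ck_on_sum Ck_on_linear[OF bounded_linear_minus[OF bounded_linear_ident]]
      Ck_on_bilinear[OF bounded_bilinear_scaleR] Ck_on_linear[OF bounded_linear_inner_left]) simp_all
  then have "Ck_on k (\<lambda>x. frechet_derivative u (at x) v) S" for v
    by (rule Suc.IH) (use d in blast)
  then show ?case
    using d by simp
qed

text \<open>Two mean value theorems: along \<open>u\<close> for the difference \<open>a\<close> of
  the values on opposite sides of the parallelogram, then along \<open>v\<close> for the derivative
  in direction \<open>u\<close>. The bound on \<open>h\<close> keeps the parallelogram inside the
  ball.\<close>

lemma second_difference_quotient:
  fixes f :: "'a::real_normed_vector \<Rightarrow> real"
  assumes S: "ball x e \<subseteq> S" and f: "\<And>y. y \<in> S \<Longrightarrow> f differentiable (at y)"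
    and f': "\<And>y. y \<in> S \<Longrightarrow> (\<lambda>z. frechet_derivative f (at z) u) differentiable (at y)"
    and h: "h > 0" "h * (norm u + norm v) < e"
  shows "\<exists>\<xi>\<in>{0<..<h}. \<exists>\<eta>\<in>{0<..<h}.
    f (x + h *\<^sub>R u + h *\<^sub>R v) - f (x + h *\<^sub>R u) - f (x + h *\<^sub>R v) + f x =
    h * h * frechet_derivative (\<lambda>z. frechet_derivative f (at z) u) (at (x + \<xi> *\<^sub>R u + \<eta> *\<^sub>R v)) v"
proof -
  have inS: "x + s *\<^sub>R u + t *\<^sub>R v \<in> S" if "0 \<le> s" "s \<le> h" "0 \<le> t" "t \<le> h" for s t
  proof -
    have "norm (s *\<^sub>R u + t *\<^sub>R v) \<le> s * norm u + t * norm v"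
      using that norm_triangle_ineq[of "s *\<^sub>R u" "t *\<^sub>R v"] by simp
    also have "\<dots> \<le> h * norm u + h * norm v"
      using that by (intro add_mono mult_right_mono) auto
    finally have "norm (s *\<^sub>R u + t *\<^sub>R v) < e"
      using h(2) by (simp add: algebra_simps)
    moreover have "dist x (x + s *\<^sub>R u + t *\<^sub>R v) = norm (s *\<^sub>R u + t *\<^sub>R v)"
      by (metis add.assoc dist_add_cancel add.right_neutral dist_0_norm)
    ultimately have "x + s *\<^sub>R u + t *\<^sub>R v \<in> ball x e"
      by simp
    then show ?thesis
      using S by blast
  qed
  have line: "((\<lambda>s. F (y + s *\<^sub>R w)) has_real_derivative frechet_derivative F (at (y + s *\<^sub>R w)) w) (at s)"
    if F: "F differentiable (at (y + s *\<^sub>R w))" for F :: "'a \<Rightarrow> real" and y w s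
  proof -
    have l: "((\<lambda>s. y + s *\<^sub>R w) has_derivative (\<lambda>s. s *\<^sub>R w)) (at s)"
      by (auto intro!: derivative_eq_intros)
    have "((\<lambda>s. F (y + s *\<^sub>R w)) has_derivative (\<lambda>r. frechet_derivative F (at (y + s *\<^sub>R w)) (r *\<^sub>R w))) (at s)"
      using diff_chain_at[OF l frechet_has_derivative[OF F]] by (simp add: o_def)
    moreover have "(\<lambda>r. frechet_derivative F (at (y + s *\<^sub>R w)) (r *\<^sub>R w)) =
        (*) (frechet_derivative F (at (y + s *\<^sub>R w)) w)"
      using linear_scale[OF linear_frechet_derivative[OF F]] by (auto simp: mult.commute)
    ultimately show ?thesis
      by (simp add: has_field_derivative_def)
  qed
  define a where "a s = f ((x + h *\<^sub>R v) + s *\<^sub>R u) - f (x + s *\<^sub>R u)" for s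
  have a': "(a has_real_derivative frechet_derivative f (at ((x + h *\<^sub>R v) + s *\<^sub>R u)) u
      - frechet_derivative f (at (x + s *\<^sub>R u)) u) (at s)" if "0 \<le> s" "s \<le> h" for s
    unfolding a_def using inS[of s h] inS[of s 0] that h(1)
    by (intro DERIV_diff line f) (auto simp: algebra_simps)
  obtain \<xi> where \<xi>: "0 < \<xi>" "\<xi> < h"
    "a h - a 0 = (h - 0) * (frechet_derivative f (at ((x + h *\<^sub>R v) + \<xi> *\<^sub>R u)) u
      - frechet_derivative f (at (x + \<xi> *\<^sub>R u)) u)"
    using MVT2[OF h(1) a'] by blast
  have b': "((\<lambda>t. frechet_derivative f (at ((x + \<xi> *\<^sub>R u) + t *\<^sub>R v)) u) has_real_derivative
      frechet_derivative (\<lambda>z. frechet_derivative f (at z) u) (at (x + \<xi> *\<^sub>R u + t *\<^sub>R v)) v) (at t)"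
    if "0 \<le> t" "t \<le> h" for t
    using inS[of \<xi> t] that \<xi> by (intro line[of "\<lambda>z. frechet_derivative f (at z) u"] f') auto
  obtain \<eta> where \<eta>: "0 < \<eta>" "\<eta> < h"
    "frechet_derivative f (at ((x + \<xi> *\<^sub>R u) + h *\<^sub>R v)) u -
      frechet_derivative f (at ((x + \<xi> *\<^sub>R u) + 0 *\<^sub>R v)) u = (h - 0) *
      frechet_derivative (\<lambda>z. frechet_derivative f (at z) u) (at (x + \<xi> *\<^sub>R u + \<eta> *\<^sub>R v)) v"
    using MVT2[OF h(1) b'] by blast
  have "f (x + h *\<^sub>R u + h *\<^sub>R v) - f (x + h *\<^sub>R u) - f (x + h *\<^sub>R v) + f x = a h - a 0"
    by (simp add: a_def algebra_simps)
  also have "\<dots> = h * h * frechet_derivative (\<lambda>z. frechet_derivative f (at z) u) (at (x + \<xi> *\<^sub>R u + \<eta> *\<^sub>R v)) v"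
    using \<xi>(3) \<eta>(3) by (simp add: algebra_simps)
  finally show ?thesis
    using \<xi>(1,2) \<eta>(1,2) greaterThanLessThan_iff by blast
qed

text \<open>Schwarz's theorem: the second difference quotient is symmetric in \<open>u\<close> and
  \<open>v\<close>, and for \<open>h\<close> tending to 0 from the right it converges to the mixed
  derivative in either order.\<close>

lemma frechet_derivative_commute_real:
  fixes f :: "'a::real_normed_vector \<Rightarrow> real"
  assumes S: "open S" "x \<in> S" and f: "Ck_on 2 f S"
  shows "frechet_derivative (\<lambda>z. frechet_derivative f (at z) u) (at x) v =
    frechet_derivative (\<lambda>z. frechet_derivative f (at z) v) (at x) u"
proof -
  have f1: "f differentiable (at y)" and
    f2: "(\<lambda>z. frechet_derivative f (at z) w) differentiable (at y)" if "y \<in> S" for y w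
    using f that by (auto simp: numeral_2_eq_2)
  let ?D = "\<lambda>u v y. frechet_derivative (\<lambda>z. frechet_derivative f (at z) u) (at y) v"
  have cont: "isCont (?D u v) x" for u v
    using f S by (auto simp: numeral_2_eq_2 continuous_on_eq_continuous_at)
  obtain e where e: "e > 0" "ball x e \<subseteq> S"
    using S by (auto simp: open_contains_ball)
  let ?\<Delta> = "\<lambda>u v h. (f (x + h *\<^sub>R u + h *\<^sub>R v) - f (x + h *\<^sub>R u) - f (x + h *\<^sub>R v) + f x) / (h * h)"
  have lim: "((?\<Delta> u v) \<longlongrightarrow> ?D u v x) (at_right 0)" for u v
  proof (rule tendstoI)
    fix r :: real
    assume "r > 0"
    then obtain d where d: "d > 0" "\<And>y. dist y x < d \<Longrightarrow> dist (?D u v y) (?D u v x) < r"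
      using cont[of u v] unfolding continuous_at_eps_delta by blast
    \<comment> \<open>The summand 1 keeps \<open>n\<close> positive when \<open>u\<close> and
      \<open>v\<close> are both 0, so that \<open>min d e / n\<close> is a radius.\<close>
    define n where "n = norm u + norm v + 1"
    have n: "n > 0"
      by (simp add: n_def add_nonneg_pos)
    have "dist (?\<Delta> u v h) (?D u v x) < r" if h: "0 < h" "h < min d e / n" for h
    proof -
      have hn: "h * n < d" "h * n < e"
        using h n by (simp_all add: field_simps)
      then have "h * (norm u + norm v) < e"
        using h(1) by (simp add: n_def algebra_simps)
      then obtain \<xi> \<eta> where *: "\<xi> \<in> {0<..<h}" "\<eta> \<in> {0<..<h}"
        "f (x + h *\<^sub>R u + h *\<^sub>R v) - f (x + h *\<^sub>R u) - f (x + h *\<^sub>R v) + f x =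
          h * h * ?D u v (x + \<xi> *\<^sub>R u + \<eta> *\<^sub>R v)"
        using second_difference_quotient[OF e(2) f1 f2 h(1)] by blast
      then have "?\<Delta> u v h = ?D u v (x + \<xi> *\<^sub>R u + \<eta> *\<^sub>R v)"
        using h(1) by simp
      moreover have "dist (x + \<xi> *\<^sub>R u + \<eta> *\<^sub>R v) x < d"
      proof -
        have "dist (x + \<xi> *\<^sub>R u + \<eta> *\<^sub>R v) x = norm (\<xi> *\<^sub>R u + \<eta> *\<^sub>R v)"
          by (simp add: dist_norm algebra_simps)
        also have "\<dots> \<le> \<xi> * norm u + \<eta> * norm v"
          using norm_triangle_ineq[of "\<xi> *\<^sub>R u" "\<eta> *\<^sub>R v"] *(1,2) by (simp only: norm_scaleR) simp
        also have "\<dots> \<le> h * norm u + h * norm v"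
          using *(1,2) by (intro add_mono mult_right_mono) auto
        also have "\<dots> \<le> h * n"
          using h(1) by (simp add: n_def algebra_simps)
        finally show ?thesis
          using hn by simp
      qed
      ultimately show ?thesis
        using d(2) by simp
    qed
    moreover have "0 < min d e / n"
      using d(1) e(1) n by simp
    ultimately show "eventually (\<lambda>h. dist (?\<Delta> u v h) (?D u v x) < r) (at_right 0)"
      unfolding eventually_at_right_field by (metis)
  qed
  have sym: "?\<Delta> u v = ?\<Delta> v u"
    by (auto simp: algebra_simps)
  show ?thesis
    using tendsto_unique[OF trivial_limit_at_right_real lim[of u v] lim[of v u, folded sym]] .
qed

text \<open>Componentwise, since the mean value theorem behind the real case is not valid for vector
  values.\<close>

lemma frechet_derivative_commute:
  fixes f :: "'a::real_normed_vector \<Rightarrow> 'b::euclidean_space"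
  assumes S: "open S" "x \<in> S" and f: "Ck_on 2 f S"
  shows "frechet_derivative (\<lambda>z. frechet_derivative f (at z) u) (at x) v =
    frechet_derivative (\<lambda>z. frechet_derivative f (at z) v) (at x) u"
proof (rule euclidean_eqI)
  fix b :: 'b
  have f1: "f differentiable (at y)" and
    f2: "(\<lambda>z. frechet_derivative f (at z) w) differentiable (at y)" if "y \<in> S" for y w
    using f that by (auto simp: numeral_2_eq_2)
  have inner: "frechet_derivative (\<lambda>z. F z \<bullet> b) (at y) w = frechet_derivative F (at y) w \<bullet> b"
    if "F differentiable (at y)" for F :: "'a \<Rightarrow> 'b" and y w
    using frechet_derivative_eq[OF bounded_linear.has_derivative[OF bounded_linear_inner_left
      frechet_has_derivative[OF that]]] by metis
  have *: "frechet_derivative (\<lambda>z. frechet_derivative f (at z) u) (at x) v \<bullet> b =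
    frechet_derivative (\<lambda>z. frechet_derivative (\<lambda>y. f y \<bullet> b) (at z) u) (at x) v" for u v
    using frechet_derivative_cong_open[OF S, of "\<lambda>z. frechet_derivative (\<lambda>y. f y \<bullet> b) (at z) u"
      "\<lambda>z. frechet_derivative f (at z) u \<bullet> b"] inner f1 f2 S by simp
  show "frechet_derivative (\<lambda>z. frechet_derivative f (at z) u) (at x) v \<bullet> b =
    frechet_derivative (\<lambda>z. frechet_derivative f (at z) v) (at x) u \<bullet> b"
    unfolding * by (rule frechet_derivative_commute_real[OF S Ck_on_linear[OF bounded_linear_inner_left S(1) f]])
qed

section \<open>Smooth functions and vector fields on manifolds\<close>

lemma smooth_on_cong:
  "open S \<Longrightarrow> smooth_on S f \<Longrightarrow> (\<And>y. y \<in> S \<Longrightarrow> f y = g y) \<Longrightarrow> smooth_on S g"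
  unfolding smooth_on_def using Ck_on_cong by blast

lemma smooth_on_subset: "smooth_on S f \<Longrightarrow> T \<subseteq> S \<Longrightarrow> smooth_on T f"
  unfolding smooth_on_def using Ck_on_subset by blast

lemma smooth_on_local:
  "(\<And>x. x \<in> S \<Longrightarrow> \<exists>U. open U \<and> x \<in> U \<and> smooth_on U f) \<Longrightarrow> smooth_on S f"
  unfolding smooth_on_def using Ck_on_local by metis

lemma smooth_on_compose:
  fixes f :: "'a::euclidean_space \<Rightarrow> 'b::real_normed_vector"
  assumes "open S" "\<And>x. x \<in> S \<Longrightarrow> g x \<in> T" "smooth_on T f" "smooth_on S g"
  shows "smooth_on S (\<lambda>x. f (g x))"
  using assms unfolding smooth_on_def by (blast intro: Ck_on_compose)

lemma smooth_on_differentiable: "smooth_on S f \<Longrightarrow> x \<in> S \<Longrightarrow> f differentiable (at x)"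
  unfolding smooth_on_def using Ck_on.simps(2) by blast

lemma smooth_on_frechet_derivative:
  "smooth_on S f \<Longrightarrow> smooth_on S (\<lambda>x. frechet_derivative f (at x) v)"
  unfolding smooth_on_def using Ck_on.simps(2) by blast

locale smooth_manifold =
  fixes A :: "('m::{t2_space,second_countable_topology}, 'e::euclidean_space) chart set"
  assumes atlas: "smooth_atlas A"
begin

lemma chart_at: "chart_at A p \<in> A" "p \<in> fst (chart_at A p)"
proof -
  have "\<exists>C. C \<in> A \<and> p \<in> fst C"
    using atlas unfolding smooth_atlas_def by blast
  then have "chart_at A p \<in> A \<and> p \<in> fst (chart_at A p)"
    unfolding chart_at_def by (rule someI_ex)
  then show "chart_at A p \<in> A" "p \<in> fst (chart_at A p)"
    by auto
qed

lemma is_chart: "C \<in> A \<Longrightarrow> is_chart C"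
  using atlas unfolding smooth_atlas_def by blast

lemma open_domain: "C \<in> A \<Longrightarrow> open (fst C)"
  using is_chart unfolding is_chart_def by blast

lemma chart_inv_chart: "C \<in> A \<Longrightarrow> p \<in> fst C \<Longrightarrow> chart_inv C (snd C p) = p"
  using is_chart[of C] unfolding is_chart_def homeomorphism_def by blast

lemma chart_chart_inv:
  assumes "C \<in> A" "x \<in> snd C ` (fst C \<inter> S)"
  shows "snd C (chart_inv C x) = x \<and> chart_inv C x \<in> fst C \<inter> S"
proof -
  obtain p where "p \<in> fst C" "p \<in> S" "x = snd C p"
    using assms(2) by blast
  then show ?thesis
    by (simp add: chart_inv_chart[OF assms(1)])
qed

lemma open_chart_image:
  assumes "C \<in> A" "open S"
  shows "open (snd C ` (fst C \<inter> S))"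
proof -
  have "snd C ` (fst C \<inter> S) = (snd C ` fst C) \<inter> chart_inv C -` S"
    using chart_inv_chart[OF assms(1)] by force
  moreover have "open (snd C ` fst C)" "continuous_on (snd C ` fst C) (chart_inv C)"
    using is_chart[OF assms(1)] unfolding is_chart_def homeomorphism_def by blast+
  ultimately show ?thesis
    using assms(2) by (simp add: continuous_open_preimage)
qed

lemma smooth_transition:
  "C \<in> A \<Longrightarrow> C' \<in> A \<Longrightarrow> smooth_on (snd C ` (fst C \<inter> fst C')) (snd C' \<circ> chart_inv C)"
  using atlas unfolding smooth_atlas_def by blast

lemma smooth_funD:
  "smooth_fun A S u \<Longrightarrow> C \<in> A \<Longrightarrow> smooth_on (snd C ` (fst C \<inter> S)) (u \<circ> chart_inv C)"
  unfolding smooth_fun_def by blast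

lemma smooth_fun_subset: "smooth_fun A S u \<Longrightarrow> T \<subseteq> S \<Longrightarrow> smooth_fun A T u"
  unfolding smooth_fun_def by (meson Int_mono image_mono order_refl smooth_on_subset)

lemma smooth_fun_cong:
  assumes "open S" "smooth_fun A S u" "\<And>p. p \<in> S \<Longrightarrow> u p = u' p"
  shows "smooth_fun A S u'"
  unfolding smooth_fun_def
proof
  fix C
  assume C: "C \<in> A"
  show "smooth_on (snd C ` (fst C \<inter> S)) (u' \<circ> chart_inv C)"
    by (rule smooth_on_cong[OF open_chart_image[OF C assms(1)] smooth_funD[OF assms(2) C]])
      (use chart_chart_inv[OF C] assms(3) in auto)
qed

text \<open>Any other chart is reached by a smooth transition map, so one chart covering
  \<open>U\<close> decides smoothness in all of them.\<close>

lemma smooth_fun_chartI: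
  assumes C: "C \<in> A" and U: "open U" "U \<subseteq> fst C" and u: "smooth_on (snd C ` U) (u \<circ> chart_inv C)"
  shows "smooth_fun A U u"
  unfolding smooth_fun_def
proof
  fix C'
  assume C': "C' \<in> A"
  have o: "open (snd C' ` (fst C' \<inter> U))"
    using open_chart_image[OF C' U(1)] .
  have tr: "smooth_on (snd C' ` (fst C' \<inter> U)) (snd C \<circ> chart_inv C')"
    by (rule smooth_on_subset[OF smooth_transition[OF C' C]]) (use U in blast)
  show "smooth_on (snd C' ` (fst C' \<inter> U)) (u \<circ> chart_inv C')"
  proof (rule smooth_on_cong[OF o smooth_on_compose[OF o _ u tr]])
    fix x
    assume x: "x \<in> snd C' ` (fst C' \<inter> U)"
    then have "chart_inv C' x \<in> U"
      using chart_chart_inv[OF C'] by blast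
    then show "(snd C \<circ> chart_inv C') x \<in> snd C ` U"
      "(u \<circ> chart_inv C) ((snd C \<circ> chart_inv C') x) = (u \<circ> chart_inv C') x"
      using chart_inv_chart[OF C] U by auto
  qed
qed

lemma smooth_fun_local:
  assumes "\<And>p. p \<in> S \<Longrightarrow> \<exists>U. open U \<and> p \<in> U \<and> smooth_fun A U u"
  shows "smooth_fun A S u"
  unfolding smooth_fun_def
proof (intro ballI smooth_on_local)
  fix C x
  assume C: "C \<in> A" and x: "x \<in> snd C ` (fst C \<inter> S)"
  then obtain p where p: "p \<in> fst C" "p \<in> S" "x = snd C p"
    by blast
  then obtain U where U: "open U" "p \<in> U" "smooth_fun A U u"
    using assms by blast
  then show "\<exists>V. open V \<and> x \<in> V \<and> smooth_on V (u \<circ> chart_inv C)"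
    using p open_chart_image[OF C U(1)] smooth_funD[OF U(3) C] by blast
qed

lemma smooth_fun_iff_Ck_on:
  "smooth_fun A S u \<longleftrightarrow> (\<forall>C\<in>A. \<forall>k. Ck_on k (\<lambda>x. u (chart_inv C x)) (snd C ` (fst C \<inter> S)))"
  by (simp add: smooth_fun_def smooth_on_def o_def)

lemma smooth_fun_const: "smooth_fun A S (\<lambda>p. c)"
  by (simp add: smooth_fun_iff_Ck_on Ck_on_const)

lemma smooth_fun_linear:
  assumes "bounded_linear L" "open S" "smooth_fun A S u"
  shows "smooth_fun A S (\<lambda>p. L (u p))"
  using assms(2-) unfolding smooth_fun_iff_Ck_on
  by (intro ballI allI Ck_on_linear[OF assms(1)] open_chart_image) blast+

lemma smooth_fun_add:
  assumes "open S" "smooth_fun A S u" "smooth_fun A S u'"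
  shows "smooth_fun A S (\<lambda>p. u p + u' p)"
  using assms unfolding smooth_fun_iff_Ck_on
  by (intro ballI allI Ck_on_add open_chart_image) blast+

lemma smooth_fun_sum:
  assumes "open S" "\<And>i. i \<in> I \<Longrightarrow> smooth_fun A S (u i)"
  shows "smooth_fun A S (\<lambda>p. \<Sum>i\<in>I. u i p)"
  using assms unfolding smooth_fun_iff_Ck_on
  by (intro ballI allI Ck_on_sum open_chart_image) blast+

lemma smooth_fun_bilinear:
  assumes "bounded_bilinear pr" "open S" "smooth_fun A S u" "smooth_fun A S u'"
  shows "smooth_fun A S (\<lambda>p. pr (u p) (u' p))"
  using assms(2-) unfolding smooth_fun_iff_Ck_on
  by (intro ballI allI Ck_on_bilinear[OF assms(1)] open_chart_image) blast+

lemmas smooth_fun_scaleR = smooth_fun_bilinear[OF bounded_bilinear_scaleR]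
lemmas smooth_fun_mult = smooth_fun_bilinear[OF bounded_bilinear_mult]
lemmas smooth_fun_inner_left = smooth_fun_linear[OF bounded_linear_inner_left]

lemma smooth_fun_linear_system:
  fixes G :: "'m \<Rightarrow> 'v::euclidean_space \<Rightarrow> 'v"
  assumes S: "open S" and G: "\<And>p. p \<in> S \<Longrightarrow> linear (G p)" "\<And>p. p \<in> S \<Longrightarrow> inj (G p)"
    "\<And>b. smooth_fun A S (\<lambda>p. G p b)" and w: "smooth_fun A S w"
    and eq: "\<And>p. p \<in> S \<Longrightarrow> G p (u p) = w p"
  shows "smooth_fun A S u"
  unfolding smooth_fun_iff_Ck_on
proof (intro ballI allI)
  fix C k
  assume C: "C \<in> A"
  let ?G = "\<lambda>x. G (chart_inv C x)"
  show "Ck_on k (\<lambda>x. u (chart_inv C x)) (snd C ` (fst C \<inter> S))"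
  proof (rule Ck_on_linear_system[where G = ?G and w = "\<lambda>x. w (chart_inv C x)"])
    show "open (snd C ` (fst C \<inter> S))"
      by (rule open_chart_image[OF C S])
    show "Ck_on m (\<lambda>x. ?G x b) (snd C ` (fst C \<inter> S))" for b m
      using G(3)[of b] C unfolding smooth_fun_iff_Ck_on by blast
    show "Ck_on k (\<lambda>x. w (chart_inv C x)) (snd C ` (fst C \<inter> S))"
      using w C unfolding smooth_fun_iff_Ck_on by blast
  qed (use chart_chart_inv[OF C, of _ S] G(1,2) eq in auto)
qed

lemma smooth_fun_chart: "C \<in> A \<Longrightarrow> smooth_fun A (fst C) (snd C)"
  unfolding smooth_fun_def using smooth_transition by blast

lemma smooth_fun_differentiable:
  "smooth_fun A S u \<Longrightarrow> p \<in> S \<Longrightarrow> C \<in> A \<Longrightarrow> p \<in> fst C \<Longrightarrow>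
    (u \<circ> chart_inv C) differentiable (at (snd C p))"
  using smooth_funD smooth_on_differentiable by blast

section \<open>Calculus of directional derivatives on a manifold\<close>

lemma dir_deriv_has_derivative:
  assumes "smooth_fun A S u" "p \<in> S"
  shows "((u \<circ> chart_inv (chart_at A p)) has_derivative (\<lambda>v. dir_deriv A p v u)) (at (snd (chart_at A p) p))"
  unfolding dir_deriv_def
  by (rule frechet_has_derivative smooth_fun_differentiable assms chart_at)+

lemma dir_deriv_eqI:
  "((u \<circ> chart_inv (chart_at A p)) has_derivative u') (at (snd (chart_at A p) p)) \<Longrightarrow> dir_deriv A p v u = u' v"
  unfolding dir_deriv_def by (simp add: frechet_derivative_eq)

lemma linear_dir_deriv:
  assumes "smooth_fun A S u" "p \<in> S"
  shows "linear (\<lambda>v. dir_deriv A p v u)"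
  using dir_deriv_has_derivative[OF assms] by (rule has_derivative_linear)

lemma dir_deriv_cong:
  assumes "open S" "p \<in> S" "\<And>q. q \<in> S \<Longrightarrow> u q = u' q"
  shows "dir_deriv A p v u = dir_deriv A p v u'"
proof -
  let ?C = "chart_at A p"
  have "frechet_derivative (u \<circ> chart_inv ?C) (at (snd ?C p)) = frechet_derivative (u' \<circ> chart_inv ?C) (at (snd ?C p))"
  proof (rule frechet_derivative_cong_open[OF open_chart_image[OF chart_at(1) assms(1)]])
    show "snd ?C p \<in> snd ?C ` (fst ?C \<inter> S)"
      using chart_at(2) assms(2) by blast
    show "(u \<circ> chart_inv ?C) x = (u' \<circ> chart_inv ?C) x" if "x \<in> snd ?C ` (fst ?C \<inter> S)" for x
      using chart_chart_inv[OF chart_at(1) that] assms(3) by auto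
  qed
  then show ?thesis
    unfolding dir_deriv_def by simp
qed

lemma dir_deriv_const: "dir_deriv A p v (\<lambda>q. c) = 0"
  by (simp add: dir_deriv_def o_def)

lemma dir_deriv_add:
  assumes "smooth_fun A S u" "smooth_fun A S u'" "p \<in> S"
  shows "dir_deriv A p v (\<lambda>q. u q + u' q) = dir_deriv A p v u + dir_deriv A p v u'"
  by (rule dir_deriv_eqI)
    (use has_derivative_add[OF dir_deriv_has_derivative[OF assms(1,3)] dir_deriv_has_derivative[OF assms(2,3)]]
      in \<open>simp add: o_def\<close>)

lemma dir_deriv_sum:
  assumes "\<And>i. i \<in> I \<Longrightarrow> smooth_fun A S (u i)" "p \<in> S"
  shows "dir_deriv A p v (\<lambda>q. \<Sum>i\<in>I. u i q) = (\<Sum>i\<in>I. dir_deriv A p v (u i))"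
  by (rule dir_deriv_eqI)
    (use has_derivative_sum[OF dir_deriv_has_derivative[OF assms(1) assms(2)]] in \<open>simp add: o_def\<close>)

lemma dir_deriv_linear:
  assumes "bounded_linear L" "smooth_fun A S u" "p \<in> S"
  shows "dir_deriv A p v (\<lambda>q. L (u q)) = L (dir_deriv A p v u)"
  by (rule dir_deriv_eqI)
    (use bounded_linear.has_derivative[OF assms(1) dir_deriv_has_derivative[OF assms(2,3)]] in \<open>simp add: o_def\<close>)

lemma dir_deriv_bilinear:
  assumes "bounded_bilinear pr" "smooth_fun A S u" "smooth_fun A S u'" "p \<in> S"
  shows "dir_deriv A p v (\<lambda>q. pr (u q) (u' q)) = pr (u p) (dir_deriv A p v u') + pr (dir_deriv A p v u) (u' p)"
  by (rule dir_deriv_eqI)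
    (use bounded_bilinear.FDERIV[OF assms(1) dir_deriv_has_derivative[OF assms(2,4)] dir_deriv_has_derivative[OF assms(3,4)]]
      chart_inv_chart[OF chart_at] in \<open>simp add: o_def\<close>)

lemmas dir_deriv_scaleR = dir_deriv_bilinear[OF bounded_bilinear_scaleR]
lemmas dir_deriv_mult = dir_deriv_bilinear[OF bounded_bilinear_mult]

section \<open>Components of tangent vectors, coordinate fields and smooth vector fields\<close>

lemma tcomp_eq_dir_deriv: "tcomp A C p v = dir_deriv A p v (snd C)"
  by (simp add: tcomp_def dir_deriv_def)

lemma linear_tcomp: "C \<in> A \<Longrightarrow> p \<in> fst C \<Longrightarrow> linear (tcomp A C p)"
  using linear_dir_deriv[OF smooth_fun_chart] by (simp add: tcomp_eq_dir_deriv[abs_def])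

text \<open>Chain rule through the transition map from the preferred chart at \<open>p\<close> to
  \<open>C\<close>, whose derivative is \<open>tcomp A C p\<close>. It replaces the jumping
  preferred chart by a fixed one.\<close>

lemma dir_deriv_chart:
  assumes u: "smooth_fun A S u" "p \<in> S" "open S" and C: "C \<in> A" "p \<in> fst C"
  shows "dir_deriv A p v u = frechet_derivative (u \<circ> chart_inv C) (at (snd C p)) (tcomp A C p v)"
proof -
  let ?P = "chart_at A p"
  let ?T = "snd ?P ` (fst ?P \<inter> fst C)"
  have 1: "((snd C \<circ> chart_inv ?P) has_derivative tcomp A C p) (at (snd ?P p))"
    using dir_deriv_has_derivative[OF smooth_fun_chart[OF C(1)] C(2)] by (simp add: tcomp_eq_dir_deriv[abs_def])
  have 2: "(snd C \<circ> chart_inv ?P) (snd ?P p) = snd C p"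
    using chart_inv_chart[OF chart_at] by simp
  have "((u \<circ> chart_inv C) \<circ> (snd C \<circ> chart_inv ?P) has_derivative
      frechet_derivative (u \<circ> chart_inv C) (at (snd C p)) \<circ> tcomp A C p) (at (snd ?P p))"
    by (rule diff_chain_at[OF 1]) (use 2 frechet_has_derivative smooth_fun_differentiable[OF u(1,2) C] in simp)
  then have "((u \<circ> chart_inv ?P) has_derivative
      frechet_derivative (u \<circ> chart_inv C) (at (snd C p)) \<circ> tcomp A C p) (at (snd ?P p))"
  proof (rule has_derivative_transform_within_open)
    show "open ?T"
      by (rule open_chart_image[OF chart_at(1) open_domain[OF C(1)]])
    show "snd ?P p \<in> ?T"
      using chart_at(2) C(2) by blast
    fix x
    assume "x \<in> ?T"
    then show "((u \<circ> chart_inv C) \<circ> (snd C \<circ> chart_inv ?P)) x = (u \<circ> chart_inv ?P) x"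
      using chart_chart_inv[OF chart_at(1)] chart_inv_chart[OF C(1)] by fastforce
  qed
  then show ?thesis
    by (simp add: dir_deriv_eqI)
qed

lemma tcomp_change:
  "C \<in> A \<Longrightarrow> C' \<in> A \<Longrightarrow> p \<in> fst C \<Longrightarrow> p \<in> fst C' \<Longrightarrow>
    tcomp A C' p v = frechet_derivative (snd C' \<circ> chart_inv C) (at (snd C p)) (tcomp A C p v)"
  unfolding tcomp_eq_dir_deriv[of C']
  by (rule dir_deriv_chart[OF smooth_fun_chart]) (auto simp: open_domain)

lemma frechet_derivative_chart_chart_inv:
  assumes C: "C \<in> A" "p \<in> fst C"
  shows "frechet_derivative (snd C \<circ> chart_inv C) (at (snd C p)) = (\<lambda>v. v)"
proof -
  have "frechet_derivative (snd C \<circ> chart_inv C) (at (snd C p)) = frechet_derivative (\<lambda>x. x) (at (snd C p))"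
  proof (rule frechet_derivative_cong_open)
    show "open (snd C ` (fst C \<inter> UNIV))"
      by (rule open_chart_image[OF C(1)]) simp
  qed (use C chart_inv_chart[OF C(1)] in auto)
  then show ?thesis
    by simp
qed

lemma tcomp_chart_at: "tcomp A (chart_at A p) p v = v"
  using frechet_derivative_chart_chart_inv[OF chart_at] by (simp add: tcomp_def)

text \<open>\<open>coord_field\<close> is the derivative of the transition from \<open>C\<close> to
  the preferred chart, so this is \<open>tcomp_change\<close> with the preferred chart as
  target.\<close>

lemma coord_field_tcomp: "C \<in> A \<Longrightarrow> p \<in> fst C \<Longrightarrow> coord_field A C (tcomp A C p v) p = v"
  using tcomp_change[of C "chart_at A p" p v] chart_at tcomp_chart_at by (simp add: coord_field_def)

lemma linear_coord_field: "C \<in> A \<Longrightarrow> p \<in> fst C \<Longrightarrow> linear (\<lambda>b. coord_field A C b p)"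
  unfolding coord_field_def
  by (intro linear_frechet_derivative smooth_fun_differentiable[OF smooth_fun_chart] chart_at)

text \<open>In finite dimension the one-sided inverse from \<open>coord_field_tcomp\<close> is
  two-sided: \<open>tcomp A C p\<close> is injective, hence surjective.\<close>

lemma tcomp_coord_field:
  assumes "C \<in> A" "p \<in> fst C"
  shows "tcomp A C p (coord_field A C b p) = b"
proof -
  have "inj (tcomp A C p)"
    by (rule inj_on_inverseI[of _ "\<lambda>b. coord_field A C b p"]) (rule coord_field_tcomp[OF assms])
  then have "surj (tcomp A C p)"
    using linear_injective_imp_surjective linear_tcomp[OF assms] by blast
  then obtain v where "b = tcomp A C p v"
    by blast
  then show ?thesis
    using coord_field_tcomp[OF assms] by simp
qed

lemma coord_field_chart_at: "coord_field A (chart_at A p) b p = b"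
  using tcomp_coord_field[OF chart_at] tcomp_chart_at by metis

lemma vf_expand:
  assumes "C \<in> A" "p \<in> fst C"
  shows "v = (\<Sum>b\<in>Basis. (tcomp A C p v \<bullet> b) *\<^sub>R coord_field A C b p)"
  using linear_eq_sum_Basis[OF linear_coord_field[OF assms], of "tcomp A C p v"]
    coord_field_tcomp[OF assms] by simp

lemma smooth_vf_iff:
  assumes "open S"
  shows "smooth_vf A S X \<longleftrightarrow> (\<forall>C\<in>A. smooth_fun A (fst C \<inter> S) (\<lambda>p. tcomp A C p (X p)))"
proof
  assume "smooth_vf A S X"
  then show "\<forall>C\<in>A. smooth_fun A (fst C \<inter> S) (\<lambda>p. tcomp A C p (X p))"
    unfolding smooth_vf_def using assms open_domain
    by (intro ballI smooth_fun_chartI) (blast intro: open_Int)+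
next
  assume "\<forall>C\<in>A. smooth_fun A (fst C \<inter> S) (\<lambda>p. tcomp A C p (X p))"
  then show "smooth_vf A S X"
    unfolding smooth_vf_def using smooth_funD by (metis Int_left_absorb)
qed

lemma smooth_vf_subset: "smooth_vf A S X \<Longrightarrow> T \<subseteq> S \<Longrightarrow> smooth_vf A T X"
  unfolding smooth_vf_def by (meson Int_mono image_mono order_refl smooth_on_subset)

text \<open>Near \<open>p\<close> the chart at \<open>p\<close> is kept fixed; there the derivative
  is a sum of components of \<open>X\<close> times partial derivatives of \<open>u\<close>, all
  smooth.\<close>

lemma smooth_fun_dir_deriv:
  assumes S: "open S" and u: "smooth_fun A S u" and X: "smooth_vf A S X"
  shows "smooth_fun A S (\<lambda>p. dir_deriv A p (X p) u)"
proof (rule smooth_fun_local)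
  fix p
  assume "p \<in> S"
  let ?C = "chart_at A p"
  let ?U = "fst ?C \<inter> S"
  have U: "open ?U"
    using S open_domain chart_at by blast
  let ?D = "\<lambda>x b. frechet_derivative (u \<circ> chart_inv ?C) (at x) b"
  have D: "smooth_fun A ?U (\<lambda>q. ?D (snd ?C q) b)" for b
  proof (rule smooth_fun_chartI[OF chart_at(1) U])
    show "smooth_on (snd ?C ` ?U) ((\<lambda>q. ?D (snd ?C q) b) \<circ> chart_inv ?C)"
      by (rule smooth_on_cong[OF open_chart_image[OF chart_at(1) S]
          smooth_on_frechet_derivative[OF smooth_funD[OF u chart_at(1)]]])
        (use chart_chart_inv[OF chart_at(1)] in auto)
  qed auto
  have "smooth_fun A ?U (\<lambda>q. \<Sum>b\<in>Basis. (tcomp A ?C q (X q) \<bullet> b) *\<^sub>R ?D (snd ?C q) b)"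
    using X[unfolded smooth_vf_iff[OF S]] chart_at(1)
    by (intro smooth_fun_sum smooth_fun_scaleR smooth_fun_inner_left U D) blast
  then have "smooth_fun A ?U (\<lambda>p. dir_deriv A p (X p) u)"
  proof (rule smooth_fun_cong[OF U])
    fix q
    assume q: "q \<in> ?U"
    then have "linear (?D (snd ?C q))"
      using smooth_fun_differentiable[OF u _ chart_at(1)] by (auto intro: linear_frechet_derivative)
    then show "(\<Sum>b\<in>Basis. (tcomp A ?C q (X q) \<bullet> b) *\<^sub>R ?D (snd ?C q) b) = dir_deriv A q (X q) u"
      using linear_eq_sum_Basis dir_deriv_chart[OF u _ S chart_at(1)] q by (metis IntD1 IntD2)
  qed
  then show "\<exists>U. open U \<and> p \<in> U \<and> smooth_fun A U (\<lambda>p. dir_deriv A p (X p) u)"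
    using U \<open>p \<in> S\<close> chart_at(2) by blast
qed

lemma smooth_fun_tcomp_coord_field:
  assumes C: "C \<in> A" "C' \<in> A"
  shows "smooth_fun A (fst C \<inter> fst C') (\<lambda>p. tcomp A C' p (coord_field A C b p))"
proof (rule smooth_fun_chartI[OF C(1)])
  let ?U = "fst C \<inter> fst C'"
  show "open ?U" "?U \<subseteq> fst C"
    using open_domain[OF C(1)] open_domain[OF C(2)] by auto
  show "smooth_on (snd C ` ?U) ((\<lambda>p. tcomp A C' p (coord_field A C b p)) \<circ> chart_inv C)"
  proof (rule smooth_on_cong[OF open_chart_image[OF C(1) open_domain[OF C(2)]]
      smooth_on_frechet_derivative[OF smooth_transition[OF C]]])
    fix x
    assume "x \<in> snd C ` ?U"
    then show "frechet_derivative (snd C' \<circ> chart_inv C) (at x) b =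
        ((\<lambda>p. tcomp A C' p (coord_field A C b p)) \<circ> chart_inv C) x"
      using chart_chart_inv[OF C(1)] tcomp_change[OF C] tcomp_coord_field[OF C(1)] by simp
  qed
qed

lemma smooth_vf_coord_field: "C \<in> A \<Longrightarrow> smooth_vf A (fst C) (coord_field A C b)"
  using smooth_fun_tcomp_coord_field[of C] by (simp only: smooth_vf_iff open_domain Int_commute) blast

text \<open>Components in another chart are obtained from those in \<open>C\<close> with the smooth
  coefficients of \<open>smooth_fun_tcomp_coord_field\<close>, so one chart around each point is
  enough.\<close>

lemma smooth_vfI_local:
  assumes S: "open S"
    and X: "\<And>p. p \<in> S \<Longrightarrow> \<exists>C\<in>A. \<exists>U. open U \<and> p \<in> U \<and> U \<subseteq> fst C \<and> smooth_fun A U (\<lambda>q. tcomp A C q (X q))"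
  shows "smooth_vf A S X"
  unfolding smooth_vf_iff[OF S]
proof (intro ballI smooth_fun_local)
  fix C' p
  assume C': "C' \<in> A" and "p \<in> fst C' \<inter> S"
  then obtain C U where C: "C \<in> A" and U: "open U" "p \<in> U" "U \<subseteq> fst C"
    "smooth_fun A U (\<lambda>q. tcomp A C q (X q))" and p: "p \<in> fst C'"
    using X[of p] by blast
  let ?V = "U \<inter> fst C'"
  have V: "open ?V"
    using U(1) open_domain[OF C'] by blast
  have "smooth_fun A ?V (\<lambda>q. \<Sum>b\<in>Basis. (tcomp A C q (X q) \<bullet> b) *\<^sub>R tcomp A C' q (coord_field A C b q))"
    using smooth_fun_subset[OF U(4), of ?V] smooth_fun_subset[OF smooth_fun_tcomp_coord_field[OF C C'], of ?V] U(3)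
    by (intro smooth_fun_sum smooth_fun_scaleR smooth_fun_inner_left V) auto
  then have "smooth_fun A ?V (\<lambda>q. tcomp A C' q (X q))"
  proof (rule smooth_fun_cong[OF V])
    fix q
    assume q: "q \<in> ?V"
    then have l: "linear (tcomp A C' q)"
      using linear_tcomp[OF C'] by blast
    show "(\<Sum>b\<in>Basis. (tcomp A C q (X q) \<bullet> b) *\<^sub>R tcomp A C' q (coord_field A C b q)) = tcomp A C' q (X q)"
      using arg_cong[OF vf_expand[OF C, of q "X q"], of "tcomp A C' q"] q U(3)
      by (auto simp: linear_sum[OF l] linear_scale[OF l])
  qed
  then show "\<exists>V. open V \<and> p \<in> V \<and> smooth_fun A V (\<lambda>q. tcomp A C' q (X q))"
    using V U(2) p by blast
qed

lemma smooth_vf_local: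
  assumes "open S" "\<And>p. p \<in> S \<Longrightarrow> \<exists>U. open U \<and> p \<in> U \<and> smooth_vf A U X"
  shows "smooth_vf A S X"
proof (rule smooth_vfI_local[OF assms(1)])
  fix p
  assume "p \<in> S"
  then obtain U where U: "open U" "p \<in> U" "smooth_vf A U X"
    using assms(2) by blast
  then have "smooth_fun A (fst (chart_at A p) \<inter> U) (\<lambda>q. tcomp A (chart_at A p) q (X q))"
    using smooth_vf_iff chart_at(1) by blast
  then show "\<exists>C\<in>A. \<exists>U. open U \<and> p \<in> U \<and> U \<subseteq> fst C \<and> smooth_fun A U (\<lambda>q. tcomp A C q (X q))"
    using U(1,2) chart_at open_domain by (metis Int_iff inf_le1 open_Int)
qed

lemma smooth_vf_scaleR:
  assumes S: "open S" and "smooth_fun A S u" "smooth_vf A S X"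
  shows "smooth_vf A S (\<lambda>p. u p *\<^sub>R X p)"
  unfolding smooth_vf_iff[OF S]
proof
  fix C
  assume C: "C \<in> A"
  have o: "open (fst C \<inter> S)"
    using S open_domain[OF C] by blast
  have "smooth_fun A (fst C \<inter> S) (\<lambda>p. u p *\<^sub>R tcomp A C p (X p))"
    using assms(3)[unfolded smooth_vf_iff[OF S]] C smooth_fun_subset[OF assms(2)]
    by (intro smooth_fun_scaleR o) blast+
  then show "smooth_fun A (fst C \<inter> S) (\<lambda>p. tcomp A C p (u p *\<^sub>R X p))"
    by (rule smooth_fun_cong[OF o]) (simp add: linear_scale[OF linear_tcomp[OF C]])
qed

lemma smooth_vf_add:
  assumes S: "open S" and "smooth_vf A S X" "smooth_vf A S Y"
  shows "smooth_vf A S (\<lambda>p. X p + Y p)"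
  unfolding smooth_vf_iff[OF S]
proof
  fix C
  assume C: "C \<in> A"
  have o: "open (fst C \<inter> S)"
    using S open_domain[OF C] by blast
  have "smooth_fun A (fst C \<inter> S) (\<lambda>p. tcomp A C p (X p) + tcomp A C p (Y p))"
    using assms(2,3)[unfolded smooth_vf_iff[OF S]] C by (intro smooth_fun_add o) blast+
  then show "smooth_fun A (fst C \<inter> S) (\<lambda>p. tcomp A C p (X p + Y p))"
    by (rule smooth_fun_cong[OF o]) (simp add: linear_add[OF linear_tcomp[OF C]])
qed

lemma smooth_vf_zero: "open S \<Longrightarrow> smooth_vf A S (\<lambda>p. 0)"
proof -
  assume S: "open S"
  have "smooth_fun A (fst C \<inter> S) (\<lambda>p. tcomp A C p 0)" if C: "C \<in> A" for C
    by (rule smooth_fun_cong[OF _ smooth_fun_const[of _ 0]])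
      (use S open_domain[OF C] linear_0[OF linear_tcomp[OF C]] in auto)
  then show ?thesis
    unfolding smooth_vf_iff[OF S] by blast
qed

lemma smooth_vf_sum:
  "open S \<Longrightarrow> (\<And>i. i \<in> I \<Longrightarrow> smooth_vf A S (X i)) \<Longrightarrow> smooth_vf A S (\<lambda>p. \<Sum>i\<in>I. X i p)"
  by (induction I rule: infinite_finite_induct) (auto simp: smooth_vf_zero intro: smooth_vf_add)

text \<open>Conjugating \<open>Q\<close> with the coordinate frame of one chart gives a system for
  the components of \<open>W\<close>, whose coefficients are smooth because \<open>Q\<close>
  preserves smooth local fields.\<close>

lemma smooth_vf_linear_system:
  assumes S: "open S" and lin: "\<And>p. p \<in> S \<Longrightarrow> linear (Q p)" and inj: "\<And>p. p \<in> S \<Longrightarrow> inj (Q p)"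
    and Q: "\<And>U Z. open U \<Longrightarrow> U \<subseteq> S \<Longrightarrow> smooth_vf A U Z \<Longrightarrow> smooth_vf A U (\<lambda>p. Q p (Z p))"
    and Y: "smooth_vf A S Y" and eq: "\<And>p. p \<in> S \<Longrightarrow> Q p (W p) = Y p"
  shows "smooth_vf A S W"
proof (rule smooth_vfI_local[OF S])
  fix p
  assume p: "p \<in> S"
  let ?C = "chart_at A p"
  let ?U = "fst ?C \<inter> S"
  let ?E = "coord_field A ?C"
  note C = chart_at[of p]
  have U: "open ?U" "p \<in> ?U"
    using open_Int[OF open_domain[OF C(1)] S] C p by auto
  have comp: "smooth_fun A ?U (\<lambda>q. tcomp A ?C q (Z q))" if "smooth_vf A ?U Z" for Z
    using that C(1) unfolding smooth_vf_iff[OF U(1)] by (metis Int_left_absorb)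
  have "smooth_fun A ?U (\<lambda>q. tcomp A ?C q (W q))"
  proof (rule smooth_fun_linear_system[OF U(1), where G = "\<lambda>q x. tcomp A ?C q (Q q (?E x q))" and w = "\<lambda>q. tcomp A ?C q (Y q)"])
    fix q
    assume "q \<in> ?U"
    then have q: "q \<in> fst ?C" "q \<in> S"
      by auto
    have "linear (tcomp A ?C q \<circ> (Q q \<circ> (\<lambda>x. ?E x q)))"
      by (intro linear_compose linear_tcomp linear_coord_field lin q C)
    then show "linear (\<lambda>x. tcomp A ?C q (Q q (?E x q)))"
      by (simp add: o_def)
    have "inj (tcomp A ?C q)"
      by (rule inj_on_inverseI[of _ "\<lambda>b. ?E b q"]) (rule coord_field_tcomp[OF C(1) q(1)])
    moreover have "inj (\<lambda>x. ?E x q)"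
      by (rule inj_on_inverseI[of _ "tcomp A ?C q"]) (rule tcomp_coord_field[OF C(1) q(1)])
    ultimately have "inj (tcomp A ?C q \<circ> (Q q \<circ> (\<lambda>x. ?E x q)))"
      by (intro inj_compose inj[OF q(2)])
    then show "inj (\<lambda>x. tcomp A ?C q (Q q (?E x q)))"
      by (simp only: o_def)
    show "tcomp A ?C q (Q q (?E (tcomp A ?C q (W q)) q)) = tcomp A ?C q (Y q)"
      by (simp add: coord_field_tcomp[OF C(1) q(1)] eq[OF q(2)])
  next
    show "smooth_fun A ?U (\<lambda>q. tcomp A ?C q (Q q (?E b q)))" for b
      by (intro comp Q U smooth_vf_subset[OF smooth_vf_coord_field[OF C(1)]]) auto
    show "smooth_fun A ?U (\<lambda>q. tcomp A ?C q (Y q))"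
      by (intro comp smooth_vf_subset[OF Y]) auto
  qed
  then show "\<exists>C\<in>A. \<exists>U. open U \<and> p \<in> U \<and> U \<subseteq> fst C \<and> smooth_fun A U (\<lambda>q. tcomp A C q (W q))"
    using U C(1) by (meson inf_le1)
qed

end

section \<open>Lie brackets, connections and smooth maps\<close>

context smooth_manifold
begin

lemma lie_bracket_dir_deriv:
  fixes u :: "'m \<Rightarrow> 'b::euclidean_space"
  assumes S: "open S" "p \<in> S" and u: "smooth_fun A S u"
    and X: "smooth_vf A S X" and Y: "smooth_vf A S Y"
  shows "dir_deriv A p (X p) (\<lambda>q. dir_deriv A q (Y q) u) - dir_deriv A p (Y p) (\<lambda>q. dir_deriv A q (X q) u)
    = dir_deriv A p (lie_bracket A X Y p) u"
proof -
  let ?C = "chart_at A p"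
  let ?F = "u \<circ> chart_inv ?C"
  let ?T = "snd ?C ` (fst ?C \<inter> S)"
  let ?U = "fst ?C \<inter> S"
  let ?D = "\<lambda>b q. frechet_derivative ?F (at (snd ?C q)) b"
  let ?c = "\<lambda>Z q. tcomp A ?C q (Z q)"
  have U: "open ?U" "p \<in> ?U"
    using S open_domain chart_at by blast+
  have T: "open ?T" "snd ?C p \<in> ?T"
    using open_chart_image[OF chart_at(1) S(1)] U by auto
  have F: "smooth_on ?T ?F"
    by (rule smooth_funD[OF u chart_at(1)])
  have D_chart: "(?D b \<circ> chart_inv ?C) x = frechet_derivative ?F (at x) b" if "x \<in> ?T" for b x
    using chart_chart_inv[OF chart_at(1) that] by simp
  have D: "smooth_fun A ?U (?D b)" for b
  proof (rule smooth_fun_chartI[OF chart_at(1) U(1)])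
    show "smooth_on ?T (?D b \<circ> chart_inv ?C)"
      by (rule smooth_on_cong[OF T(1) smooth_on_frechet_derivative[OF F, of b]]) (simp only: D_chart)
  qed auto
  have DD: "dir_deriv A p v (?D b) = frechet_derivative (\<lambda>x. frechet_derivative ?F (at x) b) (at (snd ?C p)) v" for v b
    unfolding dir_deriv_def by (rule arg_cong[where f = "\<lambda>h. h v"], rule frechet_derivative_cong_open[OF T]) (rule D_chart)
  have sym: "frechet_derivative (\<lambda>x. frechet_derivative ?F (at x) b) (at (snd ?C p)) v =
      frechet_derivative (\<lambda>x. frechet_derivative ?F (at x) v) (at (snd ?C p)) b" for b v
    using F unfolding smooth_on_def by (intro frechet_derivative_commute[OF T]) blast
  have lin2: "linear (frechet_derivative (\<lambda>x. frechet_derivative ?F (at x) b) (at (snd ?C p)))" for b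
    by (intro linear_frechet_derivative smooth_on_differentiable[OF smooth_on_frechet_derivative[OF F] T(2)])
  have lin1: "linear (frechet_derivative ?F (at (snd ?C q)))" if "q \<in> ?U" for q
    using that by (intro linear_frechet_derivative smooth_on_differentiable[OF F]) blast
  have c: "smooth_fun A ?U (?c Z)" if "smooth_vf A S Z" for Z
    using that chart_at(1) unfolding smooth_vf_iff[OF S(1)] by blast
  \<comment> \<open>A first-order part through the derivative of the components of \<open>Z\<close>,
    plus the second derivative of \<open>?F\<close> in the directions \<open>v\<close> and
    \<open>Z p\<close>. The latter is symmetric and cancels in the commutator; the former assembles
    the bracket.\<close>
  have *: "dir_deriv A p v (\<lambda>q. dir_deriv A q (Z q) u) =
      dir_deriv A p (dir_deriv A p v (?c Z)) u + frechet_derivative (\<lambda>x. frechet_derivative ?F (at x) v) (at (snd ?C p)) (Z p)"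
    if Z: "smooth_vf A S Z" for v Z
  proof -
    have "dir_deriv A p v (\<lambda>q. dir_deriv A q (Z q) u) = dir_deriv A p v (\<lambda>q. \<Sum>b\<in>Basis. (?c Z q \<bullet> b) *\<^sub>R ?D b q)"
    proof (rule dir_deriv_cong[OF U])
      fix q
      assume q: "q \<in> ?U"
      show "dir_deriv A q (Z q) u = (\<Sum>b\<in>Basis. (?c Z q \<bullet> b) *\<^sub>R ?D b q)"
        using dir_deriv_chart[OF u _ S(1) chart_at(1), of q p] linear_eq_sum_Basis[OF lin1[OF q], of "?c Z q"] q by simp
    qed
    also have "\<dots> = (\<Sum>b\<in>Basis. dir_deriv A p v (\<lambda>q. (?c Z q \<bullet> b) *\<^sub>R ?D b q))"
      by (intro dir_deriv_sum[of _ ?U] smooth_fun_scaleR smooth_fun_inner_left c Z D U)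
    also have "\<dots> = (\<Sum>b\<in>Basis. (Z p \<bullet> b) *\<^sub>R dir_deriv A p v (?D b) + (dir_deriv A p v (?c Z) \<bullet> b) *\<^sub>R ?D b p)"
      using dir_deriv_scaleR[OF smooth_fun_inner_left[OF U(1) c[OF Z]] D U(2)]
        dir_deriv_linear[OF bounded_linear_inner_left c[OF Z] U(2)]
      by (simp add: tcomp_chart_at)
    also have "\<dots> = (\<Sum>b\<in>Basis. (Z p \<bullet> b) *\<^sub>R dir_deriv A p v (?D b)) + (\<Sum>b\<in>Basis. (dir_deriv A p v (?c Z) \<bullet> b) *\<^sub>R ?D b p)"
      by (rule sum.distrib)
    also have "(\<Sum>b\<in>Basis. (Z p \<bullet> b) *\<^sub>R dir_deriv A p v (?D b)) =
        frechet_derivative (\<lambda>x. frechet_derivative ?F (at x) v) (at (snd ?C p)) (Z p)"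
      unfolding DD sym[of _ v] by (rule linear_eq_sum_Basis[OF lin2, symmetric])
    also have "(\<Sum>b\<in>Basis. (dir_deriv A p v (?c Z) \<bullet> b) *\<^sub>R ?D b p) = ?D (dir_deriv A p v (?c Z)) p"
      by (rule linear_eq_sum_Basis[OF lin1[OF U(2)], symmetric])
    also have "?D (dir_deriv A p v (?c Z)) p = dir_deriv A p (dir_deriv A p v (?c Z)) u"
      by (simp add: dir_deriv_def)
    finally show ?thesis
      by (simp only: add.commute)
  qed
  show ?thesis
    unfolding *[OF X] *[OF Y] lie_bracket_def linear_diff[OF linear_dir_deriv[OF u S(2)]]
    using sym[of "X p" "Y p"] by simp
qed

lemma lie_bracket_coord_field: "lie_bracket A (coord_field A (chart_at A p) b) (coord_field A (chart_at A p) c) p = 0"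
proof -
  have "dir_deriv A p v (\<lambda>q. tcomp A (chart_at A p) q (coord_field A (chart_at A p) b q)) = dir_deriv A p v (\<lambda>q. b)" for v b
    by (rule dir_deriv_cong[OF open_domain[OF chart_at(1)] chart_at(2)]) (simp add: tcomp_coord_field chart_at)
  then show ?thesis
    by (simp add: lie_bracket_def dir_deriv_const)
qed

end

locale smooth_connection = smooth_manifold A
  for A :: "('m::{t2_space,second_countable_topology}, 'e::euclidean_space) chart set" +
  fixes nab :: "('m, 'e) connection"
  assumes connection: "affine_connection A nab"
begin

lemmas connection_axioms = connection[unfolded affine_connection_def, THEN spec, THEN mp]

lemmas nab_smooth = connection_axioms[THEN conjunct1, rule_format]
lemmas linear_nab = connection_axioms[THEN conjunct2, THEN conjunct1, rule_format]
lemmas nab_add = connection_axioms[THEN conjunct2, THEN conjunct2, THEN conjunct1, rule_format]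
lemmas nab_scaleR =
  connection_axioms[THEN conjunct2, THEN conjunct2, THEN conjunct2, THEN conjunct1, rule_format]
lemmas nab_cong =
  connection_axioms[THEN conjunct2, THEN conjunct2, THEN conjunct2, THEN conjunct2, rule_format]

lemma nab_const_scaleR:
  "open S \<Longrightarrow> smooth_vf A S Y \<Longrightarrow> p \<in> S \<Longrightarrow> nab p v (\<lambda>q. c *\<^sub>R Y q) = c *\<^sub>R nab p v Y"
  using nab_scaleR[OF _ smooth_fun_const[of S c]] by (simp add: dir_deriv_const)

lemma nab_zero: "nab p v (\<lambda>q. 0) = 0"
  using nab_const_scaleR[of UNIV "\<lambda>q. 0" p v 0] smooth_vf_zero by simp

lemma nab_sum:
  assumes "open S" "\<And>i. i \<in> I \<Longrightarrow> smooth_vf A S (Y i)" "p \<in> S"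
  shows "nab p v (\<lambda>q. \<Sum>i\<in>I. Y i q) = (\<Sum>i\<in>I. nab p v (Y i))"
  using assms(2)
  by (induction I rule: infinite_finite_induct)
    (simp_all add: nab_zero nab_add[OF assms(1)] smooth_vf_sum[OF assms(1)] assms(3))

text \<open>Locality of \<open>nab\<close> permits replacing \<open>Y\<close> by its expansion in
  coordinate fields near \<open>p\<close>, where the Leibniz rule applies. The result has the shape
  of \<open>cov_along\<close>, which makes the two derivatives comparable.\<close>

lemma nab_expand:
  assumes S: "open S" "p \<in> S" and Y: "smooth_vf A S Y" and C: "C \<in> A" "p \<in> fst C"
  shows "nab p v Y = (\<Sum>b\<in>Basis. dir_deriv A p v (\<lambda>q. tcomp A C q (Y q) \<bullet> b) *\<^sub>R coord_field A C b p +
    (tcomp A C p (Y p) \<bullet> b) *\<^sub>R nab p v (coord_field A C b))"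
proof -
  let ?U = "fst C \<inter> S"
  let ?u = "\<lambda>b q. tcomp A C q (Y q) \<bullet> b"
  have U: "open ?U" "p \<in> ?U"
    using open_Int[OF open_domain[OF C(1)] S(1)] S C by auto
  have u: "smooth_fun A ?U (?u b)" for b
    using Y C(1) unfolding smooth_vf_iff[OF S(1)] by (intro smooth_fun_inner_left U) blast
  have E: "smooth_vf A ?U (coord_field A C b)" for b
    by (rule smooth_vf_subset[OF smooth_vf_coord_field[OF C(1)]]) auto
  have uE: "smooth_vf A ?U (\<lambda>q. ?u b q *\<^sub>R coord_field A C b q)" for b
    by (intro smooth_vf_scaleR U u E)
  have "nab p v Y = nab p v (\<lambda>q. \<Sum>b\<in>Basis. ?u b q *\<^sub>R coord_field A C b q)"
  proof (rule nab_cong[OF U(1) smooth_vf_subset[OF Y] smooth_vf_sum[OF U(1) uE] _ U(2)])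
    show "Y q = (\<Sum>b\<in>Basis. ?u b q *\<^sub>R coord_field A C b q)" if "q \<in> ?U" for q
      using vf_expand[OF C(1)] that by blast
  qed auto
  also have "\<dots> = (\<Sum>b\<in>Basis. nab p v (\<lambda>q. ?u b q *\<^sub>R coord_field A C b q))"
    by (rule nab_sum[OF U(1) uE U(2)])
  also have "\<dots> = (\<Sum>b\<in>Basis. dir_deriv A p v (?u b) *\<^sub>R coord_field A C b p + ?u b p *\<^sub>R nab p v (coord_field A C b))"
    by (intro sum.cong refl nab_scaleR[OF U(1) u E U(2)])
  finally show ?thesis .
qed

lemma nab_coord_field_expand:
  assumes C: "C \<in> A" "p \<in> fst C"
  shows "nab p v (coord_field A C w) = (\<Sum>b\<in>Basis. (w \<bullet> b) *\<^sub>R nab p v (coord_field A C b))"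
proof -
  have "dir_deriv A p v (\<lambda>q. tcomp A C q (coord_field A C w q) \<bullet> b) = dir_deriv A p v (\<lambda>q. w \<bullet> b)" for b
    by (rule dir_deriv_cong[OF open_domain[OF C(1)] C(2)]) (simp add: tcomp_coord_field[OF C(1)])
  then show ?thesis
    using nab_expand[OF open_domain[OF C(1)] C(2) smooth_vf_coord_field[OF C(1)] C, of v w]
    by (simp add: dir_deriv_const tcomp_coord_field[OF C])
qed

text \<open>Symmetry of the Christoffel symbols: coordinate fields have vanishing bracket, and at
  \<open>p\<close> itself the field with components \<open>v\<close> in the preferred chart has the
  value \<open>v\<close>.\<close>

lemma nab_coord_field_commute:
  assumes "torsion_free A nab"
  shows "nab p v (coord_field A (chart_at A p) w) = nab p w (coord_field A (chart_at A p) v)"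
proof -
  let ?E = "coord_field A (chart_at A p)"
  have "nab p (?E v p) (?E w) - nab p (?E w p) (?E v) = lie_bracket A (?E v) (?E w) p"
    using assms open_domain[OF chart_at(1)] smooth_vf_coord_field[OF chart_at(1)] chart_at(2)
    unfolding torsion_free_def by blast
  then show ?thesis
    by (simp add: lie_bracket_coord_field coord_field_chart_at)
qed

end

locale smooth_mapping = A: smooth_manifold A + B: smooth_manifold B
  for A :: "('m::{t2_space,second_countable_topology}, 'e::euclidean_space) chart set"
    and B :: "('n::{t2_space,second_countable_topology}, 'f::euclidean_space) chart set" +
  fixes f :: "'m \<Rightarrow> 'n"
  assumes smooth_map: "smooth_map A B f"
begin

abbreviation "df \<equiv> tmap A B f"

lemma open_vimage: "open S \<Longrightarrow> open (f -` S)"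
  using smooth_map unfolding smooth_map_def by (simp add: open_vimage)

lemma smooth_fun_chart_map: "C \<in> B \<Longrightarrow> smooth_fun A (f -` fst C) (snd C \<circ> f)"
  using smooth_map unfolding smooth_map_def smooth_fun_def by blast

lemma smooth_fun_pullback:
  assumes S: "open S" and u: "smooth_fun B S u"
  shows "smooth_fun A (f -` S) (\<lambda>p. u (f p))"
proof (rule A.smooth_fun_local)
  fix p
  assume p: "p \<in> f -` S"
  let ?C = "chart_at A p" and ?C' = "chart_at B (f p)"
  let ?U = "fst ?C \<inter> f -` (fst ?C' \<inter> S)"
  have o: "open (f -` (fst ?C' \<inter> S))"
    using open_vimage S B.open_domain B.chart_at by blast
  then have U: "open ?U" "p \<in> ?U"
    using A.open_domain A.chart_at B.chart_at p by blast+
  have T: "open (snd ?C ` ?U)"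
    by (rule A.open_chart_image[OF A.chart_at(1) o])
  have F: "smooth_on (snd ?C ` ?U) ((snd ?C' \<circ> f) \<circ> chart_inv ?C)"
    using A.smooth_funD[OF smooth_fun_chart_map[OF B.chart_at(1)] A.chart_at(1)]
    by (rule smooth_on_subset) auto
  have "smooth_on (snd ?C ` ?U) ((\<lambda>p. u (f p)) \<circ> chart_inv ?C)"
  proof (rule smooth_on_cong[OF T smooth_on_compose[OF T _ B.smooth_funD[OF u B.chart_at(1)] F]])
    fix x
    assume "x \<in> snd ?C ` ?U"
    then have x: "f (chart_inv ?C x) \<in> fst ?C' \<inter> S"
      using A.chart_chart_inv[OF A.chart_at(1)] by blast
    then show "((snd ?C' \<circ> f) \<circ> chart_inv ?C) x \<in> snd ?C' ` (fst ?C' \<inter> S)"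
      by auto
    show "(u \<circ> chart_inv ?C') (((snd ?C' \<circ> f) \<circ> chart_inv ?C) x) = ((\<lambda>p. u (f p)) \<circ> chart_inv ?C) x"
      using x by (simp add: B.chart_inv_chart[OF B.chart_at(1)])
  qed
  then have "smooth_fun A ?U (\<lambda>p. u (f p))"
    by (intro A.smooth_fun_chartI[OF A.chart_at(1) U(1)]) auto
  then show "\<exists>U. open U \<and> p \<in> U \<and> smooth_fun A U (\<lambda>p. u (f p))"
    using U by blast
qed

lemma linear_df: "linear (df p)"
proof -
  have "df p = (\<lambda>v. dir_deriv A p v (snd (chart_at B (f p)) \<circ> f))"
    by (simp add: fun_eq_iff tmap_def)
  then show ?thesis
    using A.linear_dir_deriv[OF smooth_fun_chart_map[OF B.chart_at(1)]] B.chart_at(2) by simp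
qed

lemma dir_deriv_pullback:
  assumes S: "open S" "f p \<in> S" and u: "smooth_fun B S u"
  shows "dir_deriv A p v (\<lambda>q. u (f q)) = dir_deriv B (f p) (df p v) u"
proof -
  let ?C = "chart_at A p" and ?C' = "chart_at B (f p)"
  let ?T = "snd ?C ` (fst ?C \<inter> f -` fst ?C')"
  have 1: "(((snd ?C' \<circ> f) \<circ> chart_inv ?C) has_derivative df p) (at (snd ?C p))"
    using A.dir_deriv_has_derivative[OF smooth_fun_chart_map[OF B.chart_at(1)]] B.chart_at(2)
    by (simp add: tmap_def[abs_def])
  have 2: "((snd ?C' \<circ> f) \<circ> chart_inv ?C) (snd ?C p) = snd ?C' (f p)"
    using A.chart_inv_chart[OF A.chart_at] by simp
  have "((u \<circ> chart_inv ?C') \<circ> ((snd ?C' \<circ> f) \<circ> chart_inv ?C) has_derivative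
      (\<lambda>w. dir_deriv B (f p) w u) \<circ> df p) (at (snd ?C p))"
    by (rule diff_chain_at[OF 1]) (simp only: 2 B.dir_deriv_has_derivative[OF u S(2)])
  then have "(((\<lambda>q. u (f q)) \<circ> chart_inv ?C) has_derivative (\<lambda>w. dir_deriv B (f p) w u) \<circ> df p) (at (snd ?C p))"
  proof (rule has_derivative_transform_within_open)
    show "open ?T"
      by (rule A.open_chart_image[OF A.chart_at(1) open_vimage[OF B.open_domain[OF B.chart_at(1)]]])
    show "snd ?C p \<in> ?T"
      using A.chart_at(2) B.chart_at(2) by blast
    fix x
    assume "x \<in> ?T"
    then have "f (chart_inv ?C x) \<in> fst ?C'"
      using A.chart_chart_inv[OF A.chart_at(1)] by blast
    then show "((u \<circ> chart_inv ?C') \<circ> ((snd ?C' \<circ> f) \<circ> chart_inv ?C)) x = ((\<lambda>q. u (f q)) \<circ> chart_inv ?C) x"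
      by (simp add: B.chart_inv_chart[OF B.chart_at(1)])
  qed
  then show ?thesis
    by (simp add: A.dir_deriv_eqI)
qed

lemma tcomp_df:
  "C \<in> B \<Longrightarrow> f p \<in> fst C \<Longrightarrow> tcomp B C (f p) (df p v) = dir_deriv A p v (snd C \<circ> f)"
  using dir_deriv_pullback[OF B.open_domain _ B.smooth_fun_chart, of C p v]
  by (simp add: B.tcomp_eq_dir_deriv o_def)

text \<open>The version of \<open>smooth_vf_along\<close> on a part \<open>S\<close> of the source.
  It is needed because pulled back coordinate fields of a chart \<open>C\<close> are available only
  over the preimage of its domain.\<close>

definition smooth_along :: "'m set \<Rightarrow> ('m \<Rightarrow> 'f) \<Rightarrow> bool" where
  "smooth_along S V \<longleftrightarrow> (\<forall>C\<in>B. smooth_fun A (S \<inter> f -` fst C) (\<lambda>p. tcomp B C (f p) (V p)))"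

lemma smooth_vf_along_iff: "smooth_vf_along A B f V \<longleftrightarrow> smooth_along UNIV V"
  unfolding smooth_vf_along_def smooth_along_def smooth_fun_def by auto

lemma open_along: "open S \<Longrightarrow> C \<in> B \<Longrightarrow> open (S \<inter> f -` fst C)"
  using open_vimage B.open_domain by blast

lemma smooth_alongD: "smooth_along S V \<Longrightarrow> C \<in> B \<Longrightarrow> smooth_fun A (S \<inter> f -` fst C) (\<lambda>p. tcomp B C (f p) (V p))"
  unfolding smooth_along_def by blast

lemma smooth_along_subset: "smooth_along S V \<Longrightarrow> T \<subseteq> S \<Longrightarrow> smooth_along T V"
  unfolding smooth_along_def by (meson A.smooth_fun_subset Int_mono order_refl)

lemma smooth_along_local:
  assumes S: "\<And>p. p \<in> S \<Longrightarrow> \<exists>U. open U \<and> p \<in> U \<and> smooth_along U V"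
  shows "smooth_along S V"
  unfolding smooth_along_def
proof (intro ballI A.smooth_fun_local)
  fix C p
  assume C: "C \<in> B" and p: "p \<in> S \<inter> f -` fst C"
  then obtain U where "open U" "p \<in> U" "smooth_along U V"
    using S by blast
  then show "\<exists>U. open U \<and> p \<in> U \<and> smooth_fun A U (\<lambda>p. tcomp B C (f p) (V p))"
    using smooth_alongD[OF _ C] open_along[OF _ C] p by blast
qed

lemma smooth_along_cong:
  assumes "open S" "smooth_along S V" "\<And>p. p \<in> S \<Longrightarrow> V p = W p"
  shows "smooth_along S W"
  unfolding smooth_along_def
proof
  fix C
  assume C: "C \<in> B"
  show "smooth_fun A (S \<inter> f -` fst C) (\<lambda>p. tcomp B C (f p) (W p))"
    by (rule A.smooth_fun_cong[OF open_along[OF assms(1) C] smooth_alongD[OF assms(2) C]]) (simp add: assms(3))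
qed

lemma smooth_along_add:
  assumes "open S" "smooth_along S V" "smooth_along S W"
  shows "smooth_along S (\<lambda>p. V p + W p)"
  unfolding smooth_along_def
proof
  fix C
  assume C: "C \<in> B"
  note o = open_along[OF assms(1) C]
  show "smooth_fun A (S \<inter> f -` fst C) (\<lambda>p. tcomp B C (f p) (V p + W p))"
    by (rule A.smooth_fun_cong[OF o A.smooth_fun_add[OF o smooth_alongD[OF assms(2) C] smooth_alongD[OF assms(3) C]]])
      (simp add: linear_add[OF B.linear_tcomp[OF C]])
qed

lemma smooth_along_scaleR:
  assumes "open S" "smooth_fun A S u" "smooth_along S V"
  shows "smooth_along S (\<lambda>p. u p *\<^sub>R V p)"
  unfolding smooth_along_def
proof
  fix C
  assume C: "C \<in> B"
  note o = open_along[OF assms(1) C]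
  have "smooth_fun A (S \<inter> f -` fst C) u"
    by (rule A.smooth_fun_subset[OF assms(2)]) auto
  then show "smooth_fun A (S \<inter> f -` fst C) (\<lambda>p. tcomp B C (f p) (u p *\<^sub>R V p))"
    by (rule A.smooth_fun_cong[OF o A.smooth_fun_scaleR[OF o _ smooth_alongD[OF assms(3) C]]])
      (simp add: linear_scale[OF B.linear_tcomp[OF C]])
qed

lemma smooth_along_zero: "open S \<Longrightarrow> smooth_along S (\<lambda>p. 0)"
proof -
  assume S: "open S"
  have "smooth_fun A (S \<inter> f -` fst C) (\<lambda>p. tcomp B C (f p) 0)" if C: "C \<in> B" for C
    by (rule A.smooth_fun_cong[OF open_along[OF S C] A.smooth_fun_const[of _ 0]])
      (simp add: linear_0[OF B.linear_tcomp[OF C]])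
  then show ?thesis
    unfolding smooth_along_def by blast
qed

lemma smooth_along_sum:
  "open S \<Longrightarrow> (\<And>i. i \<in> I \<Longrightarrow> smooth_along S (V i)) \<Longrightarrow> smooth_along S (\<lambda>p. \<Sum>i\<in>I. V i p)"
  by (induction I rule: infinite_finite_induct) (auto simp: smooth_along_zero intro: smooth_along_add)

lemma smooth_along_pullback:
  assumes S: "open S" and W: "smooth_vf B S W"
  shows "smooth_along (f -` S) (\<lambda>p. W (f p))"
  unfolding smooth_along_def
proof
  fix C
  assume C: "C \<in> B"
  have "smooth_fun B (fst C \<inter> S) (\<lambda>p. tcomp B C p (W p))"
    using W C unfolding B.smooth_vf_iff[OF S] by blast
  then have "smooth_fun A (f -` (fst C \<inter> S)) (\<lambda>p. tcomp B C (f p) (W (f p)))"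
    using S B.open_domain[OF C] by (intro smooth_fun_pullback) auto
  then show "smooth_fun A (f -` S \<inter> f -` fst C) (\<lambda>p. tcomp B C (f p) (W (f p)))"
    by (rule A.smooth_fun_subset) auto
qed

lemma smooth_along_df:
  assumes S: "open S" and X: "smooth_vf A S X"
  shows "smooth_along S (\<lambda>p. df p (X p))"
  unfolding smooth_along_def
proof
  fix C
  assume C: "C \<in> B"
  let ?U = "S \<inter> f -` fst C"
  have "smooth_fun A ?U (\<lambda>p. dir_deriv A p (X p) (snd C \<circ> f))"
    by (rule A.smooth_fun_dir_deriv[OF open_along[OF S C] A.smooth_fun_subset[OF smooth_fun_chart_map[OF C]]
      A.smooth_vf_subset[OF X]]) auto
  then show "smooth_fun A ?U (\<lambda>p. tcomp B C (f p) (df p (X p)))"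
    by (rule A.smooth_fun_cong[OF open_along[OF S C]]) (simp add: tcomp_df[OF C])
qed

end

section \<open>Covariant derivatives along a map\<close>

locale smooth_mapping_connection = smooth_mapping A B f + B: smooth_connection B nabb
  for A :: "('m::{t2_space,second_countable_topology}, 'e::euclidean_space) chart set"
    and B :: "('n::{t2_space,second_countable_topology}, 'f::euclidean_space) chart set"
    and f :: "'m \<Rightarrow> 'n" and nabb :: "('n, 'f) connection"
begin

abbreviation "cov \<equiv> cov_along A B f nabb"

abbreviation comp_along :: "('n, 'f) chart \<Rightarrow> ('m \<Rightarrow> 'f) \<Rightarrow> 'f \<Rightarrow> 'm \<Rightarrow> real" where
  "comp_along C V b \<equiv> \<lambda>q. tcomp B C (f q) (V q) \<bullet> b"

lemma cov_eq:
  "cov p v V = (\<Sum>b\<in>Basis. dir_deriv A p v (comp_along (chart_at B (f p)) V b) *\<^sub>R coord_field B (chart_at B (f p)) b (f p) +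
    comp_along (chart_at B (f p)) V b p *\<^sub>R nabb (f p) (df p v) (coord_field B (chart_at B (f p)) b))"
  by (simp add: cov_along_def Let_def)

lemma along_nbhd:
  assumes "open S" "p \<in> S" "C \<in> B" "f p \<in> fst C"
  shows "open (S \<inter> f -` fst C)" "p \<in> S \<inter> f -` fst C"
  using open_along[OF assms(1,3)] assms by auto

lemma smooth_fun_comp_along:
  "open S \<Longrightarrow> C \<in> B \<Longrightarrow> smooth_along S V \<Longrightarrow> smooth_fun A (S \<inter> f -` fst C) (comp_along C V b)"
  by (rule A.smooth_fun_inner_left[OF open_along smooth_alongD])

lemma along_expand:
  "C \<in> B \<Longrightarrow> f p \<in> fst C \<Longrightarrow> V p = (\<Sum>b\<in>Basis. comp_along C V b p *\<^sub>R coord_field B C b (f p))"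
  by (rule B.vf_expand)

lemma smooth_along_coord_field: "C \<in> B \<Longrightarrow> smooth_along (f -` fst C) (\<lambda>q. coord_field B C b (f q))"
  by (rule smooth_along_pullback[OF B.open_domain B.smooth_vf_coord_field])

lemma cov_cong:
  assumes S: "open S" "p \<in> S" and eq: "\<And>q. q \<in> S \<Longrightarrow> V q = W q"
  shows "cov p v V = cov p v W"
proof -
  have "dir_deriv A p v (comp_along C V b) = dir_deriv A p v (comp_along C W b)" for C b
    by (rule A.dir_deriv_cong[OF S]) (simp add: eq)
  then show ?thesis
    by (simp add: cov_eq eq S(2))
qed

lemma cov_add:
  assumes S: "open S" "p \<in> S" and V: "smooth_along S V" and W: "smooth_along S W"
  shows "cov p v (\<lambda>q. V q + W q) = cov p v V + cov p v W"
proof -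
  let ?C = "chart_at B (f p)"
  let ?U = "S \<inter> f -` fst ?C"
  note U = along_nbhd[OF S B.chart_at]
  have comp: "comp_along ?C (\<lambda>q. V q + W q) b q = comp_along ?C V b q + comp_along ?C W b q" if "q \<in> ?U" for b q
    using that linear_add[OF B.linear_tcomp[OF B.chart_at(1)], of "f q"] by (simp add: inner_add_left)
  have "dir_deriv A p v (comp_along ?C (\<lambda>q. V q + W q) b) =
      dir_deriv A p v (\<lambda>q. comp_along ?C V b q + comp_along ?C W b q)" for b
    by (rule A.dir_deriv_cong[OF U]) (rule comp)
  then have "dir_deriv A p v (comp_along ?C (\<lambda>q. V q + W q) b) =
      dir_deriv A p v (comp_along ?C V b) + dir_deriv A p v (comp_along ?C W b)" for b
    using A.dir_deriv_add[OF smooth_fun_comp_along[OF S(1) B.chart_at(1) V]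
      smooth_fun_comp_along[OF S(1) B.chart_at(1) W] U(2)] by simp
  then show ?thesis
    unfolding cov_eq comp[OF U(2)] by (simp add: scaleR_add_left sum.distrib algebra_simps)
qed

lemma cov_scaleR:
  assumes S: "open S" "p \<in> S" and u: "smooth_fun A S u" and V: "smooth_along S V"
  shows "cov p v (\<lambda>q. u q *\<^sub>R V q) = dir_deriv A p v u *\<^sub>R V p + u p *\<^sub>R cov p v V"
proof -
  let ?C = "chart_at B (f p)"
  let ?U = "S \<inter> f -` fst ?C"
  note U = along_nbhd[OF S B.chart_at]
  have comp: "comp_along ?C (\<lambda>q. u q *\<^sub>R V q) b q = u q * comp_along ?C V b q" if "q \<in> ?U" for b q
    using that linear_scale[OF B.linear_tcomp[OF B.chart_at(1)], of "f q"] by simp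
  have "dir_deriv A p v (comp_along ?C (\<lambda>q. u q *\<^sub>R V q) b) =
      dir_deriv A p v (\<lambda>q. u q * comp_along ?C V b q)" for b
    by (rule A.dir_deriv_cong[OF U]) (rule comp)
  then have d: "dir_deriv A p v (comp_along ?C (\<lambda>q. u q *\<^sub>R V q) b) =
      u p * dir_deriv A p v (comp_along ?C V b) + dir_deriv A p v u * comp_along ?C V b p" for b
    using A.dir_deriv_mult[OF A.smooth_fun_subset[OF u Int_lower1] smooth_fun_comp_along[OF S(1) B.chart_at(1) V] U(2)]
    by simp
  have "dir_deriv A p v u *\<^sub>R V p = (\<Sum>b\<in>Basis. (dir_deriv A p v u * comp_along ?C V b p) *\<^sub>R coord_field B ?C b (f p))"
    by (subst along_expand[OF B.chart_at, of V]) (simp add: scaleR_sum_right)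
  then show ?thesis
    unfolding cov_eq comp[OF U(2)] d
    by (simp add: scaleR_add_left scaleR_add_right sum.distrib scaleR_sum_right)
qed

lemma cov_zero: "cov p v (\<lambda>q. 0) = 0"
proof -
  have "cov p v (\<lambda>q. 0 *\<^sub>R (0::'f)) = dir_deriv A p v (\<lambda>q. 0) *\<^sub>R 0 + 0 *\<^sub>R cov p v (\<lambda>q. 0)"
    by (rule cov_scaleR[of UNIV]) (auto simp: A.smooth_fun_const smooth_along_zero)
  then show ?thesis
    by simp
qed

lemma cov_sum:
  assumes S: "open S" "p \<in> S" and V: "\<And>i. i \<in> I \<Longrightarrow> smooth_along S (V i)"
  shows "cov p v (\<lambda>q. \<Sum>i\<in>I. V i q) = (\<Sum>i\<in>I. cov p v (V i))"
  using V
  by (induction I rule: infinite_finite_induct)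
    (simp_all add: cov_zero cov_add[OF S] smooth_along_sum[OF S(1)])

text \<open>By the chain rule \<open>dir_deriv_pullback\<close> the coordinate formula of
  \<open>cov_along\<close> turns into \<open>nab_expand\<close> for the ambient connection.\<close>

lemma cov_pullback:
  assumes S: "open S" "f p \<in> S" and W: "smooth_vf B S W"
  shows "cov p v (\<lambda>q. W (f q)) = nabb (f p) (df p v) W"
proof -
  let ?C = "chart_at B (f p)"
  let ?U = "fst ?C \<inter> S"
  have U: "open ?U" "f p \<in> ?U"
    using open_Int[OF B.open_domain[OF B.chart_at(1)] S(1)] S(2) B.chart_at(2) by auto
  have "smooth_fun B ?U (\<lambda>q. tcomp B ?C q (W q) \<bullet> b)" for b
    using W[unfolded B.smooth_vf_iff[OF S(1)]] B.chart_at(1) by (intro B.smooth_fun_inner_left U) blast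
  then have "dir_deriv A p v (comp_along ?C (\<lambda>q. W (f q)) b) =
      dir_deriv B (f p) (df p v) (\<lambda>q. tcomp B ?C q (W q) \<bullet> b)" for b
    using dir_deriv_pullback[OF U, of "\<lambda>q. tcomp B ?C q (W q) \<bullet> b"] by simp
  then show ?thesis
    unfolding cov_eq B.nab_expand[OF S W B.chart_at] by simp
qed

lemma cov_scaleR_pullback:
  assumes S: "open S" "p \<in> S" and u: "smooth_fun A S u"
    and S': "open S'" "f p \<in> S'" and W: "smooth_vf B S' W"
  shows "cov p v (\<lambda>q. u q *\<^sub>R W (f q)) = dir_deriv A p v u *\<^sub>R W (f p) + u p *\<^sub>R nabb (f p) (df p v) W"
proof -
  have "open (S \<inter> f -` S')" "p \<in> S \<inter> f -` S'"
    using S S' open_vimage[OF S'(1)] by auto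
  from cov_scaleR[OF this A.smooth_fun_subset[OF u Int_lower1] smooth_along_subset[OF smooth_along_pullback[OF S'(1) W] Int_lower2]]
  show ?thesis
    by (simp add: cov_pullback[OF S' W])
qed

text \<open>\<open>cov_along\<close> refers to the preferred chart at \<open>f p\<close>. Smoothness
  in \<open>p\<close> requires the same formula in a chart that stays fixed; it follows from the
  Leibniz rule for components times pulled back coordinate fields.\<close>

lemma cov_expand:
  assumes S: "open S" "p \<in> S" and V: "smooth_along S V" and C: "C \<in> B" "f p \<in> fst C"
  shows "cov p v V = (\<Sum>b\<in>Basis. dir_deriv A p v (comp_along C V b) *\<^sub>R coord_field B C b (f p) +
    comp_along C V b p *\<^sub>R nabb (f p) (df p v) (coord_field B C b))"
proof -
  let ?U = "S \<inter> f -` fst C"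
  note U = along_nbhd[OF S C]
  have E: "smooth_along ?U (\<lambda>q. coord_field B C b (f q))" for b
    by (rule smooth_along_subset[OF smooth_along_coord_field[OF C(1)] Int_lower2])
  have "cov p v V = cov p v (\<lambda>q. \<Sum>b\<in>Basis. comp_along C V b q *\<^sub>R coord_field B C b (f q))"
    by (rule cov_cong[OF U]) (use along_expand[OF C(1)] in blast)
  also have "\<dots> = (\<Sum>b\<in>Basis. cov p v (\<lambda>q. comp_along C V b q *\<^sub>R coord_field B C b (f q)))"
    by (intro cov_sum[OF U] smooth_along_scaleR U smooth_fun_comp_along S C V E)
  also have "\<dots> = (\<Sum>b\<in>Basis. dir_deriv A p v (comp_along C V b) *\<^sub>R coord_field B C b (f p) +
    comp_along C V b p *\<^sub>R nabb (f p) (df p v) (coord_field B C b))"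
    by (intro sum.cong refl cov_scaleR_pullback[OF U smooth_fun_comp_along[OF S(1) C(1) V] B.open_domain[OF C(1)] C(2)]
      B.smooth_vf_coord_field C)
  finally show ?thesis .
qed

lemma smooth_along_cov:
  assumes S: "open S" and X: "smooth_vf A S X" and V: "smooth_along S V"
  shows "smooth_along S (\<lambda>p. cov p (X p) V)"
proof (rule smooth_along_local)
  fix p
  assume p: "p \<in> S"
  let ?C = "chart_at B (f p)"
  let ?U = "S \<inter> f -` fst ?C"
  let ?E = "coord_field B ?C"
  note C = B.chart_at(1)[of "f p"]
  note U = along_nbhd[OF S p B.chart_at]
  have X': "smooth_vf A ?U X"
    by (rule A.smooth_vf_subset[OF X Int_lower1])
  have u: "smooth_fun A ?U (comp_along ?C V b)" for b
    by (rule smooth_fun_comp_along[OF S C V])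
  have u': "smooth_fun A ?U (comp_along ?C (\<lambda>q. df q (X q)) b)" for b
    by (rule smooth_fun_comp_along[OF S C smooth_along_df[OF S X]])
  have E: "smooth_along ?U (\<lambda>q. ?E b (f q))" for b
    by (rule smooth_along_subset[OF smooth_along_coord_field[OF C] Int_lower2])
  have N: "smooth_along ?U (\<lambda>q. nabb (f q) (?E c (f q)) (?E b))" for b c
    by (rule smooth_along_subset[OF smooth_along_pullback[OF B.open_domain[OF C]
      B.nab_smooth[OF B.open_domain[OF C] B.smooth_vf_coord_field[OF C] B.smooth_vf_coord_field[OF C]]] Int_lower2])
  \<comment> \<open>The direction \<open>df q (X q)\<close> is expanded in coordinate fields too:
    smoothness of \<open>nabb\<close> concerns directions given by vector fields on the target, and
    this one is only defined along \<open>f\<close>.\<close>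
  have "smooth_along ?U (\<lambda>q. \<Sum>b\<in>Basis. dir_deriv A q (X q) (comp_along ?C V b) *\<^sub>R ?E b (f q) +
      comp_along ?C V b q *\<^sub>R (\<Sum>c\<in>Basis. comp_along ?C (\<lambda>q. df q (X q)) c q *\<^sub>R nabb (f q) (?E c (f q)) (?E b)))"
    by (intro smooth_along_sum smooth_along_add smooth_along_scaleR U A.smooth_fun_dir_deriv X' u u' E N)
  then have "smooth_along ?U (\<lambda>p. cov p (X p) V)"
  proof (rule smooth_along_cong[OF U(1)])
    fix q
    assume q: "q \<in> ?U"
    then have fq: "f q \<in> fst ?C"
      by blast
    have "(\<Sum>c\<in>Basis. comp_along ?C (\<lambda>q. df q (X q)) c q *\<^sub>R nabb (f q) (?E c (f q)) (?E b)) =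
        nabb (f q) (df q (X q)) (?E b)" for b
    proof -
      have lin: "linear (\<lambda>w. nabb (f q) w (?E b))"
        by (rule B.linear_nab[OF B.open_domain[OF C] B.smooth_vf_coord_field[OF C] fq])
      show ?thesis
        using arg_cong[OF along_expand[OF C fq, of "\<lambda>q. df q (X q)"], of "\<lambda>w. nabb (f q) w (?E b)"]
        by (simp only: linear_sum[OF lin] linear_scale[OF lin])
    qed
    then show "(\<Sum>b\<in>Basis. dir_deriv A q (X q) (comp_along ?C V b) *\<^sub>R ?E b (f q) +
      comp_along ?C V b q *\<^sub>R (\<Sum>c\<in>Basis. comp_along ?C (\<lambda>q. df q (X q)) c q *\<^sub>R nabb (f q) (?E c (f q)) (?E b))) =
      cov q (X q) V"
      using cov_expand[OF S _ V C fq, of "X q"] q by simp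
  qed
  then show "\<exists>U. open U \<and> p \<in> U \<and> smooth_along U (\<lambda>p. cov p (X p) V)"
    using U by blast
qed

lemma cov_torsion:
  assumes tor: "torsion_free B nabb" and S: "open S" "p \<in> S"
    and X: "smooth_vf A S X" and Y: "smooth_vf A S Y"
  shows "cov p (X p) (\<lambda>q. df q (Y q)) - cov p (Y p) (\<lambda>q. df q (X q)) = df p (lie_bracket A X Y p)"
proof -
  let ?C = "chart_at B (f p)"
  let ?U = "S \<inter> f -` fst ?C"
  let ?u = "snd ?C \<circ> f"
  let ?E = "coord_field B ?C"
  note C = B.chart_at[of "f p"]
  note U = along_nbhd[OF S C]
  have u: "smooth_fun A ?U ?u"
    by (rule A.smooth_fun_subset[OF smooth_fun_chart_map[OF C(1)] Int_lower2])
  \<comment> \<open>In the preferred chart at \<open>f p\<close> the coordinate frame at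
    \<open>f p\<close> is the standard basis. So the derivative is a second derivative of
    \<open>?u\<close> plus a Christoffel term, and the Christoffel terms cancel by symmetry in the
    difference over \<open>X\<close> and \<open>Y\<close>.\<close>
  have *: "cov p v (\<lambda>q. df q (Z q)) = dir_deriv A p v (\<lambda>q. dir_deriv A q (Z q) ?u) + nabb (f p) (df p v) (?E (df p (Z p)))"
    if Z: "smooth_vf A S Z" for Z v
  proof -
    have Zu: "smooth_fun A ?U (\<lambda>q. dir_deriv A q (Z q) ?u)"
      by (rule A.smooth_fun_dir_deriv[OF U(1) u A.smooth_vf_subset[OF Z Int_lower1]])
    have "dir_deriv A p v (comp_along ?C (\<lambda>q. df q (Z q)) b) = dir_deriv A p v (\<lambda>q. dir_deriv A q (Z q) ?u \<bullet> b)" for b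
      by (rule A.dir_deriv_cong[OF U]) (simp add: tcomp_df[OF C(1)])
    then have "dir_deriv A p v (comp_along ?C (\<lambda>q. df q (Z q)) b) = dir_deriv A p v (\<lambda>q. dir_deriv A q (Z q) ?u) \<bullet> b" for b
      using A.dir_deriv_linear[OF bounded_linear_inner_left Zu U(2), of v b] by simp
    then have "cov p v (\<lambda>q. df q (Z q)) =
        (\<Sum>b\<in>Basis. (dir_deriv A p v (\<lambda>q. dir_deriv A q (Z q) ?u) \<bullet> b) *\<^sub>R b + (df p (Z p) \<bullet> b) *\<^sub>R nabb (f p) (df p v) (?E b))"
      unfolding cov_eq by (simp add: B.coord_field_chart_at B.tcomp_chart_at)
    also have "\<dots> = dir_deriv A p v (\<lambda>q. dir_deriv A q (Z q) ?u) + nabb (f p) (df p v) (?E (df p (Z p)))"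
      by (simp add: sum.distrib euclidean_representation B.nab_coord_field_expand[OF C, of _ "df p (Z p)"])
    finally show ?thesis .
  qed
  have "cov p (X p) (\<lambda>q. df q (Y q)) - cov p (Y p) (\<lambda>q. df q (X q)) =
    dir_deriv A p (X p) (\<lambda>q. dir_deriv A q (Y q) ?u) - dir_deriv A p (Y p) (\<lambda>q. dir_deriv A q (X q) ?u)"
    unfolding *[OF X] *[OF Y] using B.nab_coord_field_commute[OF tor, of "f p" "df p (X p)" "df p (Y p)"] by simp
  also have "\<dots> = dir_deriv A p (lie_bracket A X Y p) ?u"
    by (rule A.lie_bracket_dir_deriv[OF U u A.smooth_vf_subset[OF X Int_lower1] A.smooth_vf_subset[OF Y Int_lower1]])
  finally show ?thesis
    by (simp add: tmap_def)
qed

lemma smooth_along_tensor11: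
  assumes \<phi>: "tensor11 B \<phi>" and S: "open S" and V: "smooth_along S V"
  shows "smooth_along S (\<lambda>p. \<phi> (f p) (V p))"
proof (rule smooth_along_local)
  fix p
  assume p: "p \<in> S"
  let ?C = "chart_at B (f p)"
  let ?U = "S \<inter> f -` fst ?C"
  note C = B.chart_at[of "f p"]
  note U = along_nbhd[OF S p C]
  have E: "smooth_vf B (fst ?C) (\<lambda>n. \<phi> n (coord_field B ?C b n))" for b
    using \<phi> B.open_domain[OF C(1)] B.smooth_vf_coord_field[OF C(1)] unfolding tensor11_def by blast
  have lin: "linear (\<phi> n)" for n
    using \<phi> unfolding tensor11_def by blast
  have "smooth_along ?U (\<lambda>q. \<Sum>b\<in>Basis. comp_along ?C V b q *\<^sub>R \<phi> (f q) (coord_field B ?C b (f q)))"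
    by (intro smooth_along_sum smooth_along_scaleR U smooth_fun_comp_along S C V
      smooth_along_subset[OF smooth_along_pullback[OF B.open_domain[OF C(1)] E] Int_lower2])
  then have "smooth_along ?U (\<lambda>q. \<phi> (f q) (V q))"
  proof (rule smooth_along_cong[OF U(1)])
    fix q
    assume "q \<in> ?U"
    then have "V q = (\<Sum>b\<in>Basis. comp_along ?C V b q *\<^sub>R coord_field B ?C b (f q))"
      using along_expand[OF C(1), of q V] by blast
    from arg_cong[OF this, of "\<phi> (f q)"]
    show "(\<Sum>b\<in>Basis. comp_along ?C V b q *\<^sub>R \<phi> (f q) (coord_field B ?C b (f q))) = \<phi> (f q) (V q)"
      by (simp add: linear_sum[OF lin] linear_scale[OF lin])
  qed
  then show "\<exists>U. open U \<and> p \<in> U \<and> smooth_along U (\<lambda>q. \<phi> (f q) (V q))"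
    using U by blast
qed

text \<open>Parallelism of \<open>\<phi>\<close> concerns fields on the target, whereas
  \<open>V\<close> lives along \<open>f\<close>; it is applied to the coordinate fields and carried
  over to \<open>V\<close> by the Leibniz rule.\<close>

lemma cov_tensor11:
  assumes \<phi>: "tensor11 B \<phi>" "parallel_tensor11 B nabb \<phi>"
    and S: "open S" "p \<in> S" and V: "smooth_along S V"
  shows "cov p v (\<lambda>q. \<phi> (f q) (V q)) = \<phi> (f p) (cov p v V)"
proof -
  let ?C = "chart_at B (f p)"
  let ?U = "S \<inter> f -` fst ?C"
  note C = B.chart_at[of "f p"]
  note U = along_nbhd[OF S C]
  note o = B.open_domain[OF C(1)]
  have E: "smooth_vf B (fst ?C) (\<lambda>n. \<phi> n (coord_field B ?C b n))" for b
    using \<phi>(1) o B.smooth_vf_coord_field[OF C(1)] unfolding tensor11_def by blast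
  have lin: "linear (\<phi> n)" for n
    using \<phi>(1) unfolding tensor11_def by blast
  have par: "nabb (f p) (df p v) (\<lambda>n. \<phi> n (coord_field B ?C b n)) = \<phi> (f p) (nabb (f p) (df p v) (coord_field B ?C b))" for b
    using \<phi>(2) o B.smooth_vf_coord_field[OF C(1)] C(2) unfolding parallel_tensor11_def by (metis eq_iff_diff_eq_0)
  have "cov p v (\<lambda>q. \<phi> (f q) (V q)) = cov p v (\<lambda>q. \<Sum>b\<in>Basis. comp_along ?C V b q *\<^sub>R \<phi> (f q) (coord_field B ?C b (f q)))"
  proof (rule cov_cong[OF U])
    fix q
    assume "q \<in> ?U"
    then have "V q = (\<Sum>b\<in>Basis. comp_along ?C V b q *\<^sub>R coord_field B ?C b (f q))"
      using along_expand[OF C(1), of q V] by blast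
    from arg_cong[OF this, of "\<phi> (f q)"]
    show "\<phi> (f q) (V q) = (\<Sum>b\<in>Basis. comp_along ?C V b q *\<^sub>R \<phi> (f q) (coord_field B ?C b (f q)))"
      by (simp add: linear_sum[OF lin] linear_scale[OF lin])
  qed
  also have "\<dots> = (\<Sum>b\<in>Basis. cov p v (\<lambda>q. comp_along ?C V b q *\<^sub>R \<phi> (f q) (coord_field B ?C b (f q))))"
    by (intro cov_sum[OF U] smooth_along_scaleR U smooth_fun_comp_along S C V
      smooth_along_subset[OF smooth_along_pullback[OF o E] Int_lower2])
  also have "\<dots> = (\<Sum>b\<in>Basis. dir_deriv A p v (comp_along ?C V b) *\<^sub>R \<phi> (f p) (coord_field B ?C b (f p)) +
    comp_along ?C V b p *\<^sub>R nabb (f p) (df p v) (\<lambda>n. \<phi> n (coord_field B ?C b n)))"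
    by (intro sum.cong refl cov_scaleR_pullback[OF U smooth_fun_comp_along[OF S(1) C(1) V] o C(2) E])
  also have "\<dots> = \<phi> (f p) (cov p v V)"
    unfolding cov_eq par by (simp add: linear_sum[OF lin] linear_add[OF lin] linear_scale[OF lin])
  finally show ?thesis .
qed

end

section \<open>Isometric immersions\<close>

locale isometric_immersion = smooth_mapping_connection A B f nabb + A: smooth_connection A nab
  for A :: "('m::{t2_space,second_countable_topology}, 'e::euclidean_space) chart set"
    and B :: "('n::{t2_space,second_countable_topology}, 'f::euclidean_space) chart set"
    and f :: "'m \<Rightarrow> 'n" and nabb :: "('n, 'f) connection" and nab :: "('m, 'e) connection" +
  fixes g :: "'n \<Rightarrow> 'f \<Rightarrow> 'f \<Rightarrow> real"
  assumes metric: "riemannian_metric B g"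
    and metric_nabb: "metric_connection B g nabb" and torsion_nabb: "torsion_free B nabb"
    and inj_df: "inj (df p)"
    and metric_nab: "metric_connection A (induced_metric A B f g) nab" and torsion_nab: "torsion_free A nab"
begin

abbreviation "tanp \<equiv> tan_part A B f g"
abbreviation "ig \<equiv> induced_metric A B f g"

lemma bilinear_g: "bilinear (g n)"
  using metric unfolding riemannian_metric_def by blast

lemma g_sym: "g n u v = g n v u"
  using metric unfolding riemannian_metric_def by blast

lemma g_pos: "v \<noteq> 0 \<Longrightarrow> g n v v > 0"
  using metric unfolding riemannian_metric_def by blast

lemma linear_g: "linear (g n u)" "linear (\<lambda>u. g n u v)"
  using bilinear_g unfolding bilinear_def by auto

lemmas g_simps = linear_add[OF linear_g(1)] linear_diff[OF linear_g(1)] linear_scale[OF linear_g(1)]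
  linear_0[OF linear_g(1)] linear_neg[OF linear_g(1)]
  linear_add[OF linear_g(2)] linear_diff[OF linear_g(2)] linear_scale[OF linear_g(2)]
  linear_0[OF linear_g(2)] linear_neg[OF linear_g(2)]

lemma g_eq_0_iff: "g n v v = 0 \<longleftrightarrow> v = 0"
  by (metis g_pos less_irrefl linear_0[OF linear_g(1)])

lemma g_smooth: "open S \<Longrightarrow> smooth_vf B S X \<Longrightarrow> smooth_vf B S Y \<Longrightarrow> smooth_fun B S (\<lambda>n. g n (X n) (Y n))"
  using metric unfolding riemannian_metric_def by blast

lemma g_along_expand:
  assumes "C \<in> B" "f q \<in> fst C"
  shows "g (f q) (V q) w = (\<Sum>b\<in>Basis. comp_along C V b q * g (f q) (coord_field B C b (f q)) w)"
  using arg_cong[OF along_expand[OF assms, of V], of "\<lambda>u. g (f q) u w"]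
  by (simp add: linear_sum[OF linear_g(2)] g_simps)

lemma smooth_fun_g_along:
  assumes S: "open S" and V: "smooth_along S V" and W: "smooth_along S W"
  shows "smooth_fun A S (\<lambda>p. g (f p) (V p) (W p))"
proof (rule A.smooth_fun_local)
  fix p
  assume p: "p \<in> S"
  let ?C = "chart_at B (f p)"
  let ?U = "S \<inter> f -` fst ?C"
  let ?E = "coord_field B ?C"
  note C = B.chart_at[of "f p"]
  note U = along_nbhd[OF S p C]
  note o = B.open_domain[OF C(1)]
  have E: "smooth_fun A ?U (\<lambda>q. g (f q) (?E b (f q)) (?E c (f q)))" for b c
    by (rule A.smooth_fun_subset[OF smooth_fun_pullback[OF o g_smooth[OF o B.smooth_vf_coord_field[OF C(1)]
      B.smooth_vf_coord_field[OF C(1)]]] Int_lower2])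
  have "smooth_fun A ?U (\<lambda>q. \<Sum>b\<in>Basis. comp_along ?C V b q *
      (\<Sum>c\<in>Basis. comp_along ?C W c q * g (f q) (?E c (f q)) (?E b (f q))))"
    by (intro A.smooth_fun_sum A.smooth_fun_mult U smooth_fun_comp_along S C V W E)
  then have "smooth_fun A ?U (\<lambda>q. g (f q) (V q) (W q))"
  proof (rule A.smooth_fun_cong[OF U(1)])
    fix q
    assume "q \<in> ?U"
    then have q: "f q \<in> fst ?C"
      by blast
    have "g (f q) (?E b (f q)) (W q) = (\<Sum>c\<in>Basis. comp_along ?C W c q * g (f q) (?E c (f q)) (?E b (f q)))" for b
      by (subst g_sym) (rule g_along_expand[OF C(1) q])
    then show "(\<Sum>b\<in>Basis. comp_along ?C V b q * (\<Sum>c\<in>Basis. comp_along ?C W c q * g (f q) (?E c (f q)) (?E b (f q)))) =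
        g (f q) (V q) (W q)"
      by (simp only: g_along_expand[OF C(1) q, of V])
  qed
  then show "\<exists>U. open U \<and> p \<in> U \<and> smooth_fun A U (\<lambda>q. g (f q) (V q) (W q))"
    using U by blast
qed

text \<open>
  Compatibility of the covariant derivative along \<open>f\<close> with the metric is established for a general
  section in the first slot once it is known for pulled back vector fields there; by symmetry,
  two applications of this step are enough.
\<close>

lemma cov_metric_step:
  assumes S: "open S" "p \<in> S" and V: "smooth_along S V" and W: "smooth_along S W"
    and coord: "\<And>b. dir_deriv A p v (\<lambda>q. g (f q) (coord_field B (chart_at B (f p)) b (f q)) (W q)) =
      g (f p) (nabb (f p) (df p v) (coord_field B (chart_at B (f p)) b)) (W p) +
      g (f p) (coord_field B (chart_at B (f p)) b (f p)) (cov p v W)"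
  shows "dir_deriv A p v (\<lambda>q. g (f q) (V q) (W q)) = g (f p) (cov p v V) (W p) + g (f p) (V p) (cov p v W)"
proof -
  let ?C = "chart_at B (f p)"
  let ?U = "S \<inter> f -` fst ?C"
  let ?E = "coord_field B ?C"
  note C = B.chart_at[of "f p"]
  note U = along_nbhd[OF S C]
  have E: "smooth_along ?U (\<lambda>q. ?E b (f q))" for b
    by (rule smooth_along_subset[OF smooth_along_coord_field[OF C(1)] Int_lower2])
  have gE: "smooth_fun A ?U (\<lambda>q. g (f q) (?E b (f q)) (W q))" for b
    by (rule smooth_fun_g_along[OF U(1) E smooth_along_subset[OF W Int_lower1]])
  note comp = smooth_fun_comp_along[OF S(1) C(1) V]
  have "dir_deriv A p v (\<lambda>q. g (f q) (V q) (W q)) =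
      dir_deriv A p v (\<lambda>q. \<Sum>b\<in>Basis. comp_along ?C V b q * g (f q) (?E b (f q)) (W q))"
    by (rule A.dir_deriv_cong[OF U]) (use g_along_expand[OF C(1)] in blast)
  also have "\<dots> = (\<Sum>b\<in>Basis. dir_deriv A p v (\<lambda>q. comp_along ?C V b q * g (f q) (?E b (f q)) (W q)))"
    by (intro A.dir_deriv_sum[of _ ?U] A.smooth_fun_mult U comp gE)
  also have "\<dots> = (\<Sum>b\<in>Basis. comp_along ?C V b p * (g (f p) (nabb (f p) (df p v) (?E b)) (W p) + g (f p) (?E b (f p)) (cov p v W)) +
      dir_deriv A p v (comp_along ?C V b) * g (f p) (?E b (f p)) (W p))"
    by (simp only: A.dir_deriv_mult[OF comp gE U(2)] coord)
  also have "\<dots> = g (f p) (cov p v V) (W p) + g (f p) (V p) (cov p v W)"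
    unfolding g_along_expand[OF C, of V] cov_eq[of p v V]
    by (simp add: linear_sum[OF linear_g(2)] g_simps sum.distrib distrib_left)
  finally show ?thesis .
qed

lemma cov_metric:
  assumes S: "open S" "p \<in> S" and V: "smooth_along S V" and W: "smooth_along S W"
  shows "dir_deriv A p v (\<lambda>q. g (f q) (V q) (W q)) = g (f p) (cov p v V) (W p) + g (f p) (V p) (cov p v W)"
proof -
  let ?C = "chart_at B (f p)"
  let ?U = "S \<inter> f -` fst ?C"
  let ?E = "coord_field B ?C"
  note C = B.chart_at[of "f p"]
  note U = along_nbhd[OF S C]
  note o = B.open_domain[OF C(1)]
  have E: "smooth_along ?U (\<lambda>q. ?E b (f q))" for b
    by (rule smooth_along_subset[OF smooth_along_coord_field[OF C(1)] Int_lower2])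
  have W': "smooth_along ?U W"
    by (rule smooth_along_subset[OF W Int_lower1])
  have covE: "cov p v (\<lambda>q. ?E b (f q)) = nabb (f p) (df p v) (?E b)" for b
    by (rule cov_pullback[OF o C(2) B.smooth_vf_coord_field[OF C(1)]])
  \<comment> \<open>With pulled back fields in both slots, this is metric compatibility of
    \<open>nabb\<close> combined with the chain rule.\<close>
  have EE: "dir_deriv A p v (\<lambda>q. g (f q) (?E b (f q)) (?E c (f q))) =
      g (f p) (nabb (f p) (df p v) (?E b)) (?E c (f p)) + g (f p) (?E b (f p)) (nabb (f p) (df p v) (?E c))" for b c
    unfolding dir_deriv_pullback[OF o C(2) g_smooth[OF o B.smooth_vf_coord_field[OF C(1)] B.smooth_vf_coord_field[OF C(1)]]]
    using metric_nabb o B.smooth_vf_coord_field[OF C(1)] C(2) unfolding metric_connection_def by blast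
  \<comment> \<open>The first application puts \<open>W\<close> into the general slot against a
    coordinate field. With the slots exchanged it is the hypothesis \<open>coord\<close> for the
    second application, to \<open>V\<close> and \<open>W\<close>.\<close>
  have WE: "dir_deriv A p v (\<lambda>q. g (f q) (W q) (?E b (f q))) =
      g (f p) (cov p v W) (?E b (f p)) + g (f p) (W p) (nabb (f p) (df p v) (?E b))" for b
    using cov_metric_step[OF U W' E, of v b] EE by (simp add: covE)
  show ?thesis
    by (rule cov_metric_step[OF S V W]) (use WE in \<open>simp only: g_sym[of _ _ "W _"] g_sym[of _ _ "cov _ _ _"] add.commute\<close>)
qed

lemma ig_eq: "ig p u v = g (f p) (df p u) (df p v)"
  by (simp add: induced_metric_def)

lemma df_eq_0_iff: "df p v = 0 \<longleftrightarrow> v = 0"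
  using inj_df[of p] linear_0[OF linear_df] by (metis injD)

lemma ig_eq_0_iff: "ig p v v = 0 \<longleftrightarrow> v = 0"
  by (simp add: ig_eq g_eq_0_iff df_eq_0_iff)

lemma ig_sym: "ig p u v = ig p v u"
  unfolding ig_eq by (rule g_sym)

lemma linear_ig: "linear (ig p u)" "linear (\<lambda>u. ig p u v)"
proof -
  have "ig p u = g (f p) (df p u) \<circ> df p" "(\<lambda>u. ig p u v) = (\<lambda>w. g (f p) w (df p v)) \<circ> df p"
    by (auto simp: ig_eq)
  then show "linear (ig p u)" "linear (\<lambda>u. ig p u v)"
    using linear_compose[OF linear_df linear_g(1)] linear_compose[OF linear_df linear_g(2)] by metis+
qed

lemmas ig_simps = linear_add[OF linear_ig(1)] linear_diff[OF linear_ig(1)] linear_scale[OF linear_ig(1)]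
  linear_0[OF linear_ig(1)] linear_neg[OF linear_ig(1)] linear_sum[OF linear_ig(1)]
  linear_add[OF linear_ig(2)] linear_diff[OF linear_ig(2)] linear_scale[OF linear_ig(2)]
  linear_0[OF linear_ig(2)] linear_neg[OF linear_ig(2)] linear_sum[OF linear_ig(2)]

lemma ig_smooth: "open S \<Longrightarrow> smooth_vf A S X \<Longrightarrow> smooth_vf A S Y \<Longrightarrow> smooth_fun A S (\<lambda>p. ig p (X p) (Y p))"
  unfolding ig_eq by (rule smooth_fun_g_along[OF _ smooth_along_df smooth_along_df])

text \<open>\<open>second_fund\<close> is symmetric because both connections are torsion-free, and
  its pairing with tangent vectors is skew because both are metric. This is the argument that proves
  uniqueness of the Levi-Civita connection.\<close>

lemma second_fund_normal:
  assumes S: "open S" "p \<in> S" and X: "smooth_vf A S X" and Y: "smooth_vf A S Y"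
  shows "second_fund A B f nabb nab X Y p \<in> normal_at A B f g p"
proof -
  let ?h = "\<lambda>X Y. second_fund A B f nabb nab X Y p"
  let ?U = "fst (chart_at A p) \<inter> S"
  note C = A.chart_at[of p]
  have U: "open ?U" "p \<in> ?U"
    using open_Int[OF A.open_domain[OF C(1)] S(1)] C S by auto
  have sym: "?h X Y = ?h Y X" if "smooth_vf A ?U X" "smooth_vf A ?U Y" for X Y
  proof -
    have "nab p (X p) Y - nab p (Y p) X = lie_bracket A X Y p"
      using torsion_nab that U unfolding torsion_free_def by blast
    then have "df p (nab p (X p) Y) - df p (nab p (Y p) X) = df p (lie_bracket A X Y p)"
      by (metis linear_diff[OF linear_df])
    then show ?thesis
      using cov_torsion[OF torsion_nabb U that] unfolding second_fund_def by (simp add: algebra_simps)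
  qed
  have skew: "g (f p) (?h X Y) (df p (Z p)) = - g (f p) (?h X Z) (df p (Y p))"
    if X: "smooth_vf A ?U X" and Y: "smooth_vf A ?U Y" and Z: "smooth_vf A ?U Z" for X Y Z
  proof -
    have "dir_deriv A p (X p) (\<lambda>q. ig q (Y q) (Z q)) = ig p (nab p (X p) Y) (Z p) + ig p (Y p) (nab p (X p) Z)"
      using metric_nab Y Z U unfolding metric_connection_def by blast
    moreover have "dir_deriv A p (X p) (\<lambda>q. g (f q) (df q (Y q)) (df q (Z q))) =
        g (f p) (cov p (X p) (\<lambda>q. df q (Y q))) (df p (Z p)) + g (f p) (df p (Y p)) (cov p (X p) (\<lambda>q. df q (Z q)))"
      by (rule cov_metric[OF U smooth_along_df[OF U(1) Y] smooth_along_df[OF U(1) Z]])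
    ultimately show ?thesis
      unfolding second_fund_def ig_eq g_simps by (simp add: g_sym[of "f p" _ "df p (Y p)"])
  qed
  \<comment> \<open>A trilinear expression that is symmetric in the first two and skew in the last two arguments vanishes.\<close>
  have "g (f p) (?h X Y) (df p z) = 0" for z
  proof -
    \<comment> \<open>The tangent vector \<open>z\<close> is extended by constant components in the
      chart at \<open>p\<close>; this extension is local, which is why all fields are restricted to
      \<open>?U\<close>.\<close>
    let ?Z = "coord_field A (chart_at A p) z"
    have X: "smooth_vf A ?U X" and Y: "smooth_vf A ?U Y" and Z: "smooth_vf A ?U ?Z"
      using A.smooth_vf_subset[OF X] A.smooth_vf_subset[OF Y] A.smooth_vf_subset[OF A.smooth_vf_coord_field[OF C(1)]] by auto
    have "g (f p) (?h X Y) (df p (?Z p)) = 0"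
      using skew[OF X Y Z] skew[OF Y Z X] skew[OF Z X Y] sym[OF X Y] sym[OF Y Z] sym[OF X Z]
      by simp
    then show ?thesis
      by (simp add: A.coord_field_chart_at)
  qed
  then show ?thesis
    by (simp add: normal_at_def)
qed

lemma smooth_along_second_fund:
  assumes "open S" "smooth_vf A S X" "smooth_vf A S Y"
  shows "smooth_along S (second_fund A B f nabb nab X Y)"
proof -
  have "smooth_along S (\<lambda>p. cov p (X p) (\<lambda>q. df q (Y q)) + (-1) *\<^sub>R df p (nab p (X p) Y))"
    using assms by (intro smooth_along_add smooth_along_scaleR A.smooth_fun_const smooth_along_cov
      smooth_along_df A.nab_smooth)
  then show ?thesis
    by (rule smooth_along_cong[OF assms(1)]) (simp add: second_fund_def)
qed

section \<open>The tangential projection and its smoothness\<close>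

lemma tan_part_eqI:
  assumes "w - df p u \<in> normal_at A B f g p"
  shows "tanp p w = u"
  unfolding tan_part_def
proof (rule the_equality[where P = "\<lambda>u. w - df p u \<in> normal_at A B f g p", OF assms])
  fix u'
  assume u': "w - df p u' \<in> normal_at A B f g p"
  have "g (f p) (df p u' - df p u) (df p v) = 0" for v
    using assms u' unfolding normal_at_def by (auto simp: g_simps)
  then have "ig p (u' - u) (u' - u) = 0"
    unfolding ig_eq linear_diff[OF linear_df] by (metis linear_diff[OF linear_df])
  then show "u' = u"
    by (simp add: ig_eq_0_iff)
qed

lemma tan_part_df: "tanp p (df p u) = u"
  by (rule tan_part_eqI) (simp add: normal_at_def g_simps)

text \<open>\<open>G\<close> is the Gram matrix of the frame \<open>E\<close>, injective since the
  metric is definite. With \<open>E\<close> the identity it gives existence of the tangential part,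
  with a coordinate frame its smoothness.\<close>

lemma gram_linear_inj:
  fixes E :: "'e \<Rightarrow> 'e" and p :: 'm
  assumes E: "linear E" "inj E"
  defines "G \<equiv> \<lambda>x. \<Sum>b\<in>Basis. ig p (E x) (E b) *\<^sub>R b"
  shows "linear G" "inj G"
proof -
  show G: "linear G"
    unfolding G_def
    by (rule linearI) (simp_all add: linear_add[OF E(1)] linear_scale[OF E(1)] ig_simps scaleR_add_left
      sum.distrib scaleR_sum_right)
  have "x = 0" if "G x = 0" for x
  proof -
    have "ig p (E x) (E b) = 0" if "b \<in> Basis" for b
      using \<open>G x = 0\<close> that unfolding G_def by (metis inner_sum_left_Basis inner_zero_left)
    moreover have "ig p (E x) (E x) = (\<Sum>b\<in>Basis. (x \<bullet> b) *\<^sub>R ig p (E x) (E b))"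
      using linear_eq_sum_Basis[OF linear_compose[OF E(1) linear_ig(1)], of p "E x" x] by (simp add: o_def)
    ultimately have "E x = 0"
      by (simp add: ig_eq_0_iff)
    then show ?thesis
      using E by (metis injD linear_0)
  qed
  then show "inj G"
    by (simp add: linear_injective_0[OF G])
qed

lemma tan_part_normal: "w - df p (tanp p w) \<in> normal_at A B f g p"
proof -
  let ?G = "\<lambda>x. \<Sum>b\<in>Basis. ig p x b *\<^sub>R b"
  have "linear ?G" "inj ?G"
    using gram_linear_inj[OF linear_id inj_on_id, of p] by simp_all
  then have "surj ?G"
    by (rule linear_injective_imp_surjective) simp
  then obtain u where u: "(\<Sum>b\<in>Basis. g (f p) w (df p b) *\<^sub>R b) = ?G u"
    by (rule surjE)
  have "ig p u b = g (f p) w (df p b)" if "b \<in> Basis" for b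
    using arg_cong[OF u, of "\<lambda>x. x \<bullet> b"] by (simp only: inner_sum_left_Basis[OF that])
  then have b: "g (f p) (w - df p u) (df p b) = 0" if "b \<in> Basis" for b
    using that by (simp add: ig_eq g_simps)
  have "g (f p) (w - df p u) (df p v) = 0" for v
    using linear_eq_sum_Basis[OF linear_compose[OF linear_df linear_g(1)], of "f p" "w - df p u" p v]
    by (simp add: o_def b)
  then have "w - df p u \<in> normal_at A B f g p"
    by (simp add: normal_at_def)
  then show ?thesis
    using tan_part_eqI by simp
qed

lemma ig_tan_part: "ig p (tanp p w) v = g (f p) w (df p v)"
  using tan_part_normal[of w p] by (simp add: normal_at_def ig_eq g_simps)

lemma linear_tan_part: "linear (tanp p)"
proof (rule linearI)
  show "tanp p (w + w') = tanp p w + tanp p w'" for w w'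
    using tan_part_normal[of w p] tan_part_normal[of w' p]
    by (intro tan_part_eqI) (simp add: normal_at_def g_simps linear_add[OF linear_df])
  show "tanp p (c *\<^sub>R w) = c *\<^sub>R tanp p w" for c w
    using tan_part_normal[of w p]
    by (intro tan_part_eqI) (simp add: normal_at_def g_simps linear_scale[OF linear_df])
qed

text \<open>\<open>tan_part\<close> is a definite description and has no formula to differentiate.
  Its components in a coordinate frame solve the Gram system, whose coefficients and right-hand side
  are smooth.\<close>

lemma smooth_vf_tan_part:
  assumes S: "open S" and V: "smooth_along S V"
  shows "smooth_vf A S (\<lambda>p. tanp p (V p))"
proof (rule A.smooth_vfI_local[OF S])
  fix p
  assume p: "p \<in> S"
  let ?C = "chart_at A p"
  let ?U = "fst ?C \<inter> S"
  let ?E = "coord_field A ?C"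
  let ?G = "\<lambda>q x. \<Sum>b\<in>Basis. ig q (?E x q) (?E b q) *\<^sub>R b"
  note C = A.chart_at[of p]
  have U: "open ?U" "p \<in> ?U"
    using open_Int[OF A.open_domain[OF C(1)] S] C p by auto
  have E: "smooth_vf A ?U (?E b)" for b
    by (rule A.smooth_vf_subset[OF A.smooth_vf_coord_field[OF C(1)] Int_lower1])
  have "smooth_fun A ?U (\<lambda>q. tcomp A ?C q (tanp q (V q)))"
  proof (rule A.smooth_fun_linear_system[OF U(1), where G = ?G and w = "\<lambda>q. \<Sum>b\<in>Basis. g (f q) (V q) (df q (?E b q)) *\<^sub>R b"])
    fix q
    assume "q \<in> ?U"
    then have q: "q \<in> fst ?C"
      by blast
    have "inj (\<lambda>x. ?E x q)"
      by (rule inj_on_inverseI[of _ "tcomp A ?C q"]) (rule A.tcomp_coord_field[OF C(1) q])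
    then show "linear (?G q)" "inj (?G q)"
      using gram_linear_inj[OF A.linear_coord_field[OF C(1) q]] by auto
    show "?G q (tcomp A ?C q (tanp q (V q))) = (\<Sum>b\<in>Basis. g (f q) (V q) (df q (?E b q)) *\<^sub>R b)"
      by (simp add: A.coord_field_tcomp[OF C(1) q] ig_tan_part)
  next
    show "smooth_fun A ?U (\<lambda>q. ?G q b)" for b
      by (intro A.smooth_fun_sum A.smooth_fun_scaleR A.smooth_fun_const ig_smooth U E)
    show "smooth_fun A ?U (\<lambda>q. \<Sum>b\<in>Basis. g (f q) (V q) (df q (?E b q)) *\<^sub>R b)"
      by (intro A.smooth_fun_sum A.smooth_fun_scaleR A.smooth_fun_const smooth_fun_g_along smooth_along_df U E
        smooth_along_subset[OF V Int_lower2])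
  qed
  then show "\<exists>C\<in>A. \<exists>U. open U \<and> p \<in> U \<and> U \<subseteq> fst C \<and> smooth_fun A U (\<lambda>q. tcomp A C q (tanp q (V q)))"
    using U C(1) by (meson inf_le1)
qed

end

section \<open>Submanifolds with parallel tangential structure\<close>

locale parallel_submanifold = isometric_immersion A B f nabb nab g
  for A :: "('m::{t2_space,second_countable_topology}, 'e::euclidean_space) chart set"
    and B :: "('n::{t2_space,second_countable_topology}, 'f::euclidean_space) chart set"
    and f :: "'m \<Rightarrow> 'n" and nabb :: "('n, 'f) connection" and nab :: "('m, 'e) connection"
    and g :: "'n \<Rightarrow> 'f \<Rightarrow> 'f \<Rightarrow> real" +
  fixes \<phi> :: "'n \<Rightarrow> 'f \<Rightarrow> 'f"
  assumes tensor: "tensor11 B \<phi>" and \<phi>_\<phi>: "\<phi> n (\<phi> n w) = - w" and g_\<phi>: "g n (\<phi> n w) (\<phi> n w') = g n w w'"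
    and parallel: "parallel_tensor11 B nabb \<phi>" and T_parallel: "T_parallel A nab (T_op A B f \<phi> g)"
begin

abbreviation "T \<equiv> T_op A B f \<phi> g"

lemma linear_\<phi>: "linear (\<phi> n)"
  using tensor unfolding tensor11_def by blast

lemma linear_T: "linear (T p)"
proof -
  have "T p = tanp p \<circ> (\<phi> (f p) \<circ> df p)"
    by (simp add: T_op_def fun_eq_iff)
  then show ?thesis
    using linear_compose[OF linear_compose[OF linear_df linear_\<phi>] linear_tan_part] by metis
qed

lemma linear_TT: "linear (\<lambda>v. T p (T p v) + v)"
  by (rule linearI) (simp_all add: linear_add[OF linear_T] linear_scale[OF linear_T] algebra_simps)

lemma smooth_T: "open S \<Longrightarrow> smooth_vf A S Y \<Longrightarrow> smooth_vf A S (\<lambda>p. T p (Y p))"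
  unfolding T_op_def by (rule smooth_vf_tan_part[OF _ smooth_along_tensor11[OF tensor _ smooth_along_df]])

lemma ig_T: "ig p (T p u) v = g (f p) (\<phi> (f p) (df p u)) (df p v)"
  unfolding T_op_def by (rule ig_tan_part)

text \<open>An isometry \<open>\<phi>\<close> with square -1 is skew for \<open>g\<close>, and
  \<open>T\<close> has the same pairings with tangent vectors as \<open>\<phi>\<close>.\<close>

lemma T_skew: "ig p (T p u) v = - ig p u (T p v)"
proof -
  have "ig p (T p u) v = g (f p) (\<phi> (f p) (\<phi> (f p) (df p u))) (\<phi> (f p) (df p v))"
    unfolding ig_T g_\<phi> ..
  also have "\<dots> = - g (f p) (\<phi> (f p) (df p v)) (df p u)"
    by (simp add: \<phi>_\<phi> g_simps g_sym)
  also have "\<dots> = - ig p u (T p v)"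
    unfolding ig_T[symmetric] by (simp add: ig_sym)
  finally show ?thesis .
qed

lemma TT_symmetric: "ig p (T p (T p u) + u) v = ig p u (T p (T p v) + v)"
  by (simp add: ig_simps T_skew)

lemma \<phi>_df_eq_T:
  assumes "T p (T p v) = - v"
  shows "\<phi> (f p) (df p v) = df p (T p v)"
proof -
  let ?a = "\<phi> (f p) (df p v)" and ?b = "df p (T p v)"
  have "g (f p) ?a ?b = ig p (T p v) (T p v)"
    by (rule ig_T[symmetric])
  moreover have "g (f p) ?b ?b = ig p (T p v) (T p v)"
    by (simp add: ig_eq)
  moreover have "ig p (T p v) (T p v) = ig p v v"
    using assms by (simp add: T_skew ig_simps)
  moreover have "g (f p) ?a ?a = ig p v v"
    by (simp add: g_\<phi> ig_eq)
  ultimately have "g (f p) (?a - ?b) (?a - ?b) = 0"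
    by (simp add: g_simps g_sym[of "f p" ?b ?a])
  then show ?thesis
    by (simp add: g_eq_0_iff)
qed

lemma nab_T:
  assumes "smooth_vf A UNIV X" "smooth_vf A UNIV Y"
  shows "nab p (X p) (\<lambda>q. T q (Y q)) = T p (nab p (X p) Y)"
  using T_parallel[unfolded T_parallel_def, rule_format, OF assms, of p] by simp

lemma nab_TT:
  assumes "smooth_vf A UNIV X" "smooth_vf A UNIV Y"
  shows "nab p (X p) (\<lambda>q. T q (T q (Y q)) + Y q) = T p (T p (nab p (X p) Y)) + nab p (X p) Y"
  using nab_T[OF assms(1) smooth_T[OF open_UNIV assms(2)], of p] nab_T[OF assms, of p]
    A.nab_add[OF open_UNIV smooth_T[OF open_UNIV smooth_T[OF open_UNIV assms(2)]] assms(2), of p "X p"] by simp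

section \<open>Angles with respect to the metric \<open>g\<close>\<close>

lemma Cauchy_Schwarz_g: "\<bar>g n u w\<bar> \<le> sqrt (g n u u) * sqrt (g n w w)"
proof (cases "w = 0")
  case True
  then show ?thesis
    by (simp add: g_simps)
next
  case False
  then have w: "g n w w > 0"
    by (rule g_pos)
  let ?t = "g n u w / g n w w"
  have "0 \<le> g n (u - ?t *\<^sub>R w) (u - ?t *\<^sub>R w)"
    using g_pos[of "u - ?t *\<^sub>R w" n] by (cases "u - ?t *\<^sub>R w = 0") (auto simp: g_simps)
  also have "\<dots> = g n u u - (g n u w)\<^sup>2 / g n w w"
    using w by (simp add: g_simps g_sym[of n w u] power2_eq_square field_simps)
  finally have "(g n u w)\<^sup>2 \<le> g n u u * g n w w"
    using w by (simp add: field_simps)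
  then show ?thesis
    using real_sqrt_le_mono by (fastforce simp: real_sqrt_mult)
qed

lemma vec_angle_nonneg: "0 \<le> vec_angle (g n) u w"
proof -
  let ?s = "sqrt (g n u u) * sqrt (g n w w)"
  have "\<bar>g n u w / ?s\<bar> \<le> 1"
  proof (cases "?s = 0")
    \<comment> \<open>A zero denominator makes the quotient 0, so the bound also holds for zero
      vectors.\<close>
    case True
    then show ?thesis
      by (simp only: True) simp
  next
    case False
    moreover have "0 \<le> ?s"
      using Cauchy_Schwarz_g[of n u w] by linarith
    ultimately have "0 < ?s"
      by (simp only: less_le) simp
    then show ?thesis
      using Cauchy_Schwarz_g[of n u w] by (simp only: abs_divide abs_of_pos pos_divide_le_eq mult_1)
  qed
  then have "- 1 \<le> g n u w / ?s" "g n u w / ?s \<le> 1"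
    by linarith+
  then show ?thesis
    unfolding vec_angle_def by (rule arccos_lbound)
qed

lemma vec_angle_self: "u \<noteq> 0 \<Longrightarrow> vec_angle (g n) u u = 0"
  using g_pos[of u n] by (simp add: vec_angle_def)

text \<open>The infimum is attained at \<open>u\<close> itself; nonnegativity of all angles supplies
  the lower bound.\<close>

lemma subspace_angle_mem:
  assumes "u \<in> W" "u \<noteq> 0"
  shows "subspace_angle (g n) u W = 0"
proof (rule antisym)
  show "subspace_angle (g n) u W \<le> 0"
    unfolding subspace_angle_def
    by (rule cINF_lower2[where x = u]) (use assms vec_angle_nonneg vec_angle_self in \<open>auto intro!: bdd_belowI2\<close>)
  show "0 \<le> subspace_angle (g n) u W"
    unfolding subspace_angle_def by (rule cINF_greatest) (use assms vec_angle_nonneg in auto)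
qed

text \<open>Every angle in question is \<open>arccos 0\<close>; the nonzero \<open>w\<close> ensures
  that the infimum is taken over a nonempty set.\<close>

lemma subspace_angle_orthogonal:
  assumes "w \<in> W" "w \<noteq> 0" "\<And>w. w \<in> W \<Longrightarrow> g n u w = 0"
  shows "subspace_angle (g n) u W = pi / 2"
proof -
  have "(\<lambda>w. vec_angle (g n) u w) ` (W - {0}) = {pi / 2}"
    using assms by (auto simp: vec_angle_def)
  then show ?thesis
    unfolding subspace_angle_def by (metis cInf_singleton)
qed

end

section \<open>Pointwise linear algebra of the slant decomposition\<close>

locale parallel_slant_submanifold = parallel_submanifold A B f nabb nab g \<phi>
  for A :: "('m::{t2_space,second_countable_topology}, 'e::euclidean_space) chart set"
    and B :: "('n::{t2_space,second_countable_topology}, 'f::euclidean_space) chart set"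
    and f :: "'m \<Rightarrow> 'n" and nabb :: "('n, 'f) connection" and nab :: "('m, 'e) connection"
    and g :: "'n \<Rightarrow> 'f \<Rightarrow> 'f \<Rightarrow> real" and \<phi> :: "'n \<Rightarrow> 'f \<Rightarrow> 'f" +
  fixes k :: nat and D :: "nat \<Rightarrow> 'm \<Rightarrow> 'e set" and \<theta> :: "nat \<Rightarrow> 'm \<Rightarrow> real"
  assumes slant: "pointwise_k_slant A B f \<phi> g k D \<theta>"
begin

lemmas slant_conditions = slant[unfolded pointwise_k_slant_def, THEN conjunct2]

lemma distribution_D: "i \<le> k \<Longrightarrow> distribution A (D i)"
  using slant_conditions[THEN conjunct1] by blast

lemma subspace_D: "i \<le> k \<Longrightarrow> subspace (D i p)"
  using distribution_D unfolding distribution_def by blast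

lemma orthogonal_D: "i \<le> k \<Longrightarrow> j \<le> k \<Longrightarrow> i \<noteq> j \<Longrightarrow> u \<in> D i p \<Longrightarrow> v \<in> D j p \<Longrightarrow> ig p u v = 0"
  using slant_conditions[THEN conjunct2, THEN conjunct1] by blast

lemma decompose:
  obtains w where "\<And>i. i \<le> k \<Longrightarrow> w i \<in> D i p" "v = (\<Sum>i\<le>k. w i)"
proof -
  obtain w where "w \<in> (\<Pi>\<^sub>E i\<in>{..k}. D i p)" "v = (\<Sum>i\<le>k. w i)"
    using slant_conditions[THEN conjunct2, THEN conjunct2, THEN conjunct1] by blast
  then show ?thesis
    using that[of w] by (simp add: PiE_iff)
qed

lemma T_D_pos: "i \<in> {1..k} \<Longrightarrow> v \<in> D i p \<Longrightarrow> T p v \<in> D i p"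
  using slant_conditions[THEN conjunct2, THEN conjunct2, THEN conjunct2, THEN conjunct1] by blast

lemma invariant_D0: "v \<in> D 0 p \<Longrightarrow> \<phi> (f p) (df p v) \<in> df p ` D 0 p"
  using slant_conditions[THEN conjunct2, THEN conjunct2, THEN conjunct2, THEN conjunct2, THEN conjunct1] by blast

lemma slant_angle:
  assumes "i \<in> {1..k}" "v \<in> D i p" "v \<noteq> 0"
  shows "subspace_angle (g (f p)) (\<phi> (f p) (df p v)) (df p ` D i p) = \<theta> i p" "\<theta> i p \<noteq> 0"
proof -
  have "pointwise_slant A B f \<phi> g (D i) (\<theta> i)"
    using slant_conditions[THEN conjunct2, THEN conjunct2, THEN conjunct2, THEN conjunct2, THEN conjunct2, THEN conjunct1]
      assms(1) by blast
  then show "subspace_angle (g (f p)) (\<phi> (f p) (df p v)) (df p ` D i p) = \<theta> i p" "\<theta> i p \<noteq> 0"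
    unfolding pointwise_slant_def using assms(2,3) by blast+
qed

lemma \<phi>_D0:
  assumes "v \<in> D 0 p"
  shows "\<phi> (f p) (df p v) = df p (T p v)" "T p v \<in> D 0 p"
proof -
  obtain u where u: "u \<in> D 0 p" "\<phi> (f p) (df p v) = df p u"
    using invariant_D0[OF assms] by blast
  then have "T p v = u"
    by (simp add: T_op_def tan_part_df)
  with u show "\<phi> (f p) (df p v) = df p (T p v)" "T p v \<in> D 0 p"
    by auto
qed

lemma TT_D0: "v \<in> D 0 p \<Longrightarrow> T p (T p v) = - v"
  using \<phi>_D0[of v p] \<phi>_D0(1)[of "T p v" p] \<phi>_\<phi>[of "f p" "df p v"]
  by (metis linear_neg[OF linear_df] tan_part_df)

lemma T_D: "i \<le> k \<Longrightarrow> v \<in> D i p \<Longrightarrow> T p v \<in> D i p"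
  using T_D_pos \<phi>_D0(2) by (cases "i = 0") auto

text \<open>Pairing the vanishing sum with \<open>w j\<close> leaves only
  \<open>ig p (w j) (w j)\<close>, by orthogonality.\<close>

lemma D_independent:
  assumes w: "\<And>i. i \<le> k \<Longrightarrow> w i \<in> D i p" and sum: "(\<Sum>i\<le>k. w i) = 0" and j: "j \<le> k"
  shows "w j = 0"
proof -
  have "0 = ig p (\<Sum>i\<le>k. w i) (w j)"
    by (simp add: sum ig_simps)
  also have "\<dots> = (\<Sum>i\<le>k. if i = j then ig p (w j) (w j) else 0)"
    unfolding ig_simps by (rule sum.cong) (use w j orthogonal_D in auto)
  also have "\<dots> = ig p (w j) (w j)"
    using j by simp
  finally show ?thesis
    by (simp add: ig_eq_0_iff)
qed

lemma slant_TT: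
  assumes i: "i \<in> {1..k}" and v: "v \<in> D i p" and TT: "T p (T p v) = - v"
  shows "v = 0"
proof (rule ccontr)
  assume "v \<noteq> 0"
  have "\<phi> (f p) (df p v) \<in> df p ` D i p"
    using \<phi>_df_eq_T[OF TT] T_D_pos[OF i v] by simp
  moreover have "\<phi> (f p) (df p v) \<noteq> 0"
    using g_\<phi>[of "f p" "df p v" "df p v"] \<open>v \<noteq> 0\<close> by (metis df_eq_0_iff g_eq_0_iff)
  ultimately have "subspace_angle (g (f p)) (\<phi> (f p) (df p v)) (df p ` D i p) = 0"
    by (rule subspace_angle_mem)
  then show False
    using slant_angle[OF i v \<open>v \<noteq> 0\<close>] by simp
qed

text \<open>On \<open>D 0\<close> the square of \<open>T\<close> is -1. On a slant distribution
  \<open>T p v = 0\<close> makes \<open>\<phi>\<close> of a nonzero \<open>v\<close> orthogonal to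
  all tangent vectors, which forces the angle \<open>pi / 2\<close>.\<close>

lemma slant_T_inj:
  assumes i: "i \<le> k" "\<theta> i p \<noteq> pi / 2" and v: "v \<in> D i p" and T: "T p v = 0"
  shows "v = 0"
proof (rule ccontr)
  assume v0: "v \<noteq> 0"
  show False
  proof (cases "i = 0")
    case True
    then show False
      using TT_D0[of v p] v T v0 by (simp add: linear_0[OF linear_T])
  next
    case False
    then have i': "i \<in> {1..k}"
      using i by simp
    have "g (f p) (\<phi> (f p) (df p v)) (df p w) = 0" for w
      unfolding ig_T[symmetric] by (simp add: T ig_simps)
    then have "subspace_angle (g (f p)) (\<phi> (f p) (df p v)) (df p ` D i p) = pi / 2"
      by (intro subspace_angle_orthogonal[of "df p v"]) (use v v0 df_eq_0_iff in auto)
    then show False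
      using slant_angle[OF i' v v0] i(2) by simp
  qed
qed

lemma D0_eq: "v \<in> D 0 p \<longleftrightarrow> T p (T p v) = - v"
proof
  assume TT: "T p (T p v) = - v"
  obtain w where w: "\<And>i. i \<le> k \<Longrightarrow> w i \<in> D i p" and v: "v = (\<Sum>i\<le>k. w i)"
    using decompose[of p v] by metis
  \<comment> \<open>\<open>T\<close> preserves each \<open>D i\<close>, so the equation for
    \<open>v\<close> splits into one equation per component, and \<open>slant_TT\<close> removes the
    components with positive index.\<close>
  have "T p (T p (w i)) + w i = 0" if i: "i \<le> k" for i
  proof (rule D_independent[of "\<lambda>i. T p (T p (w i)) + w i", OF _ _ i])
    show "T p (T p (w j)) + w j \<in> D j p" if "j \<le> k" for j
      using that w T_D subspace_add[OF subspace_D] by blast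
    show "(\<Sum>j\<le>k. T p (T p (w j)) + w j) = 0"
      using TT unfolding v by (simp add: sum.distrib linear_sum[OF linear_T])
  qed
  then have "w i = 0" if "i \<in> {..k} - {0}" for i
    using slant_TT[of i "w i" p] w that by (simp add: eq_neg_iff_add_eq_0)
  then have "v = w 0"
    unfolding v by (subst sum.remove[of _ 0]) auto
  then show "v \<in> D 0 p"
    using w by simp
qed (rule TT_D0)

text \<open>If \<open>v\<close> is orthogonal to \<open>D 0\<close>, its component
  \<open>w 0\<close> is orthogonal to itself. The description as an orthogonal complement is what
  links the sum to the kernel of \<open>T^2 + 1\<close>.\<close>

lemma sum_distribution_eq: "sum_distribution {1..k} D p = {v. \<forall>z\<in>D 0 p. ig p v z = 0}"
proof (intro set_eqI iffI)
  fix v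
  assume "v \<in> sum_distribution {1..k} D p"
  then obtain w where w: "\<And>i. i \<in> {1..k} \<Longrightarrow> w i \<in> D i p" "v = (\<Sum>i\<in>{1..k}. w i)"
    unfolding sum_distribution_def by blast
  have "ig p v z = 0" if "z \<in> D 0 p" for z
    unfolding w(2) ig_simps by (rule sum.neutral) (use that w(1) orthogonal_D[of _ 0] in auto)
  then show "v \<in> {v. \<forall>z\<in>D 0 p. ig p v z = 0}"
    by simp
next
  fix v
  assume v: "v \<in> {v. \<forall>z\<in>D 0 p. ig p v z = 0}"
  obtain w where w: "\<And>i. i \<le> k \<Longrightarrow> w i \<in> D i p" and sum: "v = (\<Sum>i\<le>k. w i)"
    using decompose[of p v] by metis
  have "0 = ig p v (w 0)"
    using v w by simp
  also have "\<dots> = (\<Sum>i\<le>k. if i = 0 then ig p (w 0) (w 0) else 0)"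
    unfolding sum ig_simps
  proof (rule sum.cong)
    fix i
    assume "i \<in> {..k}"
    then show "ig p (w i) (w 0) = (if i = 0 then ig p (w 0) (w 0) else 0)"
      using orthogonal_D[of i 0 "w i" p "w 0"] w by auto
  qed simp
  also have "\<dots> = ig p (w 0) (w 0)"
    by simp
  finally have "w 0 = 0"
    by (simp add: ig_eq_0_iff)
  moreover have "{..k} = insert 0 {1..k}"
    by auto
  ultimately have "v = (\<Sum>i\<in>{1..k}. w i)"
    unfolding sum by simp
  then show "v \<in> sum_distribution {1..k} D p"
    unfolding sum_distribution_def using w by auto
qed

lemma D0_Int_perp: "v \<in> D 0 p \<Longrightarrow> v \<in> sum_distribution {1..k} D p \<Longrightarrow> v = 0"
  using sum_distribution_eq ig_eq_0_iff by blast

text \<open>The image of a symmetric operator is orthogonal to its kernel.\<close>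

lemma TT_in_perp: "T p (T p v) + v \<in> sum_distribution {1..k} D p"
  unfolding sum_distribution_eq
proof (intro CollectI ballI)
  fix z
  assume "z \<in> D 0 p"
  then show "ig p (T p (T p v) + v) z = 0"
    by (simp only: TT_symmetric TT_D0 left_minus linear_0[OF linear_ig(1)])
qed

text \<open>The components of \<open>T p v\<close> outside \<open>D i\<close> are
  \<open>T p (w j)\<close>; they vanish, and injectivity of \<open>T\<close> on these
  \<open>D j\<close> gives \<open>w j = 0\<close>. Nothing is claimed about the kernel of
  \<open>T\<close> on \<open>D i\<close>, where the angle may be \<open>pi / 2\<close>.\<close>

lemma T_in_D_imp:
  assumes i: "i \<le> k" and \<theta>: "\<And>j. j \<le> k \<Longrightarrow> j \<noteq> i \<Longrightarrow> \<theta> j p \<noteq> pi / 2" and T: "T p v \<in> D i p"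
  shows "v \<in> D i p"
proof -
  obtain w where w: "\<And>j. j \<le> k \<Longrightarrow> w j \<in> D j p" and v: "v = (\<Sum>j\<le>k. w j)"
    using decompose[of p v] by metis
  \<comment> \<open>The components of \<open>T p v - T p v = 0\<close>, the subtracted vector being
    placed in the summand \<open>D i\<close>.\<close>
  let ?z = "\<lambda>j. T p (w j) - (if j = i then T p v else 0)"
  have z: "?z j = 0" if j: "j \<le> k" for j
  proof (rule D_independent[of ?z, OF _ _ j])
    show "?z j \<in> D j p" if "j \<le> k" for j
      using that w T_D T subspace_diff[OF subspace_D] subspace_0[OF subspace_D] by simp
    show "(\<Sum>j\<le>k. ?z j) = 0"
      using i by (simp add: sum_subtractf linear_sum[OF linear_T] v)
  qed
  have "w j = 0" if "j \<in> {..k} - {i}" for j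
  proof (rule slant_T_inj)
    have j: "j \<le> k" "j \<noteq> i"
      using that by auto
    then show "j \<le> k" "\<theta> j p \<noteq> pi / 2" "w j \<in> D j p"
      using \<theta> w by auto
    show "T p (w j) = 0"
      using z[OF j(1)] j(2) by simp
  qed
  then have "v = w i"
    unfolding v using i by (subst sum.remove[of _ i]) auto
  then show ?thesis
    using w i by simp
qed

text \<open>Constant rank comes from complementarity to \<open>D 0\<close>; a local spanning family
  is the union of those of \<open>D 1\<close> to \<open>D k\<close> on the intersection of their
  neighbourhoods.\<close>

lemma distribution_perp: "distribution A (sum_distribution {1..k} D)"
  unfolding distribution_def
proof (intro conjI allI)
  let ?P = "sum_distribution {1..k} D"
  show sub: "subspace (?P p)" for p
    unfolding sum_distribution_eq by (auto simp: subspace_def ig_simps)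
  obtain r where r: "\<And>p. dim (D 0 p) = r"
    using distribution_D[of 0] unfolding distribution_def by blast
  have "dim (?P p) = DIM('e) - r" for p
  proof -
    have "v \<in> {x + y |x y. x \<in> D 0 p \<and> y \<in> ?P p}" for v
    proof -
      obtain w where w: "\<And>j. j \<le> k \<Longrightarrow> w j \<in> D j p" "v = (\<Sum>j\<le>k. w j)"
        using decompose[of p v] by metis
      have "v = w 0 + (\<Sum>j\<in>{1..k}. w j)"
        unfolding w(2) by (subst sum.remove[of _ 0]) (auto intro!: sum.cong)
      moreover have "(\<Sum>j\<in>{1..k}. w j) \<in> ?P p"
        using w(1) unfolding sum_distribution_def by auto
      ultimately show ?thesis
        using w(1) by blast
    qed
    then have "{x + y |x y. x \<in> D 0 p \<and> y \<in> ?P p} = UNIV"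
      by blast
    moreover have "D 0 p \<inter> ?P p = {0}"
      using D0_Int_perp subspace_0[OF subspace_D] subspace_0[OF sub] by blast
    ultimately have "DIM('e) = dim (D 0 p) + dim (?P p)"
      using dim_sums_Int[OF subspace_D[of 0 p] sub[of p]] by (simp only: dim_UNIV) simp
    then show ?thesis
      by (simp add: r)
  qed
  then show "\<exists>r. \<forall>p. dim (?P p) = r"
    by blast
  fix p
  have "\<exists>S F. open S \<and> p \<in> S \<and> finite F \<and> (\<forall>E\<in>F. smooth_vf A S E) \<and> (\<forall>q\<in>S. D i q = span ((\<lambda>E. E q) ` F))"
    if "i \<in> {1..k}" for i
    using distribution_D[of i] that unfolding distribution_def by simp
  then obtain S F where SF: "\<And>i. i \<in> {1..k} \<Longrightarrow> open (S i) \<and> p \<in> S i \<and> finite (F i) \<and> (\<forall>E\<in>F i. smooth_vf A (S i) E) \<and>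
      (\<forall>q\<in>S i. D i q = span ((\<lambda>E. E q) ` F i))"
    by metis
  let ?S = "\<Inter>i\<in>{1..k}. S i" and ?F = "\<Union>i\<in>{1..k}. F i"
  have S: "open ?S" "p \<in> ?S" "finite ?F"
    using SF by auto
  have E: "smooth_vf A ?S E" if "E \<in> ?F" for E
  proof -
    obtain i where "i \<in> {1..k}" "E \<in> F i"
      using \<open>E \<in> ?F\<close> by blast
    then show "smooth_vf A ?S E"
      using SF A.smooth_vf_subset[of "S i" E ?S] by blast
  qed
  have P: "?P q = span ((\<lambda>E. E q) ` ?F)" if q: "q \<in> ?S" for q
  proof
    have D: "D i q = span ((\<lambda>E. E q) ` F i)" if "i \<in> {1..k}" for i
      using SF that q by blast
    have D_le: "D i q \<subseteq> span ((\<lambda>E. E q) ` ?F)" if "i \<in> {1..k}" for i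
      unfolding D[OF that] by (rule span_mono) (use that in blast)
    show "?P q \<subseteq> span ((\<lambda>E. E q) ` ?F)"
    proof
      fix v
      assume "v \<in> ?P q"
      then obtain w where w: "\<And>i. i \<in> {1..k} \<Longrightarrow> w i \<in> D i q" "v = (\<Sum>i\<in>{1..k}. w i)"
        unfolding sum_distribution_def by blast
      show "v \<in> span ((\<lambda>E. E q) ` ?F)"
        unfolding w(2) by (rule span_sum) (use w(1) D_le in blast)
    qed
    have "E q \<in> ?P q" if "i \<in> {1..k}" "E \<in> F i" for i E
    proof -
      have "E q \<in> D i q"
        unfolding D[OF that(1)] by (rule span_base) (use that(2) in blast)
      then show ?thesis
        unfolding sum_distribution_eq using orthogonal_D[of i 0 "E q" q] that(1) by simp
    qed
    then show "span ((\<lambda>E. E q) ` ?F) \<subseteq> ?P q"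
      by (intro span_minimal sub) blast
  qed
  show "\<exists>S F. open S \<and> p \<in> S \<and> finite F \<and> (\<forall>E\<in>F. smooth_vf A S E) \<and> (\<forall>q\<in>S. ?P q = span ((\<lambda>E. E q) ` F))"
    by (intro exI[of _ ?S] exI[of _ ?F] conjI ballI S E P)
qed

text \<open>
  Near each point, the preimage under \<open>T\<^sup>2 + 1\<close> is the solution of a regular system with smooth
  coefficients: adding \<open>K = \<Sum>E. g(E, \<cdot>) E\<close> for a local frame \<open>E\<close> of \<open>\<D>\<^sub>0\<close> makes \<open>T\<^sup>2 + 1\<close> invertible
  without changing it on the orthogonal complement of \<open>\<D>\<^sub>0\<close>.
\<close>

lemma perp_section_eq_TT:
  assumes Y: "Y \<in> sections A (sum_distribution {1..k} D)"
  obtains W where "smooth_vf A UNIV W" "\<And>p. Y p = T p (T p (W p)) + W p"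
proof -
  let ?P = "sum_distribution {1..k} D"
  have Ysm: "smooth_vf A UNIV Y" and YP: "Y p \<in> ?P p" for p
    using Y unfolding sections_def by auto
  have subP: "subspace (?P p)" for p
    using distribution_perp unfolding distribution_def by blast
  have frame: "\<exists>S F. open S \<and> p \<in> S \<and> finite F \<and> (\<forall>E\<in>F. smooth_vf A S E) \<and> (\<forall>q\<in>S. D 0 q = span ((\<lambda>E. E q) ` F))" for p
    using distribution_D[of 0] unfolding distribution_def by simp
  define Q where "Q F q v = (T q (T q v) + v) + (\<Sum>E\<in>F. ig q (E q) v *\<^sub>R E q)" for F :: "('m \<Rightarrow> 'e) set" and q v
  have linQ: "linear (Q F q)" for F q
    unfolding Q_def by (intro linear_compose_add linear_TT linear_compose_sum ballI)
      (auto intro!: linearI simp: ig_simps scaleR_add_left)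
  \<comment> \<open>For \<open>y\<close> in the complement, the correction \<open>?K\<close> lies in
    \<open>D 0\<close> as a combination of the frame, and in the complement as the difference of
    \<open>y\<close> and a value of \<open>T^2 + 1\<close>. Hence it vanishes.\<close>
  have Q0: "T q (T q v) + v = y \<and> v \<in> ?P q"
    if F: "finite F" "D 0 q = span ((\<lambda>E. E q) ` F)" and y: "y \<in> ?P q" and Qv: "Q F q v = y" for F q v y
  proof -
    let ?K = "\<Sum>E\<in>F. ig q (E q) v *\<^sub>R E q"
    have "?K \<in> D 0 q"
      unfolding F(2) by (intro span_sum span_scale span_base) blast
    moreover have "?K = y - (T q (T q v) + v)"
      by (simp only: Qv[unfolded Q_def, symmetric] add_diff_cancel_left')
    then have "?K \<in> ?P q"
      using subspace_diff[OF subP y TT_in_perp] by simp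
    ultimately have K0: "?K = 0"
      by (rule D0_Int_perp)
    \<comment> \<open>Pairing \<open>?K = 0\<close> with \<open>v\<close> gives a sum of squares, so
      \<open>v\<close> is orthogonal to every frame vector; the family \<open>F\<close> need not be
      independent for this.\<close>
    have "(\<Sum>E\<in>F. (ig q (E q) v)\<^sup>2) = 0"
      using arg_cong[OF K0, of "\<lambda>w. ig q w v"] by (simp add: ig_simps power2_eq_square)
    then have E: "ig q v (E q) = 0" if "E \<in> F" for E
      using F(1) that by (simp add: sum_nonneg_eq_0_iff ig_sym[of q v])
    have "ig q v z = 0" if "z \<in> D 0 q" for z
      using that unfolding F(2)
      by (induction rule: span_induct_alt) (auto simp: ig_simps E)
    then have "v \<in> ?P q"
      by (simp add: sum_distribution_eq del: One_nat_def)
    then show ?thesis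
      using Qv K0 by (simp add: Q_def del: One_nat_def)
  qed
  have TT_inj: "v = 0" if "v \<in> ?P q" "T q (T q v) + v = 0" for q v
    using that D0_eq[of v q] D0_Int_perp by (simp add: eq_neg_iff_add_eq_0 del: One_nat_def)
  have injQ: "inj (Q F q)" if F: "finite F" "D 0 q = span ((\<lambda>E. E q) ` F)" for F q
    unfolding linear_injective_0[OF linQ]
    using Q0[OF F subspace_0[OF subP]] TT_inj by blast
  have "\<exists>v. v \<in> ?P p \<and> T p (T p v) + v = Y p" for p
  proof -
    obtain F where F: "finite F" "D 0 p = span ((\<lambda>E. E p) ` F)"
      using frame[of p] by blast
    then have "surj (Q F p)"
      using injQ linQ by (intro linear_injective_imp_surjective) auto
    then obtain v where "Y p = Q F p v"
      by (rule surjE)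
    then show ?thesis
      using Q0[OF F YP, of v] by auto
  qed
  \<comment> \<open>A choice inside the complement solves the system of \<open>Q F\<close> for every
    local frame \<open>F\<close> at once, since the correction term vanishes there. So a globally
    chosen \<open>W\<close> is smooth near each point.\<close>
  then obtain W where W: "\<And>p. W p \<in> ?P p" "\<And>p. T p (T p (W p)) + W p = Y p"
    by metis
  have "smooth_vf A UNIV W"
  proof (rule A.smooth_vf_local)
    fix p
    obtain S F where S: "open S" "p \<in> S" and F: "finite F" "\<And>E. E \<in> F \<Longrightarrow> smooth_vf A S E"
      "\<And>q. q \<in> S \<Longrightarrow> D 0 q = span ((\<lambda>E. E q) ` F)"
      using frame[of p] by blast
    have "smooth_vf A S W"
    proof (rule A.smooth_vf_linear_system[OF S(1), where Q = "Q F" and Y = Y])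
      show "smooth_vf A U (\<lambda>q. Q F q (Z q))" if U: "open U" "U \<subseteq> S" and Z: "smooth_vf A U Z" for U Z
        unfolding Q_def
        by (intro A.smooth_vf_add[OF U(1)] smooth_T A.smooth_vf_sum A.smooth_vf_scaleR ig_smooth U Z
          A.smooth_vf_subset[OF F(2) U(2)])
      show "Q F q (W q) = Y q" if q: "q \<in> S" for q
      proof -
        have "ig q (E q) (W q) = 0" if "E \<in> F" for E
        proof -
          have "E q \<in> D 0 q"
            unfolding F(3)[OF q] by (rule span_base) (use that in blast)
          then show ?thesis
            using W(1)[of q] unfolding sum_distribution_eq by (simp add: ig_sym)
        qed
        then show ?thesis
          by (simp add: Q_def W(2))
      qed
      show "smooth_vf A S Y"
        by (rule A.smooth_vf_subset[OF Ysm]) simp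
      show "inj (Q F q)" if "q \<in> S" for q
        by (rule injQ[OF F(1) F(3)[OF that]])
    qed (rule linQ)
    then show "\<exists>U. open U \<and> p \<in> U \<and> smooth_vf A U W"
      using S by blast
  qed simp
  then show ?thesis
    using that W(2) by metis
qed

section \<open>Parallelism of \<open>D 0\<close> and of its complement\<close>

lemma nab_D0:
  assumes X: "smooth_vf A UNIV X" and Y: "Y \<in> sections A (D 0)"
  shows "nab p (X p) Y \<in> D 0 p"
proof -
  have Ysm: "smooth_vf A UNIV Y" and YD: "\<And>q. Y q \<in> D 0 q"
    using Y unfolding sections_def by auto
  \<comment> \<open>The parallel operator \<open>T^2 + 1\<close> passes through \<open>nab\<close>
    and kills \<open>Y\<close>. The direction \<open>X\<close> is arbitrary, which is needed for the
    second fundamental form below.\<close>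
  have "T p (T p (nab p (X p) Y)) + nab p (X p) Y = nab p (X p) (\<lambda>q. T q (T q (Y q)) + Y q)"
    by (rule nab_TT[OF X Ysm, symmetric])
  also have "\<dots> = 0"
    using TT_D0[OF YD] by (simp add: A.nab_zero)
  finally show ?thesis
    by (simp add: D0_eq eq_neg_iff_add_eq_0)
qed

lemma completely_integrable_D0: "completely_integrable_distribution A nab (D 0)"
  unfolding completely_integrable_distribution_def
proof (intro conjI ballI)
  fix X Y
  assume X: "X \<in> sections A (D 0)" and Y: "Y \<in> sections A (D 0)"
  then have "smooth_vf A UNIV X" "smooth_vf A UNIV Y"
    unfolding sections_def by auto
  then show "(\<lambda>p. nab p (X p) Y) \<in> sections A (D 0)"
    using nab_D0[OF _ Y, of X] A.nab_smooth[OF open_UNIV] unfolding sections_def by simp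
qed (simp add: distribution_D)

text \<open>With \<open>Y\<close> written as \<open>T^2 + 1\<close> applied to a global field
  \<open>W\<close>, its derivative is \<open>T^2 + 1\<close> applied to that of \<open>W\<close>,
  hence again in the complement.\<close>

lemma completely_integrable_perp: "completely_integrable_distribution A nab (sum_distribution {1..k} D)"
  unfolding completely_integrable_distribution_def
proof (intro conjI ballI)
  fix X Y
  assume X: "X \<in> sections A (sum_distribution {1..k} D)" and Y: "Y \<in> sections A (sum_distribution {1..k} D)"
  then have sm: "smooth_vf A UNIV X" "smooth_vf A UNIV Y"
    unfolding sections_def by auto
  obtain W where W: "smooth_vf A UNIV W" "\<And>p. Y p = T p (T p (W p)) + W p"
    using perp_section_eq_TT[OF Y] by metis
  have "Y = (\<lambda>p. T p (T p (W p)) + W p)"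
    by (rule ext) (rule W(2))
  then have "nab p (X p) Y = T p (T p (nab p (X p) W)) + nab p (X p) W" for p
    using nab_TT[OF sm(1) W(1)] by simp
  then have "nab p (X p) Y \<in> sum_distribution {1..k} D p" for p
    using TT_in_perp by (simp del: One_nat_def)
  then show "(\<lambda>p. nab p (X p) Y) \<in> sections A (sum_distribution {1..k} D)"
    using A.nab_smooth[OF open_UNIV sm] unfolding sections_def by simp
qed (rule distribution_perp)

section \<open>Integrability of a single slant distribution\<close>

lemma integrable_iff:
  assumes i: "i \<le> k" and \<theta>: "\<And>p j. j \<le> k \<Longrightarrow> j \<noteq> i \<Longrightarrow> \<theta> j p \<noteq> pi / 2"
  shows "integrable_distribution A (D i) \<longleftrightarrow> (\<forall>X\<in>sections A (D i). \<forall>Y\<in>sections A (D i).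
    (\<lambda>p. nab p (X p) (\<lambda>q. T q (Y q)) - nab p (Y p) (\<lambda>q. T q (X q))) \<in> sections A (D i))"
proof -
  have "lie_bracket A X Y \<in> sections A (D i) \<longleftrightarrow>
      (\<lambda>p. nab p (X p) (\<lambda>q. T q (Y q)) - nab p (Y p) (\<lambda>q. T q (X q))) \<in> sections A (D i)"
    if XY: "X \<in> sections A (D i)" "Y \<in> sections A (D i)" for X Y
  proof -
    have X: "smooth_vf A UNIV X" and Y: "smooth_vf A UNIV Y"
      using XY unfolding sections_def by auto
    \<comment> \<open>Torsion-freeness, with the difference written as a sum with
      \<open>(-1) *\<^sub>R\<close> to match the closure rules for smooth fields.\<close>
    have br: "lie_bracket A X Y = (\<lambda>p. nab p (X p) Y + (-1) *\<^sub>R nab p (Y p) X)"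
      using torsion_nab X Y unfolding torsion_free_def by fastforce
    have brT: "(\<lambda>p. nab p (X p) (\<lambda>q. T q (Y q)) - nab p (Y p) (\<lambda>q. T q (X q))) = (\<lambda>p. T p (lie_bracket A X Y p))"
      unfolding br using nab_T[OF X Y] nab_T[OF Y X] by (simp add: linear_diff[OF linear_T])
    have sm: "smooth_vf A UNIV (lie_bracket A X Y)"
      unfolding br by (intro A.smooth_vf_add A.smooth_vf_scaleR A.smooth_fun_const A.nab_smooth X Y open_UNIV)
    \<comment> \<open>One direction is invariance of \<open>D i\<close> under \<open>T\<close>; the
      converse is \<open>T_in_D_imp\<close>, the only place where the angle condition
      enters.\<close>
    show ?thesis
      unfolding brT sections_def using sm smooth_T[OF open_UNIV sm] T_D[OF i] T_in_D_imp[OF i \<theta>] by blast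
  qed
  then show ?thesis
    unfolding integrable_distribution_def using distribution_D[OF i] by blast
qed

section \<open>The second fundamental form on \<open>D 0\<close>\<close>

lemma \<phi>_second_fund:
  assumes X: "smooth_vf A UNIV X" and Y: "Y \<in> sections A (D 0)"
  shows "\<phi> (f p) (second_fund A B f nabb nab X Y p) = second_fund A B f nabb nab X (\<lambda>q. T q (Y q)) p"
proof -
  have Ysm: "smooth_vf A UNIV Y" and YD: "\<And>q. Y q \<in> D 0 q"
    using Y unfolding sections_def by auto
  have "\<phi> (f p) (second_fund A B f nabb nab X Y p) =
      cov p (X p) (\<lambda>q. \<phi> (f q) (df q (Y q))) - \<phi> (f p) (df p (nab p (X p) Y))"
    unfolding second_fund_def linear_diff[OF linear_\<phi>]
    by (simp add: cov_tensor11[OF tensor parallel open_UNIV _ smooth_along_df[OF open_UNIV Ysm]])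
  \<comment> \<open>Both \<open>Y\<close> and its covariant derivative lie in \<open>D 0\<close>,
    where \<open>\<phi>\<close> acts as \<open>T\<close>; parallelism of \<open>T\<close> then moves
    \<open>T\<close> inside the derivative.\<close>
  also have "\<dots> = second_fund A B f nabb nab X (\<lambda>q. T q (Y q)) p"
    unfolding second_fund_def by (simp add: \<phi>_D0(1)[OF YD] \<phi>_D0(1)[OF nab_D0[OF X Y]] nab_T[OF X Ysm])
  finally show ?thesis .
qed

lemma T_sections_D0: "Y \<in> sections A (D 0) \<Longrightarrow> (\<lambda>q. T q (Y q)) \<in> sections A (D 0)"
  unfolding sections_def using smooth_T[OF open_UNIV] \<phi>_D0(2) by simp

text \<open>\<open>\<phi>\<close> of a value of the second fundamental form is again such a value,
  with \<open>T Y\<close> for \<open>Y\<close>, and therefore normal; so taking the normal part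
  changes nothing.\<close>

lemma n_op_second_fund:
  assumes X: "smooth_vf A UNIV X" and Y: "Y \<in> sections A (D 0)"
  shows "n_op A B f \<phi> g p (second_fund A B f nabb nab X Y p) = \<phi> (f p) (second_fund A B f nabb nab X Y p)"
proof -
  have TY: "(\<lambda>q. T q (Y q)) \<in> sections A (D 0)"
    by (rule T_sections_D0[OF Y])
  let ?h = "second_fund A B f nabb nab X (\<lambda>q. T q (Y q)) p"
  have "?h \<in> normal_at A B f g p"
    using second_fund_normal[OF open_UNIV UNIV_I X] TY unfolding sections_def by simp
  then have "tanp p ?h = 0"
    by (intro tan_part_eqI) (simp add: linear_0[OF linear_df])
  then show "n_op A B f \<phi> g p (second_fund A B f nabb nab X Y p) = \<phi> (f p) (second_fund A B f nabb nab X Y p)"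
    unfolding n_op_def nor_part_def \<phi>_second_fund[OF X Y] by (simp add: linear_0[OF linear_df])
qed

lemma second_fund_eigenvector:
  assumes X: "smooth_vf A UNIV X" and Y: "Y \<in> sections A (D 0)"
    and nz: "second_fund A B f nabb nab X Y \<noteq> (\<lambda>p. 0)"
  shows "n_squared_eigenvector A B f \<phi> g (-1) (second_fund A B f nabb nab X Y)"
  unfolding n_squared_eigenvector_def
proof (intro conjI allI nz)
  have Ysm: "smooth_vf A UNIV Y"
    using Y unfolding sections_def by auto
  show "second_fund A B f nabb nab X Y \<in> normal_sections A B f g"
    unfolding normal_sections_def smooth_vf_along_iff
    using smooth_along_second_fund[OF open_UNIV X Ysm] second_fund_normal[OF open_UNIV UNIV_I X Ysm] by simp
  fix p
  show "n_op A B f \<phi> g p (n_op A B f \<phi> g p (second_fund A B f nabb nab X Y p)) = (-1) *\<^sub>R second_fund A B f nabb nab X Y p"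
    \<comment> \<open>The inner \<open>n\<close> becomes \<open>\<phi>\<close>, which is rewritten
      as replacing \<open>Y\<close> by \<open>T Y\<close>, again a section of \<open>D 0\<close>. So
      the outer \<open>n\<close> becomes \<open>\<phi>\<close> too, and folding back leaves
      \<open>\<phi>\<close> applied twice.\<close>
    unfolding n_op_second_fund[OF X Y] \<phi>_second_fund[OF X Y] n_op_second_fund[OF X T_sections_D0[OF Y]]
    unfolding \<phi>_second_fund[OF X Y, symmetric] by (simp add: \<phi>_\<phi>)
qed

end

theorem theorem3p5:
  fixes A :: "('m::{t2_space,second_countable_topology}, 'e::euclidean_space) chart set"
    and B :: "('n::{t2_space,second_countable_topology}, 'f::euclidean_space) chart set"
    and f :: "'m \<Rightarrow> 'n"
    and \<phi> :: "'n \<Rightarrow> 'f \<Rightarrow> 'f"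
    and g :: "'n \<Rightarrow> 'f \<Rightarrow> 'f \<Rightarrow> real"
    and nabb :: "('n, 'f) connection"
    and nab :: "('m, 'e) connection"
    and k :: nat
    and D :: "nat \<Rightarrow> 'm \<Rightarrow> 'e set"
    and \<theta> :: "nat \<Rightarrow> 'm \<Rightarrow> real"
  assumes "kaehler B \<phi> g nabb"
    and "smooth_atlas A"
    and "injective_immersion A B f"
    and "levi_civita A (induced_metric A B f g) nab"
    and "pointwise_k_slant A B f \<phi> g k D \<theta>"
    and "T_parallel A nab (T_op A B f \<phi> g)"
  shows "(completely_integrable_distribution A nab (D 0) \<and>
          completely_integrable_distribution A nab (sum_distribution {1..k} D))
       \<and> (\<forall>i\<in>{0..k}. (\<forall>p. \<forall>j\<in>{0..k}. j \<noteq> i \<longrightarrow> \<theta> j p \<noteq> pi / 2) \<longrightarrow>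
           (integrable_distribution A (D i) \<longleftrightarrow>
             (\<forall>X\<in>sections A (D i). \<forall>Y\<in>sections A (D i).
               (\<lambda>p. nab p (X p) (\<lambda>q. T_op A B f \<phi> g q (Y q)) -
                    nab p (Y p) (\<lambda>q. T_op A B f \<phi> g q (X q))) \<in> sections A (D i))))
       \<and> ((\<forall>X\<in>sections A (D 0). \<forall>Y\<in>sections A (D 0).
             second_fund A B f nabb nab X Y = (\<lambda>p. 0)) \<or>
          (n_squared_eigenvalue A B f \<phi> g (-1) \<and>
           (\<forall>X\<in>sections A (D 0). \<forall>Y\<in>sections A (D 0).
              second_fund A B f nabb nab X Y \<noteq> (\<lambda>p. 0) \<longrightarrow>
              n_squared_eigenvector A B f \<phi> g (-1) (second_fund A B f nabb nab X Y))))"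
proof -
  have K: "smooth_atlas B" "riemannian_metric B g" "tensor11 B \<phi>" "\<And>p v. \<phi> p (\<phi> p v) = - v"
    "\<And>p u v. g p (\<phi> p u) (\<phi> p v) = g p u v" "affine_connection B nabb" "torsion_free B nabb"
    "metric_connection B g nabb" "parallel_tensor11 B nabb \<phi>"
    using assms(1) unfolding kaehler_def almost_hermitian_def levi_civita_def by blast+
  have L: "affine_connection A nab" "torsion_free A nab" "metric_connection A (induced_metric A B f g) nab"
    using assms(4) unfolding levi_civita_def by blast+
  have F: "smooth_map A B f" "\<And>p. inj (tmap A B f p)"
    using assms(3) unfolding injective_immersion_def by blast+
  interpret parallel_slant_submanifold A B f nabb nab g \<phi> k D \<theta>
    by unfold_locales (fact assms K L F)+
  have sm: "smooth_vf A UNIV X" if "X \<in> sections A (D 0)" for X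
    using that unfolding sections_def by blast
  have ii: "\<forall>i\<in>{0..k}. (\<forall>p. \<forall>j\<in>{0..k}. j \<noteq> i \<longrightarrow> \<theta> j p \<noteq> pi / 2) \<longrightarrow>
     (integrable_distribution A (D i) \<longleftrightarrow>
       (\<forall>X\<in>sections A (D i). \<forall>Y\<in>sections A (D i).
         (\<lambda>p. nab p (X p) (\<lambda>q. T_op A B f \<phi> g q (Y q)) -
              nab p (Y p) (\<lambda>q. T_op A B f \<phi> g q (X q))) \<in> sections A (D i)))"
    by (intro ballI impI integrable_iff) auto
  \<comment> \<open>The dichotomy: a single pair with nonzero second fundamental form already
    provides the eigenvector that witnesses the eigenvalue.\<close>
  have "n_squared_eigenvalue A B f \<phi> g (-1)"
    if "X \<in> sections A (D 0)" "Y \<in> sections A (D 0)" "second_fund A B f nabb nab X Y \<noteq> (\<lambda>p. 0)" for X Y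
    unfolding n_squared_eigenvalue_def using second_fund_eigenvector[OF sm that(2,3)] that(1) by blast
  then show ?thesis
    using completely_integrable_D0 completely_integrable_perp ii second_fund_eigenvector[OF sm] by blast
qed

end
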